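(* Let $\mathcal{S}$ be the family of biquadratic fields $K=\mathbb{Q}(\sqrt{a},\sqrt{b})$ with $a,b$ odd squarefree integers, and for $X>0$ let $\mathcal{S}(X)=\{K\in\mathcal{S}: |\Delta_K|\le X\}$, where $\Delta_K$ is the discriminant of $K$. Let $\mathcal{S}_{\mathcal{E}}=\{K\in\mathcal{S}: K \text{ admits a Euclidean ideal}\}$ and $\mathcal{S}_{\mathcal{E}}(X)=\{K\in\mathcal{S}_{\mathcal{E}}: |\Delta_K|\le X\}$. Then \[ \lim_{X\to\infty}\frac{\#\mathcal{S}_{\mathcal{E}}(X)}{\#\mathcal{S}(X)}=0. \]
   Context: Let $\mathcal{I}$ be the set of nonzero integral ideals of $\mathcal{O}_K$. An ideal $C\in\mathcal{I}$ is a Euclidean ideal if there exist a well-ordered set $W$ and a function $\Psi:\mathcal{I}\to W$ such that for every $I\in\mathcal{I}$ and every $x\in I^{-1}C\setminus C$ there exists $y\in C$ with $\Psi((x-y)IC^{-1})<\Psi(I)$. A field admits a Euclidean ideal if some $C\in\mathcal{I}$ is a Euclidean ideal. *)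

theory Defs
  imports
    Complex_Main
    "HOL-Algebra.Algebraic_Closure_Type"
    "HOL-Algebra.Generated_Fields"
    "HOL-Algebra.Embedded_Algebras"
    "HOL-Algebra.Ideal_Product"
    "HOL-Computational_Algebra.Polynomial"
    "HOL-Computational_Algebra.Squarefree"
    "Jordan_Normal_Form.Determinant"
begin

section \<open>Number fields as subfields of the complex numbers\<close>

text \<open>
  A number field is a set of complex numbers. For the Galois extensions counted below,
  two subfields of the complex numbers are isomorphic only if they are equal, so that counting
  subfields is the same as counting isomorphism classes.
\<close>

abbreviation complex_ring :: "complex ring" where
  "complex_ring \<equiv> ring_of_type_algebra"

definition ring_of_integers :: "complex set \<Rightarrow> complex ring" where
  "ring_of_integers K = complex_ring \<lparr>carrier := {x \<in> K. algebraic_int x}\<rparr>"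

subsection \<open>Discriminant\<close>

text \<open>The restriction to extensional functions makes each embedding occur exactly once.\<close>

definition embeddings :: "complex set \<Rightarrow> (complex \<Rightarrow> complex) set" where
  "embeddings K = Ring.ring_hom (complex_ring \<lparr>carrier := K\<rparr>) complex_ring \<inter> extensional K"

definition field_trace :: "complex set \<Rightarrow> complex \<Rightarrow> complex" where
  "field_trace K x = (\<Sum>\<sigma>\<in>embeddings K. \<sigma> x)"

definition integral_basis :: "complex set \<Rightarrow> complex list \<Rightarrow> bool" where
  "integral_basis K ws \<longleftrightarrow>
     set ws \<subseteq> carrier (ring_of_integers K) \<and>
     (\<forall>x\<in>carrier (ring_of_integers K). \<exists>!cs :: int list. length cs = length ws \<and>
        x = (\<Sum>i<length ws. of_int (cs ! i) * ws ! i))"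

text \<open>
  The determinant is a rational integer and does not depend on the integral basis, because a change
  of integral basis has determinant 1 or -1; so the description below denotes a unique value.
\<close>

definition discriminant :: "complex set \<Rightarrow> int" where
  "discriminant K = (THE d. \<exists>ws. integral_basis K ws \<and>
     of_int d = det (mat (length ws) (length ws) (\<lambda>(i, j). field_trace K (ws ! i * ws ! j))))"

subsection \<open>Euclidean ideals\<close>

definition nonzero_ideals :: "complex set \<Rightarrow> complex set set" where
  "nonzero_ideals K = {I. ideal I (ring_of_integers K) \<and> I \<noteq> {0}}"

definition inverse_ideal :: "complex set \<Rightarrow> complex set \<Rightarrow> complex set" where
  "inverse_ideal K I = {x \<in> K. \<forall>z\<in>I. x * z \<in> carrier (ring_of_integers K)}"

text \<open>
  Products of fractional ideals are formed inside the complex numbers: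
  \<^term>\<open>ideal_prod complex_ring A B\<close> is the set of all finite sums of products \<open>a * b\<close>
  with \<open>a \<in> A\<close> and \<open>b \<in> B\<close>.
\<close>

definition euclidean_function ::
  "complex set \<Rightarrow> complex set \<Rightarrow> 'w set \<Rightarrow> 'w rel \<Rightarrow> (complex set \<Rightarrow> 'w) \<Rightarrow> bool" where
  "euclidean_function K C W r \<Psi> \<longleftrightarrow>
     well_order_on W r \<and>
     \<Psi> ` nonzero_ideals K \<subseteq> W \<and>
     (\<forall>I\<in>nonzero_ideals K. \<forall>x\<in>ideal_prod complex_ring (inverse_ideal K I) C - C. \<exists>y\<in>C.
        (\<Psi> ((\<lambda>z. (x - y) * z) ` ideal_prod complex_ring I (inverse_ideal K C)), \<Psi> I) \<in> r - Id)"

text \<open>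
  One cannot quantify over types inside a definition, so the elements of the well-ordered set are
  taken from the type \<^typ>\<open>complex set\<close>. The lemma \<open>euclidean_idealI\<close> shows that this is no
  restriction.
\<close>

definition euclidean_ideal :: "complex set \<Rightarrow> complex set \<Rightarrow> bool" where
  "euclidean_ideal K C \<longleftrightarrow>
     C \<in> nonzero_ideals K \<and>
     (\<exists>(W :: complex set set) r \<Psi>. euclidean_function K C W r \<Psi>)"

lemma euclidean_idealI:
  fixes W :: "'w set"
  assumes C: "C \<in> nonzero_ideals K" and euc: "euclidean_function K C W r \<Psi>"
  shows "euclidean_ideal K C"
proof -
  define A where "A = W \<inter> range \<Psi>"
  define g where "g = inv_into UNIV \<Psi>"
  define s where "s = Restr r A"
  have wo: "well_order_on W r" using euc by (simp add: euclidean_function_def)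
  have fld: "Field r = W" using wo well_order_on_Field by metis
  have ws: "well_order_on A s"
    unfolding s_def using wo fld by (intro well_order_on_Restr) (auto simp: A_def)
  have fs: "Field s = A" using ws well_order_on_Field by metis
  have inj: "inj_on g A" unfolding g_def A_def by (meson Int_lower2 inj_on_inv_into)
  define t where "t = dir_image s g"
  have "Well_order t" unfolding t_def using ws fs inj by (intro Well_order_dir_image) auto
  moreover have "Field t = g ` A" unfolding t_def using fs by (simp add: dir_image_Field)
  ultimately have wt: "well_order_on (g ` A) t" by simp
  have "euclidean_function K C (g ` A) t (g \<circ> \<Psi>)"
    unfolding euclidean_function_def
  proof (intro conjI ballI wt)
    show "(g \<circ> \<Psi>) ` nonzero_ideals K \<subseteq> g ` A"
      using euc by (auto simp: euclidean_function_def A_def)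
  next
    fix I x assume I: "I \<in> nonzero_ideals K"
      and x: "x \<in> ideal_prod complex_ring (inverse_ideal K I) C - C"
    let ?J = "\<lambda>y. (\<lambda>z. (x - y) * z) ` ideal_prod complex_ring I (inverse_ideal K C)"
    obtain y where y: "y \<in> C" "(\<Psi> (?J y), \<Psi> I) \<in> r - Id"
      using euc I x unfolding euclidean_function_def by blast
    hence mem: "\<Psi> (?J y) \<in> A" "\<Psi> I \<in> A" using fld by (auto simp: A_def Field_def)
    hence "(\<Psi> (?J y), \<Psi> I) \<in> s" using y by (auto simp: s_def)
    hence "(g (\<Psi> (?J y)), g (\<Psi> I)) \<in> t" unfolding t_def dir_image_def by blast
    moreover have "g (\<Psi> (?J y)) \<noteq> g (\<Psi> I)" using mem y inj by (auto dest: inj_onD)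
    ultimately show "\<exists>y\<in>C. ((g \<circ> \<Psi>) (?J y), (g \<circ> \<Psi>) I) \<in> t - Id" using y by auto
  qed
  thus ?thesis using C unfolding euclidean_ideal_def by blast
qed

definition admits_euclidean_ideal :: "complex set \<Rightarrow> bool" where
  "admits_euclidean_ideal K \<longleftrightarrow> (\<exists>C\<in>nonzero_ideals K. euclidean_ideal K C)"

section \<open>The families of biquadratic fields\<close>

text \<open>The degree condition excludes degenerate pairs such as \<open>a = b\<close> or \<open>a = 1\<close>.\<close>

definition odd_biquadratic_fields :: "complex set set" where
  "odd_biquadratic_fields = {K. \<exists>a b :: int. odd a \<and> odd b \<and> squarefree a \<and> squarefree b \<and>
     K = generate_field complex_ring {csqrt (of_int a), csqrt (of_int b)} \<and>
     ring.dimension complex_ring 4 \<rat> K}"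

definition euclidean_odd_biquadratic_fields :: "complex set set" where
  "euclidean_odd_biquadratic_fields = {K \<in> odd_biquadratic_fields. admits_euclidean_ideal K}"

definition up_to_discriminant :: "complex set set \<Rightarrow> real \<Rightarrow> complex set set" where
  "up_to_discriminant F x = {K \<in> F. real_of_int \<bar>discriminant K\<bar> \<le> x}"

end

(* If C is a Euclidean ideal, descent along Psi shows that every ideal class is a power of the class
   of C, so among any two classes of order at most 2 one is trivial, or else their product is.
   For K = Q(sqrt a, sqrt b) and n dividing a, the ideal (n, sqrt a) has square (n). Hence, up to a
   fixed twist n0, all these ideals are principal, and a generator c makes n equal to c^2 times a unit.
   Taking relative norms of c turns that unit into a product of units of the three quadratic
   subfields, and those fall into boundedly many square classes. So a Euclidean ideal bounds the
   number of divisors of a and of b by an absolute constant. Writing a = g r, b = g s with g = gcd a b,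
   the discriminant is at least (g r s)^2, so at most O(sqrt X) fields of the family up to X have a
   Euclidean ideal. On the other hand the fields Q(sqrt p, sqrt b) with p an odd prime contribute
   about sqrt X / p each, and the sum of 1/p diverges, so the whole family outgrows every multiple
   of sqrt X. *)
theory Submission
  imports Defs "Jordan_Normal_Form.Char_Poly"
begin

section \<open>Primes and squarefree numbers\<close>

text \<open>The obstacle is the unit group of the quartic field, whose structure is never
  determined. The identity behind the unit argument is that c^2 times the absolute norm of c is the
  product of the three relative norms of c; since the absolute norm is n^2 up to sign, c^2 is n
  times units of quadratic fields, up to sign. There a smallest unit above 1 is all that is
  required, and square classes are compared in K, so no index of unit groups enters. Each quadratic
  subfield contributes at most 25 classes and the sign contributes 2. Two divisors in one class have
  a product that is a square in K, and integers that become squares in K are rational squares times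
  1, g r, g s or r s. Together with the choice between twisted and untwisted this explains the bound
  8 * 2 * 25^3. No class group is constructed: cyclicity is used as a property of the set of
  exponents k for which C^k is principal, a set of naturals closed under addition and cancellation.
  None of the constants in the two counts has to be sharp, because the divergence of the sum of 1/p
  absorbs each of them.\<close>

lemma squarefree_eq_if_prime_factors_eq:
  fixes m n :: nat
  assumes sq: "squarefree m" "squarefree n" and eq: "prime_factors m = prime_factors n"
  shows "m = n"
proof -
  have nz: "m \<noteq> 0" "n \<noteq> 0" using sq by (auto intro: Nat.gr0I)
  have mult: "multiplicity p m = multiplicity p n" if p: "prime p" for p
  proof (cases "p \<in> prime_factors m")
    case True
    moreover from True have "p \<in> prime_factors n" using eq by simp
    ultimately show ?thesis
      using sq nz squarefree_factorial_semiring'[of m] squarefree_factorial_semiring'[of n] by simp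
  next
    case False
    hence "p \<notin> prime_factors m" "p \<notin> prime_factors n" using eq by auto
    hence "\<not> p dvd m" "\<not> p dvd n" using p nz prime_factorsI by blast+
    thus ?thesis
      using not_dvd_imp_multiplicity_0[of p m] not_dvd_imp_multiplicity_0[of p n] by simp
  qed
  show "m = n"
    by (rule multiplicity_eq_nat) (use nz mult in blast)+
qed

section \<open>Divergence of the sum of the reciprocals of the primes\<close>

text \<open>Split n into a squarefree part and a square. The squarefree part is a product over a
  subset of \<open>A\<close>, which leaves 2 ^ card A choices, and the root of the square is at most
  \<open>N\<close>.\<close>

lemma card_smooth_le:
  fixes A :: "nat set" and N :: nat
  assumes "finite A"
  shows "card {n. 0 < n \<and> n \<le> N\<^sup>2 \<and> prime_factors n \<subseteq> A} \<le> 2 ^ card A * N"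
proof -
  let ?S = "{n. 0 < n \<and> n \<le> N\<^sup>2 \<and> prime_factors n \<subseteq> A}"
  let ?f = "\<lambda>n :: nat. (prime_factors (squarefree_part n), square_part n)"
  have "inj_on ?f ?S"
  proof (rule inj_onI)
    fix m n assume "?f m = ?f n"
    hence pf: "prime_factors (squarefree_part m) = prime_factors (squarefree_part n)"
      and sq: "square_part m = square_part n" by simp_all
    from pf have "squarefree_part m = squarefree_part n"
      by (intro squarefree_eq_if_prime_factors_eq squarefree_squarefree_part)
    with sq show "m = n" by (rule squarefree_decomposition_unique)
  qed
  moreover have "?f ` ?S \<subseteq> Pow A \<times> {1..N}"
  proof (rule image_subsetI)
    fix n assume n: "n \<in> ?S"
    have dvd: "squarefree_part n dvd n" "(square_part n)\<^sup>2 dvd n"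
      using dvd_triv_left[of "squarefree_part n" "(square_part n)\<^sup>2"]
        dvd_triv_right[of "(square_part n)\<^sup>2" "squarefree_part n"]
      by (simp_all only: squarefree_decompose[symmetric])
    have "n \<noteq> 0" "n \<le> N\<^sup>2" "prime_factors n \<subseteq> A" using n by auto
    have "prime_factors (squarefree_part n) \<subseteq> prime_factors n"
      using dvd \<open>n \<noteq> 0\<close> by (intro dvd_prime_factors)
    moreover have "square_part n \<noteq> 0" using dvd \<open>n \<noteq> 0\<close> by (intro notI) simp
    hence "square_part n \<ge> 1" by linarith
    moreover have "(square_part n)\<^sup>2 \<le> n"
      using dvd \<open>n \<noteq> 0\<close> by (intro dvd_imp_le) auto
    hence "(square_part n)\<^sup>2 \<le> N\<^sup>2" using \<open>n \<le> N\<^sup>2\<close> by (rule le_trans)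
    hence "square_part n \<le> N" by (simp add: power2_le_iff_abs_le)
    ultimately show "?f n \<in> Pow A \<times> {1..N}" using \<open>prime_factors n \<subseteq> A\<close> by auto
  qed
  ultimately have "card ?S \<le> card (Pow A \<times> {1..N})"
    using assms by (intro card_inj_on_le) auto
  thus ?thesis using assms by (simp add: card_cartesian_product card_Pow)
qed

lemma card_multiples_le: "card {n. 0 < n \<and> n \<le> (N::nat) \<and> p dvd n} \<le> N div p"
proof (cases "p = 0")
  case False
  have "{n. 0 < n \<and> n \<le> N \<and> p dvd n} \<subseteq> (\<lambda>k. p * k) ` {1..N div p}"
  proof
    fix n assume "n \<in> {n. 0 < n \<and> n \<le> N \<and> p dvd n}"
    then obtain k where "n = p * k" "0 < n" "n \<le> N" by auto
    moreover from this have "k \<le> N div p" using False by (simp add: less_eq_div_iff_mult_less_eq mult.commute)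
    ultimately show "n \<in> (\<lambda>k. p * k) ` {1..N div p}" by (auto intro!: imageI Suc_leI Nat.gr0I)
  qed
  hence "card {n. 0 < n \<and> n \<le> N \<and> p dvd n} \<le> card ((\<lambda>k. p * k) ` {1..N div p})"
    by (intro card_mono) auto
  also have "\<dots> \<le> N div p" using card_image_le[of "{1..N div p}" "\<lambda>k. p * k"] by simp
  finally show ?thesis .
qed auto

text \<open>Following Erdos: if the tail beyond the finite set \<open>A\<close> had sum below \<open>1/2\<close>, more than half
  of the integers up to \<open>N\<^sup>2\<close> would be composed of primes in \<open>A\<close> only.\<close>
lemma ex_primes_reciprocal_sum_ge_half:
  fixes A :: "nat set"
  assumes "finite A"
  shows "\<exists>B. finite B \<and> (\<forall>p\<in>B. prime p) \<and> A \<inter> B = {} \<and> (\<Sum>p\<in>B. 1 / real p) \<ge> 1 / 2"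
proof (rule ccontr)
  assume neg: "\<not> ?thesis"
  \<comment> \<open>With this choice the bound \<open>2 ^ card A * N\<close> on the integers
    composed of primes in \<open>A\<close> is exactly half of N^2, while the multiples of the primes
    in \<open>B\<close> make up less than the other half.\<close>
  define N :: nat where "N = 2 ^ (card A + 1)"
  define B where "B = {p. prime p \<and> p \<le> N\<^sup>2 \<and> p \<notin> A}"
  have finB: "finite B" unfolding B_def by (rule finite_subset[of _ "{..N\<^sup>2}"]) auto
  have "A \<inter> B = {}" "\<forall>p\<in>B. prime p" by (auto simp: B_def)
  hence lt: "(\<Sum>p\<in>B. 1 / real p) < 1 / 2" using neg finB not_le by blast
  let ?S = "{n. 0 < n \<and> n \<le> N\<^sup>2 \<and> prime_factors n \<subseteq> A}"
  let ?M = "\<lambda>p. {n. 0 < n \<and> n \<le> N\<^sup>2 \<and> p dvd n}"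
  have "{1..N\<^sup>2} \<subseteq> ?S \<union> (\<Union>p\<in>B. ?M p)"
  proof
    fix n assume n: "n \<in> {1..N\<^sup>2}"
    show "n \<in> ?S \<union> (\<Union>p\<in>B. ?M p)"
    proof (cases "prime_factors n \<subseteq> A")
      case False
      then obtain p where p: "p \<in> prime_factors n" "p \<notin> A" by auto
      hence "p dvd n" "prime p" by auto
      moreover from this have "p \<le> N\<^sup>2" using n dvd_imp_le[of p n] by auto
      ultimately show ?thesis using n p by (auto simp: B_def)
    qed (use n in auto)
  qed
  hence "card {1..N\<^sup>2} \<le> card (?S \<union> (\<Union>p\<in>B. ?M p))"
    using finB by (intro card_mono) auto
  also have "\<dots> \<le> card ?S + card (\<Union>p\<in>B. ?M p)" by (rule card_Un_le)
  also have "card (\<Union>p\<in>B. ?M p) \<le> (\<Sum>p\<in>B. card (?M p))" using finB by (rule card_UN_le)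
  also have "\<dots> \<le> (\<Sum>p\<in>B. N\<^sup>2 div p)" by (intro sum_mono card_multiples_le)
  also have "card ?S \<le> 2 ^ card A * N" by (rule card_smooth_le[OF assms])
  finally have "N\<^sup>2 \<le> 2 ^ card A * N + (\<Sum>p\<in>B. N\<^sup>2 div p)" by simp
  hence "real (N\<^sup>2) \<le> real (2 ^ card A * N + (\<Sum>p\<in>B. N\<^sup>2 div p))"
    by (subst of_nat_le_iff)
  also have "\<dots> = 2 ^ card A * real N + (\<Sum>p\<in>B. real (N\<^sup>2 div p))" by simp
  also have "(\<Sum>p\<in>B. real (N\<^sup>2 div p)) \<le> (\<Sum>p\<in>B. real (N\<^sup>2) * (1 / real p))"
  proof (rule sum_mono)
    show "real (N\<^sup>2 div p) \<le> real (N\<^sup>2) * (1 / real p)" for p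
      using of_nat_div_le_of_nat[where 'a = real, of "N\<^sup>2" p] by simp
  qed
  also have "\<dots> = real (N\<^sup>2) * (\<Sum>p\<in>B. 1 / real p)" by (simp add: sum_distrib_left)
  also have "\<dots> < real (N\<^sup>2) * (1 / 2)"
    using lt by (intro mult_strict_left_mono) (auto simp: N_def)
  finally have "real (N\<^sup>2) / 2 < 2 ^ card A * real N" by simp
  moreover have "real N = 2 * 2 ^ card A" by (simp add: N_def)
  ultimately show False by (simp add: power2_eq_square)
qed

lemma ex_odd_primes_reciprocal_sum_ge:
  "\<exists>P :: nat set. finite P \<and> (\<forall>p\<in>P. prime p \<and> odd p) \<and> (\<Sum>p\<in>P. 1 / real p) \<ge> H"
proof -
  have "\<exists>P :: nat set. finite P \<and> (\<forall>p\<in>P. prime p \<and> odd p) \<and> (\<Sum>p\<in>P. 1 / real p) \<ge> real k / 2" for k :: nat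
  proof (induction k)
    case 0
    show ?case by (intro exI[of _ "{}"]) auto
  next
    case (Suc k)
    then obtain P :: "nat set" where P: "finite P" "\<forall>p\<in>P. prime p \<and> odd p" "(\<Sum>p\<in>P. 1 / real p) \<ge> real k / 2"
      by blast
    \<comment> \<open>Adding 2 to the excluded set makes the new primes odd; excluding
      \<open>P\<close> makes them new, so that each round adds at least 1/2.\<close>
    obtain B where B: "finite B" "\<forall>p\<in>B. prime p" "insert 2 P \<inter> B = {}" "(\<Sum>p\<in>B. 1 / real p) \<ge> 1 / 2"
      using ex_primes_reciprocal_sum_ge_half[of "insert 2 P"] P(1) by auto
    have "(\<Sum>p\<in>P \<union> B. 1 / real p) = (\<Sum>p\<in>P. 1 / real p) + (\<Sum>p\<in>B. 1 / real p)"
      using P B by (intro sum.union_disjoint) auto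
    moreover have "odd p" if "p \<in> B" for p
    proof -
      have "p \<noteq> 2" "prime p" using B that by auto
      thus ?thesis using prime_odd_nat[of p] prime_ge_2_nat[of p] by linarith
    qed
    ultimately show ?case using P B by (intro exI[of _ "P \<union> B"]) (auto simp: add_divide_distrib)
  qed
  moreover obtain k :: nat where "real k \<ge> 2 * H" using real_arch_simple by blast
  ultimately obtain P :: "nat set" where "finite P" "\<forall>p\<in>P. prime p \<and> odd p" "(\<Sum>p\<in>P. 1 / real p) \<ge> real k / 2"
    by blast
  with \<open>real k \<ge> 2 * H\<close> have "(\<Sum>p\<in>P. 1 / real p) \<ge> H" by linarith
  thus ?thesis using \<open>finite P\<close> \<open>\<forall>p\<in>P. prime p \<and> odd p\<close> by blast
qed

section \<open>Odd squarefree integers in an interval\<close>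

text \<open>As 2 is invertible modulo \<open>m\<close>, the condition fixes j modulo
  \<open>m\<close>, and j is then determined by its quotient \<open>j div m\<close>.\<close>

lemma card_residue_class_le:
  fixes m J :: nat
  assumes "m > 0" "coprime m 2"
  shows "card {j. j < J \<and> m dvd 2 * j + 1} \<le> J div m + 1"
proof -
  let ?S = "{j. j < J \<and> m dvd 2 * j + 1}"
  have "inj_on (\<lambda>j. j div m) ?S"
  proof (rule inj_onI)
    fix i j assume ij: "i \<in> ?S" "j \<in> ?S" and eq: "i div m = j div m"
    have "m dvd (2 * i + 1) - (2 * j + 1)" "m dvd (2 * j + 1) - (2 * i + 1)"
      using ij by (blast intro: dvd_diff_nat)+
    hence "m dvd 2 * (i - j)" "m dvd 2 * (j - i)" by (simp_all add: diff_mult_distrib2)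
    hence *: "m dvd i - j" "m dvd j - i" using assms(2) by (simp_all add: coprime_dvd_mult_right_iff)
    have "i mod m = j mod m"
    proof (cases "i \<le> j")
      case True
      thus ?thesis using *(2) mod_eq_dvd_iff_nat by metis
    next
      case False
      hence "j \<le> i" by simp
      thus ?thesis using *(1) mod_eq_dvd_iff_nat by metis
    qed
    thus "i = j" using eq by (metis div_mult_mod_eq)
  qed
  moreover have "(\<lambda>j. j div m) ` ?S \<subseteq> {..J div m}" by (auto intro: div_le_mono)
  ultimately have "card ?S \<le> card {..J div m}" by (intro card_inj_on_le) auto
  thus ?thesis by simp
qed

text \<open>Since (2 i + 1)^2 exceeds 4 i (i + 1), the sum is bounded by a telescoping one. The
  resulting 1/4 is small enough to leave a positive proportion in the sieve below.\<close>

lemma sum_inverse_odd_squares_le: "(\<Sum>i=1..n. 1 / (real (2 * i + 1))\<^sup>2) \<le> 1 / 4 * (1 - 1 / (real n + 1))"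
proof (induction n)
  case (Suc n)
  have "1 / (real (2 * Suc n + 1))\<^sup>2 \<le> 1 / (4 * ((real n + 1) * (real n + 2)))"
    by (intro divide_left_mono) (auto simp: power2_eq_square algebra_simps intro!: add_pos_nonneg)
  also have "\<dots> = 1 / 4 * (1 / (real n + 1) - 1 / (real n + 2))"
    by (simp add: field_simps)
  finally have "1 / (real (2 * Suc n + 1))\<^sup>2 \<le> \<dots>" .
  with Suc.IH show ?case by (simp add: algebra_simps)
qed auto

text \<open>A sieve on the numbers 2 j + 1 with j < J: it discards 1, the multiples of
  \<open>p\<close> (at most J/3 + 1 as p is at least 3) and the multiples of odd squares (at most
  J/4 plus one for each square). The condition J \<ge> 200 is what makes sqrt (2 J) at most J/10, so
  that the rounding errors stay small.\<close>

lemma odd_squarefree_count: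
  fixes p J :: nat
  assumes p: "prime p" "odd p" and J: "J \<ge> 200"
  shows "real (card {b. odd b \<and> squarefree b \<and> \<not> p dvd b \<and> 1 < b \<and> b < 2 * J}) \<ge> real J / 4"
proof -
  let ?G = "{b. odd b \<and> squarefree b \<and> \<not> p dvd b \<and> 1 < b \<and> b < 2 * J}"
  \<comment> \<open>Every odd q = 2 i + 1 whose square is at most 2 J has i at most
    \<open>I\<close>.\<close>
  define I where "I = nat \<lfloor>sqrt (2 * real J) / 2\<rfloor>"
  let ?B = "\<lambda>m. {j. j < J \<and> m dvd 2 * j + 1}"
  have "{..<J} \<subseteq> (\<lambda>b. b div 2) ` ?G \<union> {0} \<union> ?B p \<union> (\<Union>i\<in>{1..I}. ?B ((2 * i + 1)\<^sup>2))"
  proof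
    fix j assume j: "j \<in> {..<J}"
    show "j \<in> (\<lambda>b. b div 2) ` ?G \<union> {0} \<union> ?B p \<union> (\<Union>i\<in>{1..I}. ?B ((2 * i + 1)\<^sup>2))"
    proof (cases "j = 0 \<or> j \<in> ?B p \<or> \<not> squarefree (2 * j + 1)")
      case False
      hence "2 * j + 1 \<in> ?G" using j by auto
      moreover have "j = (2 * j + 1) div 2" by simp
      ultimately show ?thesis by blast
    next
      case True
      show ?thesis
      proof (cases "squarefree (2 * j + 1)")
        case False
        then obtain q where q: "q\<^sup>2 dvd 2 * j + 1" "\<not> q dvd 1" by (auto simp: squarefree_def)
        have "odd q"
        proof
          assume "even q"
          hence "even (2 * j + 1)" using q(1) by (meson dvd_trans dvd_power pos2)
          thus False by simp
        qed
        moreover have "q \<noteq> 1" using q by auto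
        moreover from \<open>odd q\<close> obtain i where "q = 2 * i + 1" by (rule oddE)
        ultimately have i: "q = 2 * i + 1" "i \<ge> 1" by simp_all
        have "q\<^sup>2 \<le> 2 * J" using dvd_imp_le[OF q(1)] j by auto
        hence "(real q)\<^sup>2 \<le> 2 * real J" by (metis of_nat_le_iff of_nat_mult of_nat_numeral of_nat_power)
        hence "real q \<le> sqrt (2 * real J)" by (simp add: real_le_rsqrt)
        hence "real i \<le> sqrt (2 * real J) / 2" using i by simp
        hence "i \<le> I" unfolding I_def by (simp add: le_nat_floor)
        thus ?thesis using q(1) i j by auto
      qed (use True j in auto)
    qed
  qed
  hence "card {..<J} \<le> card ((\<lambda>b. b div 2) ` ?G \<union> {0} \<union> ?B p \<union> (\<Union>i\<in>{1..I}. ?B ((2 * i + 1)\<^sup>2)))"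
    by (intro card_mono) auto
  also have "\<dots> \<le> card ((\<lambda>b. b div 2) ` ?G) + card {0::nat} + card (?B p) + card (\<Union>i\<in>{1..I}. ?B ((2 * i + 1)\<^sup>2))"
    by (meson add_le_mono card_Un_le le_trans order_refl)
  also have "card ((\<lambda>b. b div 2) ` ?G) \<le> card ?G" by (rule card_image_le) auto
  also have "card (?B p) \<le> J div p + 1"
    using p prime_gt_0_nat by (intro card_residue_class_le) (auto simp: coprime_commute)
  also have "card (\<Union>i\<in>{1..I}. ?B ((2 * i + 1)\<^sup>2)) \<le> (\<Sum>i=1..I. card (?B ((2 * i + 1)\<^sup>2)))"
    by (intro card_UN_le) auto
  also have "\<dots> \<le> (\<Sum>i=1..I. J div (2 * i + 1)\<^sup>2 + 1)"
    by (intro sum_mono card_residue_class_le) auto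
  finally have "J \<le> card ?G + 1 + (J div p + 1) + (\<Sum>i=1..I. J div (2 * i + 1)\<^sup>2 + 1)" by simp
  hence "real J \<le> real (card ?G + 1 + (J div p + 1) + (\<Sum>i=1..I. J div (2 * i + 1)\<^sup>2 + 1))"
    by (subst of_nat_le_iff)
  also have "\<dots> = real (card ?G) + 2 + real (J div p) + (\<Sum>i=1..I. real (J div (2 * i + 1)\<^sup>2)) + real I"
    by (simp add: sum.distrib)
  also have "(\<Sum>i=1..I. real (J div (2 * i + 1)\<^sup>2)) \<le> (\<Sum>i=1..I. real J * (1 / (real (2 * i + 1))\<^sup>2))"
  proof (rule sum_mono)
    show "real (J div (2 * i + 1)\<^sup>2) \<le> real J * (1 / (real (2 * i + 1))\<^sup>2)" for i
      using of_nat_div_le_of_nat[where 'a = real, of J "(2 * i + 1)\<^sup>2"] by simp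
  qed
  also have "\<dots> = real J * (\<Sum>i=1..I. 1 / (real (2 * i + 1))\<^sup>2)" by (simp add: sum_distrib_left)
  also have "\<dots> \<le> real J * (1 / 4)"
  proof (rule mult_left_mono)
    have "1 / 4 * (1 - 1 / (real I + 1)) \<le> 1 / 4" by simp
    with sum_inverse_odd_squares_le[of I] show "(\<Sum>i=1..I. 1 / (real (2 * i + 1))\<^sup>2) \<le> 1 / 4" by linarith
  qed simp
  also have "real (J div p) \<le> real J / 3"
  proof -
    have "p \<ge> 3" using p prime_ge_2_nat[of p] by (cases "p = 2") auto
    have "real (J div p) \<le> real J / real p" by (rule of_nat_div_le_of_nat)
    also have "\<dots> \<le> real J / 3" using \<open>p \<ge> 3\<close> by (intro divide_left_mono) auto
    finally show ?thesis .
  qed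
  also have "real I \<le> sqrt (2 * real J) / 2"
    unfolding I_def by (rule of_nat_floor) simp
  also have "sqrt (2 * real J) \<le> real J / 10"
  proof (rule real_le_lsqrt)
    have "200 * real J \<le> real J * real J" using J by (intro mult_right_mono) auto
    thus "2 * real J \<le> (real J / 10)\<^sup>2" by (simp add: power2_eq_square)
  qed auto
  finally show ?thesis using J by simp
qed

section \<open>Algebraic integers\<close>

interpretation zmod: Modules.module "\<lambda>(n :: int) (x :: complex). of_int n * x"
  by unfold_locales (auto simp: algebra_simps)

text \<open>The determinant trick: multiplication by x on the generators is described by an integer
  matrix, the generators form an eigenvector for x, and the characteristic polynomial is monic with
  integer coefficients. The element \<open>w0\<close> makes this eigenvector nonzero; the generators
  may be linearly dependent.\<close>

lemma algebraic_int_if_stabilises_lattice: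
  fixes x :: complex
  assumes W: "finite W" "w0 \<in> W" "w0 \<noteq> 0"
    and stable: "\<And>w. w \<in> W \<Longrightarrow> x * w \<in> zmod.span W"
  shows "algebraic_int x"
proof -
  define n where "n = card W"
  obtain e where e: "bij_betw e {..<n} W"
    using ex_bij_betw_nat_finite[OF W(1)] by (auto simp: n_def atLeast0LessThan)
  have "\<exists>c :: nat \<Rightarrow> int. x * e i = (\<Sum>j<n. of_int (c j) * e j)" if "i < n" for i
  proof -
    have "e i \<in> W" using e that by (auto simp: bij_betw_def)
    hence "x * e i \<in> zmod.span W" by (rule stable)
    then obtain u where "x * e i = (\<Sum>w\<in>W. of_int (u w) * w)"
      by (auto simp: zmod.span_finite[OF W(1)])
    also have "\<dots> = (\<Sum>j<n. of_int (u (e j)) * e j)"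
      using e by (intro sum.reindex_bij_betw[symmetric])
    finally show ?thesis by (intro exI[of _ "\<lambda>j. u (e j)"])
  qed
  then obtain c :: "nat \<Rightarrow> nat \<Rightarrow> int" where c: "\<And>i. i < n \<Longrightarrow> x * e i = (\<Sum>j<n. of_int (c i j) * e j)"
    by metis
  define B :: "int mat" where "B = mat n n (\<lambda>(i, j). c i j)"
  define A :: "complex mat" where "A = map_mat of_int B"
  have BA: "B \<in> carrier_mat n n" "A \<in> carrier_mat n n" by (auto simp: A_def B_def)
  define v where "v = vec n e"
  have "A *\<^sub>v v = x \<cdot>\<^sub>v v"
  proof (rule eq_vecI)
    fix i assume "i < dim_vec (x \<cdot>\<^sub>v v)"
    hence i: "i < n" by (simp add: v_def)
    have "(A *\<^sub>v v) $ i = (\<Sum>j<n. of_int (c i j) * e j)"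
      using i by (simp add: A_def B_def v_def scalar_prod_def atLeast0LessThan)
    thus "(A *\<^sub>v v) $ i = (x \<cdot>\<^sub>v v) $ i" using c[OF i] i by (simp add: v_def)
  qed (use BA in \<open>auto simp: v_def\<close>)
  moreover have "v \<noteq> 0\<^sub>v n"
  proof
    assume v0: "v = 0\<^sub>v n"
    obtain i where "i < n" "e i = w0" using e W(2) by (force simp: bij_betw_def)
    moreover from this have "v $ i = w0" by (simp add: v_def)
    ultimately show False using v0 W(3) by simp
  qed
  ultimately have "eigenvalue A x"
    unfolding eigenvalue_def eigenvector_def using BA by (intro exI[of _ v]) (auto simp: v_def)
  hence "poly (char_poly A) x = 0" using eigenvalue_root_char_poly[OF BA(2)] by simp
  moreover have "char_poly A = map_poly of_int (char_poly B)"
    unfolding A_def by (rule of_int_hom.char_poly_hom[OF BA(1)])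
  ultimately show ?thesis
    using degree_monic_char_poly[OF BA(1)] by (auto simp: algebraic_int_altdef_ipoly)
qed

lemma algebraic_int_power_in_span:
  fixes x :: complex
  assumes "algebraic_int x"
  obtains m where "m > 0" "x ^ m \<in> zmod.span ((\<lambda>i. x ^ i) ` {..<m})"
proof -
  from assms obtain p where p: "lead_coeff p = 1" "\<forall>i. coeff p i \<in> \<int>" "poly p x = 0"
    by (auto elim: algebraic_int.cases)
  let ?m = "degree p"
  have "?m > 0" using p by (intro Nat.gr0I) (auto elim!: degree_eq_zeroE)
  have "0 = (\<Sum>i\<le>?m. coeff p i * x ^ i)" using p(3) by (simp add: poly_altdef)
  also have "{..?m} = insert ?m {..<?m}" by auto
  finally have "x ^ ?m = - (\<Sum>i<?m. coeff p i * x ^ i)" using p(1) by (simp add: add_eq_0_iff)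
  also have "\<dots> \<in> zmod.span ((\<lambda>i. x ^ i) ` {..<?m})"
  proof (intro zmod.span_neg zmod.span_sum)
    fix i assume "i \<in> {..<?m}"
    moreover obtain k where "coeff p i = of_int k" using p(2) by (auto elim: Ints_cases)
    ultimately show "coeff p i * x ^ i \<in> zmod.span ((\<lambda>i. x ^ i) ` {..<?m})"
      by (simp add: zmod.span_scale zmod.span_base)
  qed
  finally show ?thesis using \<open>?m > 0\<close> by (rule that[rotated])
qed

text \<open>The finitely many products x^i y^j below the degrees of monic equations for x and y span
  a lattice that is stable under both x and y, hence under their sum and product.\<close>

lemma
  fixes x y :: complex
  assumes "algebraic_int x" "algebraic_int y"
  shows algebraic_int_add: "algebraic_int (x + y)" and algebraic_int_mult: "algebraic_int (x * y)"
proof -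
  obtain m where m: "m > 0" "x ^ m \<in> zmod.span ((\<lambda>i. x ^ i) ` {..<m})"
    using algebraic_int_power_in_span[OF assms(1)] .
  obtain k where k: "k > 0" "y ^ k \<in> zmod.span ((\<lambda>i. y ^ i) ` {..<k})"
    using algebraic_int_power_in_span[OF assms(2)] .
  define W where "W = (\<lambda>(i, j). x ^ i * y ^ j) ` ({..<m} \<times> {..<k})"
  have fin: "finite W" unfolding W_def by simp
  have one: "1 \<in> W" unfolding W_def using m(1) k(1) by (intro image_eqI[of _ _ "(0, 0)"]) auto
  have W: "x ^ i * y ^ j \<in> W" if "i < m" "j < k" for i j
    using that unfolding W_def by (intro image_eqI[of _ _ "(i, j)"]) auto
  have mult_span: "b * u \<in> zmod.span T"
    if "u \<in> zmod.span S" "\<And>s. s \<in> S \<Longrightarrow> b * s \<in> zmod.span T" for b u :: complex and S T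
    using that(1)
  proof (induction rule: zmod.span_induct_alt)
    case (step c s u)
    have "b * (of_int c * s + u) = of_int c * (b * s) + b * u" by (simp add: algebra_simps)
    thus ?case using step that(2) by (simp add: zmod.span_add zmod.span_scale)
  qed (simp add: zmod.span_zero)
  have xW: "x * w \<in> zmod.span W" if "w \<in> W" for w
  proof -
    from that obtain i j where w: "w = x ^ i * y ^ j" "i < m" "j < k" by (auto simp: W_def)
    show ?thesis
    proof (cases "Suc i < m")
      case True
      thus ?thesis using W[of "Suc i" j] w by (auto intro!: zmod.span_base simp: mult.assoc)
    next
      case False
      hence "m = Suc i" using w by simp
      hence "x * w = y ^ j * x ^ m" using w by simp
      also have "\<dots> \<in> zmod.span W"
        using m(2) by (rule mult_span) (use w W in \<open>auto intro!: zmod.span_base simp: mult.commute[of "y ^ j"]\<close>)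
      finally show ?thesis .
    qed
  qed
  have yW: "y * w \<in> zmod.span W" if "w \<in> W" for w
  proof -
    from that obtain i j where w: "w = x ^ i * y ^ j" "i < m" "j < k" by (auto simp: W_def)
    show ?thesis
    proof (cases "Suc j < k")
      case True
      moreover have "y * w = x ^ i * y ^ Suc j" using w by simp
      ultimately show ?thesis using W[of i "Suc j"] w zmod.span_base by metis
    next
      case False
      hence "k = Suc j" using w by simp
      hence "y * w = x ^ i * y ^ k" using w by (simp add: mult_ac)
      also have "\<dots> \<in> zmod.span W"
        using k(2) by (rule mult_span) (use w W in \<open>auto intro!: zmod.span_base\<close>)
      finally show ?thesis .
    qed
  qed
  show "algebraic_int (x + y)"
    using fin one by (rule algebraic_int_if_stabilises_lattice)
      (use xW yW in \<open>auto simp: distrib_right intro: zmod.span_add\<close>)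
  show "algebraic_int (x * y)"
    using fin one by (rule algebraic_int_if_stabilises_lattice)
      (use mult_span[OF yW xW] in \<open>auto simp: mult.assoc\<close>)
qed

lemma algebraic_int_diff: "algebraic_int x \<Longrightarrow> algebraic_int y \<Longrightarrow> algebraic_int (x - y :: complex)"
  using algebraic_int_add[of x "- y"] by simp

lemma algebraic_int_of_int [simp]: "algebraic_int (of_int n :: complex)"
  by (intro int_imp_algebraic_int) auto

lemma algebraic_int_power_cancel:
  assumes "algebraic_int (x ^ n :: complex)" "n > 0"
  shows "algebraic_int x"
  using assms(1) by (rule algebraic_int_root[where p = "monom 1 n"])
    (use assms(2) in \<open>auto simp: poly_monom degree_monom_eq lead_coeff_monom\<close>)

text \<open>A ring homomorphism fixes the integers, so it maps roots of a monic integer polynomial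
  to roots of the same polynomial. The domain \<open>S\<close> is a mere set, which admits
  conjugations defined by coordinates on a subset of the complex numbers.\<close>

lemma algebraic_int_hom:
  fixes h :: "complex \<Rightarrow> complex"
  assumes x: "algebraic_int x" "x \<in> S"
    and S: "\<And>n. of_int n \<in> S" "\<And>a b. a \<in> S \<Longrightarrow> b \<in> S \<Longrightarrow> a + b \<in> S" "\<And>a b. a \<in> S \<Longrightarrow> b \<in> S \<Longrightarrow> a * b \<in> S"
    and h: "\<And>n. h (of_int n) = of_int n" "\<And>a b. a \<in> S \<Longrightarrow> b \<in> S \<Longrightarrow> h (a + b) = h a + h b"
      "\<And>a b. a \<in> S \<Longrightarrow> b \<in> S \<Longrightarrow> h (a * b) = h a * h b"
  shows "algebraic_int (h x)"
proof -
  obtain p where p: "poly (map_poly of_int p) x = 0" "lead_coeff p = 1"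
    using x(1) by (auto simp: algebraic_int_altdef_ipoly)
  have "poly (map_poly of_int q) x \<in> S \<and> h (poly (map_poly of_int q) x) = poly (map_poly of_int q) (h x)" for q
  proof (induction q)
    case 0
    thus ?case using S(1)[of 0] h(1)[of 0] by simp
  next
    case (pCons a q)
    thus ?case using S h x(2) by (auto simp: map_poly_pCons)
  qed
  from this[of p] have "poly (map_poly of_int p) (h x) = 0" using p h(1)[of 0] by simp
  thus ?thesis using p(2) by (auto simp: algebraic_int_altdef_ipoly)
qed

section \<open>Units of quadratic fields\<close>

text \<open>In lowest terms the square of the denominator would divide \<open>d\<close>. This is the
  device that removes denominators from coordinates with respect to square roots.\<close>

lemma rat_square_times_squarefree_int:
  fixes r :: rat and d M :: int
  assumes "squarefree d" "of_int d * r\<^sup>2 = of_int M"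
  shows "r \<in> \<int>"
proof -
  obtain p q where pq: "q > 0" "coprime p q" "r = of_int p / of_int q"
    by (metis Fract_of_int_quotient Rat_cases_nonzero quotient_of_unique)
  have "of_int (d * p\<^sup>2) = (of_int (M * q\<^sup>2) :: rat)"
    using assms(2) pq by (simp add: power_divide field_simps)
  hence "d * p\<^sup>2 = M * q\<^sup>2" by (simp only: of_int_eq_iff)
  hence "q\<^sup>2 dvd d * p\<^sup>2" by simp
  moreover have "coprime (q\<^sup>2) (p\<^sup>2)" using pq by (simp add: coprime_commute)
  ultimately have "q\<^sup>2 dvd d" by (simp add: coprime_dvd_mult_left_iff)
  hence "q = 1" using assms(1) pq(1) by (auto dest: squarefreeD)
  thus ?thesis using pq by simp
qed

lemma squarefree_not_rat_square:
  fixes q :: rat and d :: int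
  assumes "squarefree d" "d \<noteq> 1"
  shows "q\<^sup>2 \<noteq> of_int d"
proof
  assume eq: "q\<^sup>2 = of_int d"
  hence "of_int d * (1 / q)\<^sup>2 = of_int 1" using assms by (auto simp: power_divide)
  hence "1 / q \<in> \<int>" by (rule rat_square_times_squarefree_int[OF assms(1)])
  then obtain k where k: "1 / q = of_int k" by (auto elim: Ints_cases)
  have "of_int (d * k\<^sup>2) = (of_int 1 :: rat)"
    using \<open>of_int d * (1 / q)\<^sup>2 = of_int 1\<close> unfolding k by simp
  hence "d * k\<^sup>2 = 1" by (simp only: of_int_eq_iff)
  hence "d = 1" by (smt (verit) pos_zmult_eq_1_iff zero_le_power2 zmult_eq_1_iff)
  thus False using assms by simp
qed

lemma of_real_of_rat: "of_real (of_rat q) = (of_rat q :: complex)"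
  by (cases q) (simp add: of_rat_rat)

text \<open>The root \<delta> is not fixed to be the principal one: the third root \<gamma> of a
  biquadratic field is obtained from the product of the other two and may carry either sign.\<close>

locale quadratic_field =
  fixes d :: int and \<delta> :: complex
  assumes sqrt: "\<delta>\<^sup>2 = of_int d" and sqf: "squarefree d" and ne_1: "d \<noteq> 1"
begin

lemma sqrt': "\<delta> * \<delta> = of_int d"
  using sqrt by (simp add: power2_eq_square)

definition F :: "complex set" where
  "F = {of_rat x + of_rat y * \<delta> | x y. True}"

lemma in_F [simp]: "of_rat x + of_rat y * \<delta> \<in> F"
  by (auto simp: F_def)

lemma F_E: assumes "u \<in> F" obtains x y where "u = of_rat x + of_rat y * \<delta>"
  using assms by (auto simp: F_def)

lemma norm_ne_0: assumes "x \<noteq> 0 \<or> y \<noteq> (0 :: rat)" shows "x\<^sup>2 - of_int d * y\<^sup>2 \<noteq> 0"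
proof
  assume eq: "x\<^sup>2 - of_int d * y\<^sup>2 = 0"
  hence "y \<noteq> 0" using assms by auto
  hence "(x / y)\<^sup>2 = of_int d" using eq by (simp add: power_divide field_simps)
  thus False using squarefree_not_rat_square[OF sqf ne_1] by blast
qed

lemma mult_conj:
  "(of_rat x + of_rat y * \<delta>) * (of_rat x - of_rat y * \<delta>) = of_rat (x\<^sup>2 - of_int d * y\<^sup>2)"
proof -
  have "(of_rat x + of_rat y * \<delta>) * (of_rat x - of_rat y * \<delta>) = (of_rat x)\<^sup>2 - \<delta>\<^sup>2 * (of_rat y)\<^sup>2"
    by (simp add: power2_eq_square algebra_simps)
  thus ?thesis using sqrt by (simp add: of_rat_diff of_rat_mult of_rat_power)
qed

lemma eq_0_iff: "of_rat x + of_rat y * \<delta> = 0 \<longleftrightarrow> x = 0 \<and> y = 0"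
proof
  assume "of_rat x + of_rat y * \<delta> = 0"
  hence "of_rat (x\<^sup>2 - of_int d * y\<^sup>2) = (0 :: complex)" by (simp flip: mult_conj)
  thus "x = 0 \<and> y = 0" using norm_ne_0[of x y] by auto
qed simp

lemma coords_unique:
  assumes "of_rat x + of_rat y * \<delta> = of_rat x' + of_rat y' * \<delta>"
  shows "x = x'" "y = y'"
proof -
  have "of_rat (x - x') + of_rat (y - y') * \<delta> = 0"
    using assms by (simp add: of_rat_diff algebra_simps)
  thus "x = x'" "y = y'" by (simp_all add: eq_0_iff)
qed

lemma mult_coords:
  "(of_rat x + of_rat y * \<delta>) * (of_rat x' + of_rat y' * \<delta>) =
     of_rat (x * x' + of_int d * (y * y')) + of_rat (x * y' + y * x') * \<delta>"
proof -
  have "(of_rat x + of_rat y * \<delta>) * (of_rat x' + of_rat y' * \<delta>) =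
    of_rat x * of_rat x' + (\<delta> * \<delta>) * (of_rat y * of_rat y') + (of_rat x * of_rat y' + of_rat y * of_rat x') * \<delta>"
    by (simp add: algebra_simps)
  thus ?thesis unfolding sqrt' by (simp add: of_rat_add of_rat_mult)
qed

lemma F_mult: "u \<in> F \<Longrightarrow> v \<in> F \<Longrightarrow> u * v \<in> F"
  by (elim F_E) (auto simp: mult_coords)

lemma F_of_rat: "of_rat x \<in> F"
  using in_F[of x 0] by simp

lemma F_of_int: "of_int n \<in> F"
  using F_of_rat[of "of_int n"] by simp

lemma F_add: "u \<in> F \<Longrightarrow> v \<in> F \<Longrightarrow> u + v \<in> F"
proof (elim F_E)
  fix x y x' y' assume uv: "u = of_rat x + of_rat y * \<delta>" "v = of_rat x' + of_rat y' * \<delta>"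
  have "u + v = of_rat (x + x') + of_rat (y + y') * \<delta>"
    unfolding uv by (simp add: of_rat_add algebra_simps)
  thus "u + v \<in> F" by (simp add: in_F)
qed

lemma F_uminus: "u \<in> F \<Longrightarrow> - u \<in> F"
  using F_mult[of "of_rat (-1)" u] F_of_rat[of "-1"] by (simp add: of_rat_minus)

lemma inverse_coords:
  assumes "x \<noteq> 0 \<or> y \<noteq> 0"
  shows "1 / (of_rat x + of_rat y * \<delta>) =
    of_rat (x / (x\<^sup>2 - of_int d * y\<^sup>2)) + of_rat (- y / (x\<^sup>2 - of_int d * y\<^sup>2)) * \<delta>"
proof -
  let ?n = "x\<^sup>2 - of_int d * y\<^sup>2"
  have "of_rat ?n \<noteq> (0 :: complex)" using norm_ne_0[OF assms] by simp
  moreover from assms have "of_rat x + of_rat y * \<delta> \<noteq> 0" by (simp add: eq_0_iff)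
  ultimately have "1 / (of_rat x + of_rat y * \<delta>) = (of_rat x - of_rat y * \<delta>) / of_rat ?n"
    using mult_conj[of x y] by (simp add: divide_simps mult.commute)
  also have "\<dots> = of_rat (x / ?n) + of_rat (- y / ?n) * \<delta>"
    by (simp add: of_rat_divide of_rat_minus diff_divide_distrib)
  finally show ?thesis .
qed

lemma F_diff: "u \<in> F \<Longrightarrow> v \<in> F \<Longrightarrow> u - v \<in> F"
  using F_add[of u "- v"] F_uminus[of v] by simp

lemma F_inverse: assumes "u \<in> F" shows "1 / u \<in> F"
proof (cases "u = 0")
  case True
  thus ?thesis using F_of_rat[of 0] by simp
next
  case False
  obtain x y where u: "u = of_rat x + of_rat y * \<delta>" using assms by (rule F_E)
  with False have "x \<noteq> 0 \<or> y \<noteq> 0" by (auto simp: eq_0_iff)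
  thus ?thesis unfolding u by (auto simp: inverse_coords)
qed

lemma algebraic_int_conj:
  assumes "algebraic_int (of_rat x + of_rat y * \<delta>)"
  shows "algebraic_int (of_rat x - of_rat y * \<delta>)"
proof -
  \<comment> \<open>Conjugation on \<open>F\<close>, well defined because coordinates are unique;
    its values outside \<open>F\<close> do not matter.\<close>
  define h where "h u = (THE v. \<exists>x y. u = of_rat x + of_rat y * \<delta> \<and> v = of_rat x - of_rat y * \<delta>)" for u
  have h: "h (of_rat x + of_rat y * \<delta>) = of_rat x - of_rat y * \<delta>" for x y
    unfolding h_def by (rule the_equality) (auto dest: coords_unique)
  have "algebraic_int (h (of_rat x + of_rat y * \<delta>))"
    using assms
  proof (rule algebraic_int_hom[where S = F])
    show "of_int n \<in> F" for n using F_of_rat[of "of_int n"] by simp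
    show "h (of_int n) = of_int n" for n using h[of "of_int n" 0] by simp
  next
    fix u v assume "u \<in> F" "v \<in> F"
    then obtain x y x' y' where uv: "u = of_rat x + of_rat y * \<delta>" "v = of_rat x' + of_rat y' * \<delta>"
      by (elim F_E)
    have uv': "u + v = of_rat (x + x') + of_rat (y + y') * \<delta>"
      by (simp add: uv of_rat_add algebra_simps)
    thus "u + v \<in> F" by auto
    show "h (u + v) = h u + h v"
      unfolding uv' unfolding uv h by (simp add: of_rat_add algebra_simps)
    show "u * v \<in> F" using \<open>u \<in> F\<close> \<open>v \<in> F\<close> by (rule F_mult)
    have "h u * h v = of_rat (x * x' + of_int d * (y * y')) - of_rat (x * y' + y * x') * \<delta>"
      using mult_coords[of x "-y" x' "-y'"] unfolding uv h
      by (simp add: of_rat_minus of_rat_add of_rat_mult of_rat_diff algebra_simps)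
    thus "h (u * v) = h u * h v" unfolding uv mult_coords h by simp
  qed auto
  thus ?thesis unfolding h .
qed

lemma algebraic_int_rat: "algebraic_int (of_rat x :: complex) \<Longrightarrow> \<exists>n. x = of_int n"
proof -
  assume "algebraic_int (of_rat x :: complex)"
  hence "of_rat x \<in> (\<int> :: complex set)" by (rule rational_algebraic_int_is_int) simp
  then obtain n where "of_rat x = (of_int n :: complex)" by (auto elim: Ints_cases)
  hence "of_rat x = (of_rat (of_int n) :: complex)" by simp
  thus ?thesis by (intro exI[of _ n]) (simp only: of_rat_eq_iff)
qed

text \<open>Trace and norm are rational algebraic integers, so 2 x and x^2 - d y^2 are integers.
  Then d (2 y)^2 is an integer as well, and 2 y is integral because \<open>d\<close> is
  squarefree.\<close>

lemma integral_coords: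
  assumes "algebraic_int (of_rat x + of_rat y * \<delta>)"
  obtains A B N :: int where "x = of_int A / 2" "y = of_int B / 2" "A\<^sup>2 - d * B\<^sup>2 = 4 * N"
proof -
  have conj: "algebraic_int (of_rat x - of_rat y * \<delta>)" using assms by (rule algebraic_int_conj)
  have "algebraic_int (of_rat (2 * x) :: complex)"
    using algebraic_int_add[OF assms conj] by (simp add: of_rat_mult)
  then obtain A where A: "2 * x = of_int A" using algebraic_int_rat by blast
  have "algebraic_int (of_rat (x\<^sup>2 - of_int d * y\<^sup>2) :: complex)"
    using algebraic_int_mult[OF assms conj] by (simp only: mult_conj)
  then obtain N where N: "x\<^sup>2 - of_int d * y\<^sup>2 = of_int N" using algebraic_int_rat by blast
  have "of_int d * (2 * y)\<^sup>2 = (2 * x)\<^sup>2 - 4 * of_int N"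
    by (simp flip: N add: power_mult_distrib algebra_simps)
  also have "\<dots> = of_int (A\<^sup>2 - 4 * N)" by (simp add: A)
  finally have *: "of_int d * (2 * y)\<^sup>2 = of_int (A\<^sup>2 - 4 * N)" .
  from rat_square_times_squarefree_int[OF sqf this] obtain B where B: "2 * y = of_int B"
    by (auto elim: Ints_cases)
  have "of_int (d * B\<^sup>2) = (of_int (A\<^sup>2 - 4 * N) :: rat)" using * unfolding B by simp
  hence "d * B\<^sup>2 = A\<^sup>2 - 4 * N" by (simp only: of_int_eq_iff)
  thus ?thesis using A B by (intro that[of A B N]) (auto simp: field_simps)
qed

section \<open>Units of a quadratic field modulo squares\<close>

definition U :: "complex set" where
  "U = {u \<in> F. u \<noteq> 0 \<and> algebraic_int u \<and> algebraic_int (1 / u)}"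

lemma U_mult: "u \<in> U \<Longrightarrow> v \<in> U \<Longrightarrow> u * v \<in> U"
  using algebraic_int_mult[of "1 / u" "1 / v"] by (auto simp: U_def intro: F_mult algebraic_int_mult)

lemma U_inverse: "u \<in> U \<Longrightarrow> inverse u \<in> U"
  using F_inverse[of u] by (auto simp: U_def inverse_eq_divide)

lemma one_in_U: "1 \<in> U"
  using F_of_rat[of 1] by (auto simp: U_def)

lemma uminus_U: "u \<in> U \<Longrightarrow> - u \<in> U"
  by (auto simp: U_def F_uminus)

lemma U_power: "u \<in> U \<Longrightarrow> u ^ n \<in> U"
  by (induction n) (auto intro: U_mult one_in_U)

lemma U_power_int: "u \<in> U \<Longrightarrow> u powi n \<in> U"
  by (auto simp: power_int_def intro: U_power U_inverse)

text \<open>The norms of u and of 1 / u are integers with product 1, so the norm of u is 1 or -1;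
  clearing the denominator 2 gives the Pell equation with right-hand side 4 or -4.\<close>

lemma U_coords:
  assumes "u \<in> U"
  obtains A B :: int where "u = of_rat (of_int A / 2) + of_rat (of_int B / 2) * \<delta>"
    "A\<^sup>2 - d * B\<^sup>2 = 4 \<or> A\<^sup>2 - d * B\<^sup>2 = - 4"
proof -
  obtain x y where u: "u = of_rat x + of_rat y * \<delta>" using assms by (auto simp: U_def elim: F_E)
  let ?n = "x\<^sup>2 - of_int d * y\<^sup>2"
  have "algebraic_int u" "algebraic_int (1 / u)" "u \<noteq> 0" using assms by (auto simp: U_def)
  hence nz: "x \<noteq> 0 \<or> y \<noteq> 0" by (auto simp: u)
  obtain A B N where AB: "x = of_int A / 2" "y = of_int B / 2" "A\<^sup>2 - d * B\<^sup>2 = 4 * N"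
    using \<open>algebraic_int u\<close> unfolding u by (rule integral_coords)
  obtain A' B' N' where AB': "x / ?n = of_int A' / 2" "- y / ?n = of_int B' / 2" "A'\<^sup>2 - d * B'\<^sup>2 = 4 * N'"
    using \<open>algebraic_int (1 / u)\<close> unfolding u inverse_coords[OF nz] by (rule integral_coords)
  have "?n = of_int (A\<^sup>2 - d * B\<^sup>2) / 4" by (simp add: AB(1,2) power_divide diff_divide_distrib)
  hence n: "?n = of_int N" by (simp add: AB(3))
  have "(x / ?n)\<^sup>2 - of_int d * (- y / ?n)\<^sup>2 = of_int (A'\<^sup>2 - d * B'\<^sup>2) / 4"
    unfolding AB'(1,2) by (simp add: power_divide diff_divide_distrib)
  hence n': "(x / ?n)\<^sup>2 - of_int d * (- y / ?n)\<^sup>2 = of_int N'" by (simp add: AB'(3))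
  have "(x / ?n)\<^sup>2 - of_int d * (- y / ?n)\<^sup>2 = ?n / ?n\<^sup>2"
    by (simp add: power_divide diff_divide_distrib)
  also have "\<dots> = 1 / ?n" by (simp add: power2_eq_square)
  finally have "1 / of_int N = (of_int N' :: rat)" using n n' by simp
  hence "of_int (N * N') = (of_int 1 :: rat)" using norm_ne_0[OF nz] n by (auto simp: field_simps)
  hence "N * N' = 1" by (simp only: of_int_eq_iff)
  hence "N = 1 \<or> N = - 1" by (auto simp: zmult_eq_1_iff)
  thus ?thesis using AB(3) u[unfolded AB(1,2)] by (intro that[of A B]) auto
qed

lemma real_sqrt:
  assumes "d > 0"
  obtains D where "\<delta> = of_real D" "D\<^sup>2 = of_int d" "\<bar>D\<bar> \<ge> 1"
proof -
  have re: "(Re \<delta>)\<^sup>2 - (Im \<delta>)\<^sup>2 = of_int d" and im: "Re \<delta> * Im \<delta> = 0"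
    using sqrt by (auto simp: complex_eq_iff power2_eq_square)
  have "Im \<delta> = 0"
  proof (rule ccontr)
    assume "Im \<delta> \<noteq> 0"
    hence "- (Im \<delta>)\<^sup>2 = of_int d" using re im by simp
    moreover have "(Im \<delta>)\<^sup>2 \<ge> 0" by simp
    ultimately show False using assms by linarith
  qed
  hence D: "\<delta> = of_real (Re \<delta>)" "(Re \<delta>)\<^sup>2 = of_int d" using re by (auto simp: complex_eq_iff)
  have "1\<^sup>2 \<le> \<bar>Re \<delta>\<bar>\<^sup>2" using D(2) assms by simp
  hence "1 \<le> \<bar>Re \<delta>\<bar>" by (rule power2_le_imp_le) simp
  with D show ?thesis by (rule that)
qed

text \<open>The conjugate of a unit r > 1 has absolute value 1 / r < 1. Sum and difference of r and
  its conjugate are therefore bounded by b + 1, which leaves finitely many integer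
  coordinates.\<close>

lemma finite_bounded_units:
  assumes "d > 0"
  shows "finite {r :: real. of_real r \<in> U \<and> 1 < r \<and> r \<le> b}"
proof -
  obtain D where D: "\<delta> = of_real D" "D\<^sup>2 = of_int d" "\<bar>D\<bar> \<ge> 1" using real_sqrt[OF assms] .
  define c where "c = \<lceil>b\<rceil> + 1"
  have "{r :: real. of_real r \<in> U \<and> 1 < r \<and> r \<le> b} \<subseteq>
    (\<lambda>(A, B). of_int A / 2 + of_int B / 2 * D) ` ({-c..c} \<times> {-c..c})"
  proof clarify
    fix r :: real assume r: "of_real r \<in> U" "1 < r" "r \<le> b"
    obtain A B where AB: "of_real r = of_rat (of_int A / 2) + of_rat (of_int B / 2) * \<delta>"
      "A\<^sup>2 - d * B\<^sup>2 = 4 \<or> A\<^sup>2 - d * B\<^sup>2 = - 4"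
      using r(1) by (rule U_coords)
    have "complex_of_real r = of_real (of_int A / 2 + of_int B / 2 * D)"
      using AB(1) by (simp add: D of_rat_divide)
    hence r_eq: "r = of_int A / 2 + of_int B / 2 * D" by (simp only: of_real_eq_iff)
    define r' where "r' = of_int A / 2 - of_int B / 2 * D"
    have "r * r' = (of_int A / 2)\<^sup>2 - (of_int B / 2)\<^sup>2 * D\<^sup>2"
      by (simp add: r_eq r'_def algebra_simps power2_eq_square)
    also have "\<dots> = of_int (A\<^sup>2 - d * B\<^sup>2) / 4" by (simp add: D power_divide diff_divide_distrib)
    also have "\<bar>\<dots>\<bar> = 1"
    proof -
      have "\<bar>x / 4\<bar> = 1" if "x = 4 \<or> x = - 4" for x :: real using that by auto
      moreover have "real_of_int (A\<^sup>2 - d * B\<^sup>2) = 4 \<or> real_of_int (A\<^sup>2 - d * B\<^sup>2) = - 4"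
        using AB(2) by (metis of_int_minus of_int_numeral)
      ultimately show ?thesis by blast
    qed
    finally have "\<bar>r * r'\<bar> = 1" .
    hence "\<bar>r'\<bar> = 1 / r" using r(2) by (simp add: abs_mult field_simps)
    hence r': "\<bar>r'\<bar> < 1" using r(2) by simp
    have "of_int A = r + r'" by (simp add: r_eq r'_def)
    hence "\<bar>of_int A\<bar> \<le> b + 1" using r r' by linarith
    moreover have "of_int B * D = r - r'" by (simp add: r_eq r'_def)
    hence "\<bar>of_int B * D\<bar> \<le> b + 1" using r r' by linarith
    moreover have "\<bar>of_int B\<bar> * 1 \<le> \<bar>of_int B :: real\<bar> * \<bar>D\<bar>" using D(3) by (intro mult_left_mono) auto
    ultimately have "\<bar>of_int A\<bar> \<le> b + 1" "\<bar>of_int B\<bar> \<le> b + 1" by (simp_all add: abs_mult)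
    hence "\<bar>A\<bar> \<le> c" "\<bar>B\<bar> \<le> c" unfolding c_def by linarith+
    thus "r \<in> (\<lambda>(A, B). of_int A / 2 + of_int B / 2 * D) ` ({-c..c} \<times> {-c..c})"
      unfolding r_eq by (intro image_eqI[of _ _ "(A, B)"]) auto
  qed
  thus ?thesis by (rule finite_subset) auto
qed

lemma U_real:
  assumes "d > 0" "u \<in> U"
  obtains r :: real where "u = of_real r"
proof -
  obtain D where D: "\<delta> = of_real D" using real_sqrt[OF assms(1)] .
  obtain x y where "u = of_rat x + of_rat y * \<delta>" using assms(2) by (auto simp: U_def elim: F_E)
  also have "\<dots> = of_real (of_rat x + of_rat y * D)"
    by (simp add: D of_real_of_rat)
  finally show ?thesis by (rule that)
qed

lemma U_subset_F: "U \<subseteq> F" and zero_notin_U: "0 \<notin> U"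
  by (auto simp: U_def)

text \<open>Existence of a nontrivial unit is not established: if no unit exceeds 1, the units are 1
  and -1; otherwise \<open>e\<close> is the smallest unit above 1, and every positive unit is a
  power of it.\<close>

lemma real_unit_square_classes:
  assumes "d > 0"
  obtains e where "e \<in> U" "\<And>u. u \<in> U \<Longrightarrow> \<exists>v\<in>U. u \<in> {v\<^sup>2, - v\<^sup>2, e * v\<^sup>2, - (e * v\<^sup>2)}"
proof (cases "\<exists>r :: real. of_real r \<in> U \<and> r > 1")
  case False
  have "u \<in> {1\<^sup>2, - 1\<^sup>2}" if u: "u \<in> U" for u
  proof -
    obtain r where r: "u = of_real r" using U_real[OF assms u] .
    have "of_real r \<in> U" "of_real (- r) \<in> U" "of_real (inverse r) \<in> U" "of_real (- inverse r) \<in> U"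
      using u uminus_U[OF u] U_inverse[OF u] uminus_U[OF U_inverse[OF u]] by (simp_all add: r)
    hence "r \<le> 1" "- r \<le> 1" "inverse r \<le> 1" "- inverse r \<le> 1" using False by (meson not_le)+
    moreover have "r \<noteq> 0" using zero_notin_U u r by auto
    ultimately have "r = 1 \<or> r = - 1" by (cases "r > 0") (auto simp: field_simps)
    thus ?thesis by (auto simp: r)
  qed
  with one_in_U show ?thesis by (intro that[of 1]) blast+
next
  case True
  then obtain r0 :: real where r0: "of_real r0 \<in> U" "r0 > 1" by blast
  let ?S = "{r :: real. of_real r \<in> U \<and> 1 < r \<and> r \<le> r0}"
  define e where "e = Min ?S"
  have fin: "finite ?S" "?S \<noteq> {}" using finite_bounded_units[OF assms] r0 by auto
  have e: "of_real e \<in> U" "1 < e" "e \<le> r0" using Min_in[OF fin] by (auto simp: e_def)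
  have min: "r = 1" if r: "of_real r \<in> U" "1 \<le> r" "r < e" for r :: real
  proof (rule ccontr)
    assume "r \<noteq> 1"
    hence "r \<in> ?S" using r e by auto
    hence "e \<le> r" unfolding e_def by (intro Min_le[OF fin(1)])
    thus False using r by simp
  qed
  have pos: "\<exists>v\<in>U. of_real r \<in> {v\<^sup>2, of_real e * v\<^sup>2}" if r: "of_real r \<in> U" "r > 0" for r :: real
  proof -
    \<comment> \<open>Dividing by a power of e^2, rather than of e, removes a square of a unit and
      leaves some s with 1 \<le> s < e^2. Minimality of e then forces s = 1 or s = e.\<close>
    define q where "q = e\<^sup>2"
    have q: "q > 1" using e by (simp add: q_def)
    define k where "k = \<lfloor>log q r\<rfloor>"
    have "q powr of_int k \<le> q powr log q r" "q powr log q r < q powr (of_int k + 1)"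
      using q by (simp_all add: k_def)
    hence k: "q powi k \<le> r" "r < q powi k * q"
      using q r by (simp_all add: powr_add powr_real_of_int')
    have qk: "q powi k = (e powi k)\<^sup>2"
      using e by (simp add: q_def power2_eq_square power_int_mult_distrib)
    define s where "s = r / q powi k"
    have pos: "q powi k > 0" using q by simp
    have s: "1 \<le> s" "s < q" using k pos by (simp_all add: s_def divide_simps mult.commute)
    have ek: "of_real (e powi k) \<in> U" using U_power_int[OF e(1), of k] by simp
    have "of_real s = of_real r * inverse ((of_real (e powi k))\<^sup>2 :: complex)"
      by (simp add: s_def qk divide_inverse)
    hence sU: "of_real s \<in> U" using U_mult[OF r(1) U_inverse[OF U_power[OF ek]]] by simp
    have rs: "of_real r = of_real s * (of_real (e powi k) :: complex)\<^sup>2"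
      using pos by (simp add: s_def qk)
    show ?thesis
    proof (cases "s < e")
      case True
      hence "s = 1" using min[OF sU] s by simp
      thus ?thesis using rs ek by (intro bexI[of _ "of_real (e powi k)"]) auto
    next
      case False
      have "of_real (s * inverse e) \<in> U" using U_mult[OF sU U_inverse[OF e(1)]] by simp
      moreover have "1 \<le> s * inverse e" "s * inverse e < e"
        using False s e by (simp_all add: q_def field_simps power2_eq_square)
      ultimately have "s * inverse e = 1" by (rule min)
      hence "s = e" using e by (simp add: field_simps)
      thus ?thesis using rs ek by (intro bexI[of _ "of_real (e powi k)"]) auto
    qed
  qed
  show ?thesis
  proof (rule that[OF e(1)])
    fix u assume u: "u \<in> U"
    obtain r where r: "u = of_real r" using U_real[OF assms u] .
    have "r \<noteq> 0" using zero_notin_U u r by auto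
    then consider "r > 0" | "- r > 0" by linarith
    thus "\<exists>v\<in>U. u \<in> {v\<^sup>2, - v\<^sup>2, of_real e * v\<^sup>2, - (of_real e * v\<^sup>2)}"
    proof cases
      case 1
      thus ?thesis using pos[of r] u r by auto
    next
      case 2
      have "of_real (- r) \<in> U" using uminus_U[OF u] by (simp add: r)
      then obtain v where "v \<in> U" "- u \<in> {v\<^sup>2, of_real e * v\<^sup>2}" using pos[OF _ 2] r by auto
      thus ?thesis by (intro bexI[of _ v]) (auto simp: minus_equation_iff[of u])
    qed
  qed
qed

text \<open>The bound is uniform in \<open>d\<close>. Real fields need four classes; in imaginary
  ones the Pell equation gives A^2 + B^2 \<le> 4, so the units themselves lie among the 5 * 5 pairs
  of coordinates between -2 and 2.\<close>

lemma unit_square_class_representatives: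
  "\<exists>E. finite E \<and> card E \<le> 25 \<and> (\<forall>u\<in>U. \<exists>e\<in>E. \<exists>v\<in>F. v \<noteq> 0 \<and> u = e * v\<^sup>2)"
proof (cases "d > 0")
  case True
  obtain e where e: "e \<in> U" "\<And>u. u \<in> U \<Longrightarrow> \<exists>v\<in>U. u \<in> {v\<^sup>2, - v\<^sup>2, e * v\<^sup>2, - (e * v\<^sup>2)}"
    using real_unit_square_classes[OF True] by blast
  let ?E = "{1, - 1, e, - e}"
  have "card ?E \<le> 4" using card_length[of "[1, - 1, e, - e]"] by simp
  moreover have "\<exists>e'\<in>?E. \<exists>v\<in>F. v \<noteq> 0 \<and> u = e' * v\<^sup>2" if u: "u \<in> U" for u
  proof -
    obtain v where "v \<in> U" "u \<in> {v\<^sup>2, - v\<^sup>2, e * v\<^sup>2, - (e * v\<^sup>2)}" using e(2)[OF u] by blast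
    moreover from this have "v \<in> F" "v \<noteq> 0" using U_subset_F zero_notin_U by auto
    ultimately show ?thesis by auto
  qed
  ultimately show ?thesis by (intro exI[of _ ?E] conjI ballI) auto
next
  case False
  hence d: "d \<le> - 1" using sqf by (cases "d = 0") auto
  let ?f = "\<lambda>(A, B). of_rat (of_int A / 2) + of_rat (of_int B / 2) * \<delta>"
  let ?S = "{-2..2 :: int} \<times> {-2..2 :: int}"
  have "card (?f ` ?S) \<le> card ?S" by (rule card_image_le) auto
  moreover have "\<exists>e\<in>?f ` ?S. \<exists>v\<in>F. v \<noteq> 0 \<and> u = e * v\<^sup>2" if u: "u \<in> U" for u
  proof -
    obtain A B where AB: "u = of_rat (of_int A / 2) + of_rat (of_int B / 2) * \<delta>"
      "A\<^sup>2 - d * B\<^sup>2 = 4 \<or> A\<^sup>2 - d * B\<^sup>2 = - 4"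
      using u by (rule U_coords)
    have "1 * B\<^sup>2 \<le> (- d) * B\<^sup>2" using d by (intro mult_right_mono) auto
    hence "A\<^sup>2 + B\<^sup>2 \<le> 4" using AB(2) zero_le_power2[of A] zero_le_power2[of B] by linarith
    hence "A\<^sup>2 \<le> 4" "B\<^sup>2 \<le> 4" using zero_le_power2[of A] zero_le_power2[of B] by linarith+
    hence "\<bar>A\<bar> \<le> 2" "\<bar>B\<bar> \<le> 2" using power2_le_iff_abs_le[of 2 A] power2_le_iff_abs_le[of 2 B] by simp_all
    hence "u \<in> ?f ` ?S" unfolding AB(1) by (intro image_eqI[of _ _ "(A, B)"]) auto
    thus ?thesis using F_of_rat[of 1] by (intro bexI[of _ u] bexI[of _ 1]) auto
  qed
  ultimately show ?thesis by (intro exI[of _ "?f ` ?S"] conjI ballI) auto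
qed

end

section \<open>Biquadratic fields\<close>

lemma complex_ring_simps [simp]:
  "carrier complex_ring = UNIV" "\<one>\<^bsub>complex_ring\<^esub> = 1" "\<zero>\<^bsub>complex_ring\<^esub> = 0"
  "x \<oplus>\<^bsub>complex_ring\<^esub> y = x + y" "x \<otimes>\<^bsub>complex_ring\<^esub> y = x * y"
  by (simp_all add: ring_of_type_algebra_def)

text \<open>Separates the commutative rearrangement from the relations between the roots, so that
  \<open>A * A\<close>, \<open>B * G\<close> and the like appear literally and can be replaced by
  rewriting.\<close>

lemma expand_biquadratic_product:
  fixes A B G :: "'a :: comm_ring_1"
  shows "(x + y * A + z * B + w * G) * (x' + y' * A + z' * B + w' * G) =
      x * x' + y * y' * (A * A) + z * z' * (B * B) + w * w' * (G * G)
    + (x * y' + y * x') * A + (z * w' + w * z') * (B * G)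
    + (x * z' + z * x') * B + (y * w' + w * y') * (A * G)
    + (x * w' + w * x') * G + (y * z' + z * y') * (A * B)"
  by (simp only: distrib_left distrib_right mult_ac add_ac)

text \<open>Any field \<open>\<rat>(\<surd>a, \<surd>b)\<close> has this shape with \<open>g = gcd a b\<close>; \<open>g\<close>, \<open>r\<close>, \<open>s\<close> play symmetric roles, and the three
  quadratic subfields are generated by \<open>\<alpha>\<close>, \<open>\<beta>\<close>, \<open>\<gamma>\<close>. The signs of the roots are tied by \<open>products\<close>.\<close>
locale biquadratic_field =
  fixes g r s :: int and \<alpha> \<beta> \<gamma> :: complex
  assumes sqrts: "\<alpha>\<^sup>2 = of_int (g * r)" "\<beta>\<^sup>2 = of_int (g * s)" "\<gamma>\<^sup>2 = of_int (r * s)"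
    and products: "\<alpha> * \<beta> = of_int g * \<gamma>" "\<alpha> * \<gamma> = of_int r * \<beta>" "\<beta> * \<gamma> = of_int s * \<alpha>"
    and sqf: "squarefree (g * r)" "squarefree (g * s)" "squarefree (r * s)"
    and ne_1: "g * r \<noteq> 1" "g * s \<noteq> 1" "r * s \<noteq> 1"
    and odd_grs: "odd g" "odd r" "odd s"
begin

sublocale A: quadratic_field "g * r" \<alpha> by unfold_locales (fact sqrts sqf ne_1)+
sublocale B: quadratic_field "g * s" \<beta> by unfold_locales (fact sqrts sqf ne_1)+
sublocale C: quadratic_field "r * s" \<gamma> by unfold_locales (fact sqrts sqf ne_1)+

lemma grs_nonzero: "g \<noteq> 0" "r \<noteq> 0" "s \<noteq> 0"
  using odd_grs by auto

definition emb :: "rat \<Rightarrow> rat \<Rightarrow> rat \<Rightarrow> rat \<Rightarrow> complex" where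
  "emb x y z w = of_rat x + of_rat y * \<alpha> + of_rat z * \<beta> + of_rat w * \<gamma>"

definition K :: "complex set" where
  "K = {emb x y z w | x y z w. True}"

lemma emb_in_K [simp]: "emb x y z w \<in> K"
  by (auto simp: K_def)

lemma K_E: assumes "u \<in> K" obtains x y z w where "u = emb x y z w"
  using assms by (auto simp: K_def)

lemma emb_add: "emb x y z w + emb x' y' z' w' = emb (x + x') (y + y') (z + z') (w + w')"
  by (simp add: emb_def of_rat_add algebra_simps)

lemma emb_uminus: "- emb x y z w = emb (- x) (- y) (- z) (- w)"
  by (simp add: emb_def of_rat_minus algebra_simps)

lemma emb_diff: "emb x y z w - emb x' y' z' w' = emb (x - x') (y - y') (z - z') (w - w')"
  by (simp add: emb_def of_rat_diff algebra_simps)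

lemma emb_of_rat: "of_rat q = emb q 0 0 0"
  by (simp add: emb_def)

lemma emb_of_int: "of_int n = emb (of_int n) 0 0 0"
  by (simp add: emb_def)

lemma emb_gens: "\<alpha> = emb 0 1 0 0" "\<beta> = emb 0 0 1 0" "\<gamma> = emb 0 0 0 1"
  by (simp_all add: emb_def)

lemma emb_mult:
  "emb x y z w * emb x' y' z' w' =
     emb (x * x' + of_int (g * r) * (y * y') + of_int (g * s) * (z * z') + of_int (r * s) * (w * w'))
         (x * y' + y * x' + of_int s * (z * w' + w * z'))
         (x * z' + z * x' + of_int r * (y * w' + w * y'))
         (x * w' + w * x' + of_int g * (y * z' + z * y'))"
  unfolding emb_def expand_biquadratic_product A.sqrt' B.sqrt' C.sqrt' products
  by (simp only: of_rat_add of_rat_mult of_rat_of_int_eq distrib_left distrib_right mult_ac add_ac)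

text \<open>Collect the element as u + v \<beta> with u and v in the field of \<alpha>. If v were
  nonzero, \<beta> = p + q \<alpha> with rational p and q; squaring forces p = 0 or q = 0, and r s
  or g s would be a rational square.\<close>

lemma emb_eq_0_iff: "emb x y z w = 0 \<longleftrightarrow> x = 0 \<and> y = 0 \<and> z = 0 \<and> w = 0"
proof
  assume eq: "emb x y z w = 0"
  define u where "u = of_rat x + of_rat y * \<alpha>"
  define v where "v = of_rat z + of_rat (w / of_int g) * \<alpha>"
  have "of_rat (w / of_int g) * \<alpha> * \<beta> = of_rat w * \<gamma>"
    using grs_nonzero by (simp add: mult.assoc products of_rat_divide)
  hence uv: "u + v * \<beta> = 0"
    using eq by (simp add: u_def v_def emb_def algebra_simps)
  have "v = 0"
  proof (rule ccontr)
    assume "v \<noteq> 0"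
    hence "\<beta> = - u * (1 / v)" using uv by (simp add: field_simps eq_neg_iff_add_eq_0)
    also have "\<dots> \<in> A.F" unfolding u_def v_def by (intro A.F_mult A.F_uminus A.F_inverse A.in_F)
    finally obtain p q where pq: "\<beta> = of_rat p + of_rat q * \<alpha>" by (rule A.F_E)
    have "\<beta> * \<beta> = of_rat (of_int (g * s)) + of_rat 0 * \<alpha>" by (simp add: B.sqrt' of_rat_mult)
    hence *: "p * p + of_int (g * r) * (q * q) = of_int (g * s)" "p * q + q * p = 0"
      unfolding pq A.mult_coords by (rule A.coords_unique)+
    hence "p = 0 \<or> q = 0" by simp
    thus False
    proof
      assume "q = 0"
      hence "p\<^sup>2 = of_int (g * s)" using * by (simp add: power2_eq_square)
      thus False using squarefree_not_rat_square[OF sqf(2) ne_1(2)] by blast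
    next
      assume "p = 0"
      hence "of_int r * (q * q) = of_int s" using * grs_nonzero by simp
      hence "of_int r * (of_int r * (q * q)) = of_int r * of_int s" by simp
      hence "(of_int r * q)\<^sup>2 = of_int (r * s)" by (simp add: power2_eq_square mult_ac)
      thus False using squarefree_not_rat_square[OF sqf(3) ne_1(3)] by blast
    qed
  qed
  moreover from this have "u = 0" using uv by simp
  ultimately show "x = 0 \<and> y = 0 \<and> z = 0 \<and> w = 0"
    using grs_nonzero by (simp add: u_def v_def A.eq_0_iff)
qed (simp add: emb_def)

lemma emb_eq_iff:
  "emb x y z w = emb x' y' z' w' \<longleftrightarrow> x = x' \<and> y = y' \<and> z = z' \<and> w = w'"
  using emb_eq_0_iff[of "x - x'" "y - y'" "z - z'" "w - w'"]
  by (auto simp flip: emb_diff)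

lemma K_add: "u \<in> K \<Longrightarrow> v \<in> K \<Longrightarrow> u + v \<in> K"
  by (elim K_E) (simp add: emb_add)

lemma K_mult: "u \<in> K \<Longrightarrow> v \<in> K \<Longrightarrow> u * v \<in> K"
  by (elim K_E) (simp add: emb_mult)

lemma K_uminus: "u \<in> K \<Longrightarrow> - u \<in> K"
  by (elim K_E) (simp add: emb_uminus)

lemma K_of_rat: "of_rat q \<in> K"
  by (simp add: emb_of_rat)

lemma K_of_int: "of_int n \<in> K"
  using K_of_rat[of "of_int n"] by simp

lemma K_gens: "\<alpha> \<in> K" "\<beta> \<in> K" "\<gamma> \<in> K"
  using emb_in_K[of 0 1 0 0] emb_in_K[of 0 0 1 0] emb_in_K[of 0 0 0 1] by (simp_all only: emb_gens[symmetric])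

lemma F_subset_K: "A.F \<subseteq> K" "B.F \<subseteq> K" "C.F \<subseteq> K"
proof -
  have "of_rat x + of_rat y * \<alpha> = emb x y 0 0" "of_rat x + of_rat y * \<beta> = emb x 0 y 0"
    "of_rat x + of_rat y * \<gamma> = emb x 0 0 y" for x y
    by (simp_all add: emb_def)
  thus "A.F \<subseteq> K" "B.F \<subseteq> K" "C.F \<subseteq> K"
    by (force elim: A.F_E, force elim: B.F_E, force elim: C.F_E)
qed

text \<open>Inversion in the tower over the field of \<alpha>: multiplying u = p + q \<beta> by p -
  q \<beta> gives an element of that field, whose inverse is known.\<close>

lemma K_inverse: assumes "u \<in> K" shows "1 / u \<in> K"
proof (cases "u = 0")
  case True
  thus ?thesis using K_of_int[of 0] by simp
next
  case False
  obtain x y z w where u: "u = emb x y z w" using assms by (rule K_E)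
  define p where "p = of_rat x + of_rat y * \<alpha>"
  define q where "q = of_rat z + of_rat (w / of_int g) * \<alpha>"
  have "of_rat (w / of_int g) * \<alpha> * \<beta> = of_rat w * \<gamma>"
    using grs_nonzero by (simp add: mult.assoc products of_rat_divide)
  hence conj: "u = p + q * \<beta>" "emb x y (- z) (- w) = p - q * \<beta>"
    by (simp_all add: u p_def q_def emb_def of_rat_minus algebra_simps)
  have "x \<noteq> 0 \<or> y \<noteq> 0 \<or> - z \<noteq> 0 \<or> - w \<noteq> 0" using False u by (auto simp: emb_eq_0_iff)
  hence "p - q * \<beta> \<noteq> 0" by (simp add: emb_eq_0_iff flip: conj)
  moreover define n where "n = p * p - q * q * of_int (g * s)"
  have "(p + q * \<beta>) * (p - q * \<beta>) = n"
    unfolding n_def B.sqrt'[symmetric] by (simp add: algebra_simps)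
  ultimately have "1 / u = (p - q * \<beta>) * (1 / n)" using False conj(1) by (auto simp: divide_simps)
  moreover have "n \<in> A.F"
    unfolding n_def p_def q_def by (intro A.F_diff A.F_mult A.in_F A.F_of_int)
  hence "1 / n \<in> K" using A.F_inverse F_subset_K by blast
  moreover have "p - q * \<beta> \<in> K" by (simp flip: conj)
  ultimately show ?thesis by (simp only: K_mult)
qed

section \<open>Automorphisms, embeddings and the trace\<close>

text \<open>For signs i and j this is the automorphism with \<alpha> to i \<alpha>, \<beta> to j
  \<beta> and hence \<gamma> to i j \<gamma>. The signs are rationals so that they can act directly
  on the coordinates.\<close>

definition cj :: "rat \<Rightarrow> rat \<Rightarrow> complex \<Rightarrow> complex" where
  "cj i j u = (THE v. \<exists>x y z w. u = emb x y z w \<and> v = emb x (i * y) (j * z) (i * j * w))"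

lemma cj_emb: "cj i j (emb x y z w) = emb x (i * y) (j * z) (i * j * w)"
  unfolding cj_def by (rule the_equality) (auto simp: emb_eq_iff)

lemma cj_in_K: "u \<in> K \<Longrightarrow> cj i j u \<in> K"
  by (elim K_E) (simp add: cj_emb)

lemma cj_add: "u \<in> K \<Longrightarrow> v \<in> K \<Longrightarrow> cj i j (u + v) = cj i j u + cj i j v"
  by (elim K_E) (simp add: cj_emb emb_add algebra_simps)

lemma cj_of_rat: "cj i j (of_rat q) = of_rat q"
  by (simp add: emb_of_rat cj_emb)

lemma cj_of_int: "cj i j (of_int n) = of_int n"
  using cj_of_rat[of i j "of_int n"] by simp

definition sgns :: "rat set" where "sgns = {1, - 1}"

lemma cj_mult:
  assumes "i \<in> sgns" "j \<in> sgns" "u \<in> K" "v \<in> K"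
  shows "cj i j (u * v) = cj i j u * cj i j v"
proof -
  obtain x y z w x' y' z' w' where uv: "u = emb x y z w" "v = emb x' y' z' w'"
    using assms(3,4) by (elim K_E)
  from assms(1,2) consider "i = 1" "j = 1" | "i = 1" "j = - 1" | "i = - 1" "j = 1" | "i = - 1" "j = - 1"
    unfolding sgns_def by blast
  thus ?thesis
    by cases (simp_all add: uv emb_mult cj_emb emb_eq_iff algebra_simps)
qed

lemma cj_eq_0_iff:
  assumes "i \<in> sgns" "j \<in> sgns" "u \<in> K"
  shows "cj i j u = 0 \<longleftrightarrow> u = 0"
proof -
  obtain x y z w where u: "u = emb x y z w" using assms(3) by (rule K_E)
  have "i \<noteq> 0" "j \<noteq> 0" using assms by (auto simp: sgns_def)
  thus ?thesis by (simp add: u cj_emb emb_eq_0_iff)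
qed

lemma algebraic_int_cj:
  assumes "i \<in> sgns" "j \<in> sgns" "u \<in> K" "algebraic_int u"
  shows "algebraic_int (cj i j u)"
  using assms(4,3)
  by (rule algebraic_int_hom) (use assms K_of_int K_add K_mult cj_of_int cj_add cj_mult in auto)

text \<open>An embedding fixes the rationals and preserves the squares of \<alpha> and \<beta>, so
  it changes each by a sign; the image of \<gamma> is then forced by
  \<open>\<alpha> * \<beta> = of_int g * \<gamma>\<close>.\<close>

lemma embedding_cases:
  assumes "h \<in> embeddings K"
  obtains i j where "i \<in> sgns" "j \<in> sgns" "h = restrict (cj i j) K"
proof -
  have ext: "h \<in> extensional K" and hom: "h \<in> Ring.ring_hom (complex_ring \<lparr>carrier := K\<rparr>) complex_ring"
    using assms by (auto simp: embeddings_def)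
  have h1: "h 1 = 1" and hadd: "\<And>u v. u \<in> K \<Longrightarrow> v \<in> K \<Longrightarrow> h (u + v) = h u + h v"
    and hmult: "\<And>u v. u \<in> K \<Longrightarrow> v \<in> K \<Longrightarrow> h (u * v) = h u * h v"
    using ring_hom_one[OF hom] ring_hom_add[OF hom] ring_hom_mult[OF hom] by auto
  have in_K: "0 \<in> K" "1 \<in> K" using K_of_int[of 0] K_of_int[of 1] by auto
  have h0: "h 0 = 0" using hadd[of 0 0] in_K by simp
  have hmin: "h (- u) = - h u" if "u \<in> K" for u
  proof -
    have "h u + h (- u) = 0" using hadd[OF that K_uminus[OF that]] h0 by simp
    thus ?thesis by (simp add: eq_neg_iff_add_eq_0 add.commute)
  qed
  have hnat: "h (of_nat n) = of_nat n" for n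
  proof (induction n)
    case (Suc n)
    thus ?case using hadd[of 1 "of_nat n"] K_of_int[of "int n"] in_K h1 by simp
  qed (simp add: h0)
  have hint: "h (of_int n) = of_int n" for n
    using hnat[of "nat \<bar>n\<bar>"] hmin[of "of_nat (nat \<bar>n\<bar>)"] K_of_int[of "int (nat \<bar>n\<bar>)"]
    by (cases "n \<ge> 0") auto
  have hrat: "h (of_rat q) = of_rat q" for q
  proof -
    obtain a b where q: "b > 0" "q = of_int a / of_int b"
      by (metis Fract_of_int_quotient Rat_cases_nonzero quotient_of_unique)
    have "of_rat q * of_int b = (of_int a :: complex)" using q by (simp add: of_rat_divide)
    hence "h (of_rat q) * of_int b = of_int a"
      using hmult[OF K_of_rat K_of_int, of q b] by (simp add: hint)
    hence "h (of_rat q) = of_int a / of_int b" using q(1) by (simp add: eq_divide_eq)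
    also have "\<dots> = of_rat q" using q by (simp add: of_rat_divide)
    finally show ?thesis .
  qed
  have "h \<alpha> * h \<alpha> = \<alpha> * \<alpha>" "h \<beta> * h \<beta> = \<beta> * \<beta>"
    using hmult[of \<alpha> \<alpha>] hmult[of \<beta> \<beta>] by (simp_all only: K_gens A.sqrt' B.sqrt' hint)
  hence "h \<alpha> = \<alpha> \<or> h \<alpha> = - \<alpha>" "h \<beta> = \<beta> \<or> h \<beta> = - \<beta>"
    unfolding square_eq_iff .
  hence "\<exists>i\<in>sgns. h \<alpha> = of_rat i * \<alpha>" "\<exists>j\<in>sgns. h \<beta> = of_rat j * \<beta>"
    by (auto simp: sgns_def of_rat_minus)
  then obtain i j where ij: "i \<in> sgns" "j \<in> sgns" "h \<alpha> = of_rat i * \<alpha>" "h \<beta> = of_rat j * \<beta>" by blast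
  have "h (of_int g * \<gamma>) = h \<alpha> * h \<beta>" using hmult[OF K_gens(1,2)] products by simp
  hence "of_int g * h \<gamma> = of_rat (i * j) * (\<alpha> * \<beta>)"
    using hmult[OF K_of_int K_gens(3), of g] by (simp add: hint ij of_rat_mult)
  hence h\<gamma>: "h \<gamma> = of_rat (i * j) * \<gamma>" unfolding products using grs_nonzero by simp
  have "h (emb x y z w) = cj i j (emb x y z w)" for x y z w
    unfolding cj_emb unfolding emb_def
    by (simp add: hadd hmult hrat K_add K_mult K_of_rat K_gens ij h\<gamma> of_rat_mult)
  hence "h = restrict (cj i j) K"
    by (intro extensionalityI[OF ext]) (auto simp: K_def)
  with ij show ?thesis by (intro that)
qed

lemma cj_embedding:
  assumes "i \<in> sgns" "j \<in> sgns"
  shows "restrict (cj i j) K \<in> embeddings K"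
proof -
  have "1 \<in> K" "cj i j 1 = 1" using K_of_int[of 1] cj_of_int[of i j 1] by simp_all
  hence "restrict (cj i j) K \<in> Ring.ring_hom (complex_ring \<lparr>carrier := K\<rparr>) complex_ring"
    by (intro ring_hom_memI) (simp_all add: K_mult K_add cj_add cj_mult[OF assms])
  thus ?thesis by (simp add: embeddings_def)
qed

lemma embeddings_eq: "embeddings K = (\<lambda>(i, j). restrict (cj i j) K) ` (sgns \<times> sgns)"
proof
  show "embeddings K \<subseteq> (\<lambda>(i, j). restrict (cj i j) K) ` (sgns \<times> sgns)"
  proof
    fix h assume "h \<in> embeddings K"
    then obtain i j where "i \<in> sgns" "j \<in> sgns" "h = restrict (cj i j) K" by (rule embedding_cases)
    thus "h \<in> (\<lambda>(i, j). restrict (cj i j) K) ` (sgns \<times> sgns)"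
      by (intro rev_image_eqI[of "(i, j)"]) auto
  qed
  show "(\<lambda>(i, j). restrict (cj i j) K) ` (sgns \<times> sgns) \<subseteq> embeddings K"
    using cj_embedding by auto
qed

lemma field_trace_emb: "field_trace K (emb x y z w) = of_rat (4 * x)"
proof -
  have inj: "inj_on (\<lambda>(i, j). restrict (cj i j) K) (sgns \<times> sgns)"
  proof (rule inj_onI, clarify)
    fix i j i' j' :: rat
    assume eq: "restrict (cj i j) K = restrict (cj i' j') K"
    \<comment> \<open>The element \<alpha> + \<beta> has four distinct conjugates and so separates
      the sign pairs.\<close>
    have "cj i j (emb 0 1 1 0) = cj i' j' (emb 0 1 1 0)"
      using fun_cong[OF eq, of "emb 0 1 1 0"] by simp
    thus "i = i' \<and> j = j'" by (simp add: cj_emb emb_eq_iff)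
  qed
  have "field_trace K (emb x y z w) = (\<Sum>(i, j)\<in>sgns \<times> sgns. cj i j (emb x y z w))"
    unfolding field_trace_def embeddings_eq by (subst sum.reindex[OF inj]) (auto intro!: sum.cong)
  also have "\<dots> = (\<Sum>i\<in>sgns. \<Sum>j\<in>sgns. cj i j (emb x y z w))"
    by (simp add: sum.cartesian_product)
  also have "\<dots> = of_rat (4 * x)"
    by (simp add: sgns_def cj_emb emb_add emb_of_rat)
  finally show ?thesis .
qed

text \<open>Together with \<open>rotate\<close> this permutes the three quadratic subfields. It
  allows any one of g r, g s, r s to be the radicand that is 1 modulo 4, and transfers a bound for
  the divisors of g r to those of g s.\<close>

lemma swap: "biquadratic_field g s r \<beta> \<alpha> \<gamma>"
  by unfold_locales (use sqrts products sqf ne_1 odd_grs in \<open>auto simp: mult.commute\<close>)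

lemma rotate: "biquadratic_field r g s \<alpha> \<gamma> \<beta>"
  by unfold_locales (use sqrts products sqf ne_1 odd_grs in \<open>auto simp: mult.commute\<close>)

end

lemma (in biquadratic_field) K_swap: "biquadratic_field.K \<beta> \<alpha> \<gamma> = K"
proof -
  interpret S: biquadratic_field g s r \<beta> \<alpha> \<gamma> by (rule swap)
  have eq: "S.emb x y z w = emb x z y w" for x y z w by (simp add: S.emb_def emb_def)
  have "u \<in> S.K \<longleftrightarrow> u \<in> K" for u
  proof
    assume "u \<in> K"
    then obtain x y z w where "u = emb x y z w" by (rule K_E)
    thus "u \<in> S.K" by (simp flip: eq)
  qed (auto elim: S.K_E simp: eq)
  thus ?thesis by blast
qed

lemma (in biquadratic_field) K_rotate: "biquadratic_field.K \<alpha> \<gamma> \<beta> = K"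
proof -
  interpret S: biquadratic_field r g s \<alpha> \<gamma> \<beta> by (rule rotate)
  have eq: "S.emb x y z w = emb x y w z" for x y z w by (simp add: S.emb_def emb_def)
  have "u \<in> S.K \<longleftrightarrow> u \<in> K" for u
  proof
    assume "u \<in> K"
    then obtain x y z w where "u = emb x y z w" by (rule K_E)
    thus "u \<in> S.K" by (simp flip: eq)
  qed (auto elim: S.K_E simp: eq)
  thus ?thesis by blast
qed

section \<open>Discriminants\<close>

lemma carrier_ring_of_integers [simp]: "carrier (ring_of_integers K) = {x \<in> K. algebraic_int x}"
  by (simp add: ring_of_integers_def)

context quadratic_field
begin

lemma algebraic_int_sqrt: "algebraic_int \<delta>"
  by (rule algebraic_int_power_cancel[of _ 2]) (simp_all add: sqrt del: of_int_mult)

lemma algebraic_int_half: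
  assumes "d mod 4 = 1"
  shows "algebraic_int ((1 + \<delta>) / 2)"
proof -
  obtain k where k: "d = 4 * k + 1" using assms by (metis mult_div_mod_eq)
  have "((1 + \<delta>) / 2)\<^sup>2 - (1 + \<delta>) / 2 = (\<delta>\<^sup>2 - 1) / 4"
    by (simp add: power2_eq_square field_simps)
  also have "\<dots> = of_int k" by (simp add: sqrt k)
  finally have "((1 + \<delta>) / 2)\<^sup>2 - (1 + \<delta>) / 2 = of_int k" .
  hence "poly [:0, - 1, 1:] ((1 + \<delta>) / 2) = of_int k"
    by (simp add: power2_eq_square algebra_simps)
  thus ?thesis
    by (rule algebraic_int_root[OF algebraic_int_of_int]) (auto simp: coeff_pCons split: nat.splits)
qed

lemma parity_if_1_mod_4:
  assumes "d mod 4 = 1" "A\<^sup>2 - d * B\<^sup>2 = 4 * N"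
  shows "even (A - B)"
proof -
  have "odd d" using assms(1) by presburger
  have "even (A\<^sup>2 - d * B\<^sup>2)" unfolding assms(2) by simp
  thus ?thesis using \<open>odd d\<close> by simp
qed

lemma parity_if_3_mod_4:
  assumes "d mod 4 = 3" "A\<^sup>2 - d * B\<^sup>2 = 4 * N"
  shows "even A" "even B"
proof -
  have "odd d" using assms(1) by presburger
  have "even (A\<^sup>2 - d * B\<^sup>2)" unfolding assms(2) by simp
  hence par: "even A \<longleftrightarrow> even B" using \<open>odd d\<close> by simp
  have "even A"
  proof (rule ccontr)
    assume "odd A"
    hence "odd B" using par by simp
    obtain a b where ab: "A = 2 * a + 1" "B = 2 * b + 1" using \<open>odd A\<close> \<open>odd B\<close> by (metis oddE)
    obtain k where k: "d = 4 * k + 3" using assms(1) by (metis mult_div_mod_eq)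
    \<comment> \<open>Odd squares are 1 modulo 4, so the left side is 1 - 3 modulo 4 and not
      divisible by 4.\<close>
    have "A\<^sup>2 - d * B\<^sup>2 = 4 * (a\<^sup>2 + a - k * B\<^sup>2 - 3 * (b\<^sup>2 + b)) - 2"
      unfolding k ab by (simp add: power2_eq_square algebra_simps)
    hence "4 * N = 4 * (a\<^sup>2 + a - k * B\<^sup>2 - 3 * (b\<^sup>2 + b)) - 2" using assms(2) by simp
    thus False by presburger
  qed
  thus "even A" "even B" using par by auto
qed

end

section \<open>Independence of the discriminant from the integral basis\<close>

lemma integral_basis_coeffs_unique:
  fixes c d :: "nat \<Rightarrow> int"
  assumes basis: "integral_basis K ws" and x: "x \<in> carrier (ring_of_integers K)"
    and "x = (\<Sum>j<length ws. of_int (c j) * ws ! j)" "x = (\<Sum>j<length ws. of_int (d j) * ws ! j)"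
    and "i < length ws"
  shows "c i = d i"
proof -
  define P where "P cs \<longleftrightarrow> length cs = length ws \<and> x = (\<Sum>i<length ws. of_int (cs ! i) * ws ! i)"
    for cs :: "int list"
  have P: "P (map f [0..<length ws])" if "x = (\<Sum>j<length ws. of_int (f j) * ws ! j)" for f
    unfolding P_def by (subst that) simp
  have "\<exists>!cs. P cs" using basis x unfolding integral_basis_def P_def by blast
  then obtain cs where cs: "\<And>y. P y \<Longrightarrow> y = cs" by (metis (full_types))
  have "map c [0..<length ws] = map d [0..<length ws]"
    using cs[OF P[OF assms(3)]] cs[OF P[OF assms(4)]] by simp
  hence "map c [0..<length ws] ! i = map d [0..<length ws] ! i" by (rule arg_cong)
  thus ?thesis using assms(5) by simp
qed

lemma integral_basis_coeffs_ex:
  assumes "integral_basis K ws" "x \<in> carrier (ring_of_integers K)"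
  shows "\<exists>c :: nat \<Rightarrow> int. x = (\<Sum>j<length ws. of_int (c j) * ws ! j)"
proof -
  obtain cs :: "int list" where "x = (\<Sum>i<length ws. of_int (cs ! i) * ws ! i)"
    using assms unfolding integral_basis_def by blast
  thus ?thesis by (intro exI[of _ "\<lambda>i. cs ! i"])
qed

text \<open>Expanding each basis in the other and back gives the identity by uniqueness of
  coefficients. Both products are recorded with separate index ranges, since the lengths of the
  bases are not yet known to agree.\<close>

lemma integral_basis_transition:
  assumes ws: "integral_basis K ws" and vs: "integral_basis K vs"
  shows "\<exists>P Q :: nat \<Rightarrow> nat \<Rightarrow> int.
    (\<forall>i<length ws. ws ! i = (\<Sum>k<length vs. of_int (P i k) * vs ! k)) \<and>
    (\<forall>i<length ws. \<forall>j<length ws. (\<Sum>k<length vs. P i k * Q k j) = of_bool (i = j)) \<and>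
    (\<forall>i<length vs. \<forall>j<length vs. (\<Sum>k<length ws. Q i k * P k j) = of_bool (i = j))"
proof -
  have one_side: "(\<Sum>k<length vs. P i k * Q k j) = of_bool (i = j)"
    if ws: "integral_basis K ws" and vs: "integral_basis K vs"
      and P: "\<And>i. i < length ws \<Longrightarrow> ws ! i = (\<Sum>k<length vs. of_int (P i k) * vs ! k)"
      and Q: "\<And>i. i < length vs \<Longrightarrow> vs ! i = (\<Sum>k<length ws. of_int (Q i k) * ws ! k)"
      and ij: "i < length ws" "j < length ws"
    for ws vs :: "complex list" and P Q :: "nat \<Rightarrow> nat \<Rightarrow> int" and i j
  proof (rule integral_basis_coeffs_unique[OF ws, of "ws ! i"])
    show "ws ! i \<in> carrier (ring_of_integers K)"
      using ws nth_mem[OF ij(1)] unfolding integral_basis_def by blast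
    have "ws ! i = (\<Sum>k<length vs. of_int (P i k) * (\<Sum>j<length ws. of_int (Q k j) * ws ! j))"
      unfolding P[OF ij(1)]
    proof (rule sum.cong[OF refl])
      fix k assume "k \<in> {..<length vs}"
      hence "vs ! k = (\<Sum>j<length ws. of_int (Q k j) * ws ! j)" by (intro Q) simp
      thus "of_int (P i k) * vs ! k = of_int (P i k) * (\<Sum>j<length ws. of_int (Q k j) * ws ! j)"
        by (rule arg_cong)
    qed
    also have "\<dots> = (\<Sum>k<length vs. \<Sum>j<length ws. of_int (P i k * Q k j) * ws ! j)"
      by (simp only: sum_distrib_left of_int_mult mult.assoc)
    also have "\<dots> = (\<Sum>j<length ws. \<Sum>k<length vs. of_int (P i k * Q k j) * ws ! j)"
      by (rule sum.swap)
    also have "\<dots> = (\<Sum>j<length ws. of_int (\<Sum>k<length vs. P i k * Q k j) * ws ! j)"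
      by (simp only: sum_distrib_right of_int_sum)
    finally show "ws ! i = (\<Sum>j<length ws. of_int (\<Sum>k<length vs. P i k * Q k j) * ws ! j)" .
    have "(\<Sum>j<length ws. of_int (of_bool (i = j)) * ws ! j) = (\<Sum>j<length ws. if i = j then ws ! j else 0)"
      by (rule sum.cong) auto
    thus "ws ! i = (\<Sum>j<length ws. of_int (of_bool (i = j)) * ws ! j)" using ij by simp
  qed fact
  have "\<exists>c :: nat \<Rightarrow> int. ws ! i = (\<Sum>k<length vs. of_int (c k) * vs ! k)" if "i < length ws" for i
    using ws that nth_mem[of i ws] by (intro integral_basis_coeffs_ex[OF vs]) (unfold integral_basis_def, blast)
  then obtain P :: "nat \<Rightarrow> nat \<Rightarrow> int" where P: "\<And>i. i < length ws \<Longrightarrow> ws ! i = (\<Sum>k<length vs. of_int (P i k) * vs ! k)"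
    by metis
  have "\<exists>c :: nat \<Rightarrow> int. vs ! i = (\<Sum>k<length ws. of_int (c k) * ws ! k)" if "i < length vs" for i
    using vs that nth_mem[of i vs] by (intro integral_basis_coeffs_ex[OF ws]) (unfold integral_basis_def, blast)
  then obtain Q :: "nat \<Rightarrow> nat \<Rightarrow> int" where Q: "\<And>i. i < length vs \<Longrightarrow> vs ! i = (\<Sum>k<length ws. of_int (Q i k) * ws ! k)"
    by metis
  show ?thesis
    by (rule exI[of _ P], rule exI[of _ Q])
      (intro conjI allI impI P one_side[OF ws vs P Q] one_side[OF vs ws Q P] | assumption)+
qed

definition trace_matrix :: "complex set \<Rightarrow> complex list \<Rightarrow> complex mat" where
  "trace_matrix K ws = mat (length ws) (length ws) (\<lambda>(i, j). field_trace K (ws ! i * ws ! j))"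

text \<open>A change of basis C turns the Gram matrix T of the trace form into C T C^t, and C, being
  invertible over the integers, has determinant 1 or -1.\<close>

lemma det_trace_matrix_unique:
  assumes ws: "integral_basis K ws" and vs: "integral_basis K vs"
    and lin: "\<And>I (c :: nat \<times> nat \<Rightarrow> int) u. finite I \<Longrightarrow>
      (\<And>i. i \<in> I \<Longrightarrow> u i \<in> {v * v' | v v'. v \<in> set vs \<and> v' \<in> set vs}) \<Longrightarrow>
      field_trace K (\<Sum>i\<in>I. of_int (c i) * u i) = (\<Sum>i\<in>I. of_int (c i) * field_trace K (u i))"
  shows "det (trace_matrix K ws) = det (trace_matrix K vs)"
proof -
  obtain P Q :: "nat \<Rightarrow> nat \<Rightarrow> int" where
    P: "\<And>i. i < length ws \<Longrightarrow> ws ! i = (\<Sum>k<length vs. of_int (P i k) * vs ! k)" and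
    PQ: "\<And>i j. i < length ws \<Longrightarrow> j < length ws \<Longrightarrow> (\<Sum>k<length vs. P i k * Q k j) = of_bool (i = j)" and
    QP: "\<And>i j. i < length vs \<Longrightarrow> j < length vs \<Longrightarrow> (\<Sum>k<length ws. Q i k * P k j) = of_bool (i = j)"
    using integral_basis_transition[OF ws vs] by blast
  \<comment> \<open>The two products of the transition matrices have the same trace, and each trace
    is the length of a basis.\<close>
  have "int (length ws) = (\<Sum>i<length ws. \<Sum>k<length vs. P i k * Q k i)" by (simp add: PQ)
  also have "\<dots> = (\<Sum>k<length vs. \<Sum>i<length ws. Q k i * P i k)"
    by (subst sum.swap) (simp add: mult.commute)
  also have "\<dots> = int (length vs)" by (simp add: QP)
  finally have len: "length ws = length vs" by simp
  define n where "n = length ws"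
  define MP where "MP = mat n n (\<lambda>(i, j). P i j)"
  define MQ where "MQ = mat n n (\<lambda>(i, j). Q i j)"
  have car: "MP \<in> carrier_mat n n" "MQ \<in> carrier_mat n n" by (auto simp: MP_def MQ_def)
  have "MP * MQ = 1\<^sub>m n"
    by (rule eq_matI) (use PQ len in \<open>auto simp: MP_def MQ_def scalar_prod_def n_def atLeast0LessThan\<close>)
  hence "det MP * det MQ = 1" using det_mult[OF car] by simp
  hence "det MP = 1 \<or> det MP = - 1" by (auto simp: zmult_eq_1_iff)
  hence sq: "(det MP)\<^sup>2 = 1" by auto
  define C where "C = map_mat complex_of_int MP"
  have carC: "C \<in> carrier_mat n n" "trace_matrix K vs \<in> carrier_mat n n"
    using len by (auto simp: C_def MP_def trace_matrix_def n_def)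
  have "trace_matrix K ws = C * (trace_matrix K vs * transpose_mat C)"
  proof (rule eq_matI)
    fix i j assume "i < dim_row (C * (trace_matrix K vs * transpose_mat C))"
      "j < dim_col (C * (trace_matrix K vs * transpose_mat C))"
    hence ij: "i < n" "j < n" using carC by auto
    have "ws ! i * ws ! j = (\<Sum>k<n. \<Sum>l<n. of_int (P i k * P j l) * (vs ! k * vs ! l))"
      using ij len by (simp add: P n_def sum_product mult_ac)
    also have "\<dots> = (\<Sum>(k, l)\<in>{..<n} \<times> {..<n}. of_int (P i k * P j l) * (vs ! k * vs ! l))"
      by (simp add: sum.cartesian_product)
    finally have "field_trace K (ws ! i * ws ! j) =
      field_trace K (\<Sum>p\<in>{..<n} \<times> {..<n}. of_int (P i (fst p) * P j (snd p)) * (vs ! fst p * vs ! snd p))"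
      by (simp add: case_prod_beta)
    also have "\<dots> = (\<Sum>p\<in>{..<n} \<times> {..<n}. of_int (P i (fst p) * P j (snd p)) * field_trace K (vs ! fst p * vs ! snd p))"
    proof (rule lin)
      fix p assume "p \<in> {..<n} \<times> {..<n}"
      hence "vs ! fst p \<in> set vs" "vs ! snd p \<in> set vs" using len by (auto simp: n_def)
      thus "vs ! fst p * vs ! snd p \<in> {v * v' | v v'. v \<in> set vs \<and> v' \<in> set vs}" by blast
    qed simp
    also have "\<dots> = (\<Sum>k<n. \<Sum>l<n. of_int (P i k * P j l) * field_trace K (vs ! k * vs ! l))"
      by (simp add: sum.cartesian_product case_prod_beta)
    also have "\<dots> = (\<Sum>k<n. of_int (P i k) * (\<Sum>l<n. field_trace K (vs ! k * vs ! l) * of_int (P j l)))"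
      by (simp only: sum_distrib_left of_int_mult mult_ac)
    also have "\<dots> = (C * (trace_matrix K vs * transpose_mat C)) $$ (i, j)"
      using ij len by (auto simp: C_def MP_def trace_matrix_def scalar_prod_def n_def atLeast0LessThan)
    finally show "trace_matrix K ws $$ (i, j) = (C * (trace_matrix K vs * transpose_mat C)) $$ (i, j)"
      using ij by (simp add: trace_matrix_def n_def)
  qed (use carC len in \<open>auto simp: trace_matrix_def n_def\<close>)
  hence "det (trace_matrix K ws) = det C * (det (trace_matrix K vs) * det C)"
    using carC by (simp add: det_mult[of _ n] det_transpose[of _ n])
  also have "det C = of_int (det MP)" unfolding C_def by simp
  also have "of_int (det MP) * (det (trace_matrix K vs) * of_int (det MP)) =
    of_int ((det MP)\<^sup>2) * det (trace_matrix K vs)"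
    by (simp add: power2_eq_square)
  finally show ?thesis by (simp add: sq)
qed

context biquadratic_field
begin

lemma emb_scale: "of_int c * emb x y z w = emb (of_int c * x) (of_int c * y) (of_int c * z) (of_int c * w)"
  by (simp add: emb_def of_rat_mult algebra_simps)

lemma field_trace_add: "u \<in> K \<Longrightarrow> v \<in> K \<Longrightarrow> field_trace K (u + v) = field_trace K u + field_trace K v"
  by (elim K_E) (simp add: emb_add field_trace_emb of_rat_add of_rat_mult distrib_left)

lemma field_trace_scale: "u \<in> K \<Longrightarrow> field_trace K (of_int c * u) = of_int c * field_trace K u"
  by (elim K_E) (simp add: emb_scale field_trace_emb of_rat_mult)

lemma field_trace_linear:
  assumes "finite I" "\<And>i. i \<in> I \<Longrightarrow> u i \<in> K"
  shows "(\<Sum>i\<in>I. of_int (c i) * u i) \<in> K"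
    and "field_trace K (\<Sum>i\<in>I. of_int (c i) * u i) = (\<Sum>i\<in>I. of_int (c i) * field_trace K (u i))"
proof -
  have "(\<Sum>i\<in>I. of_int (c i) * u i) \<in> K \<and>
    field_trace K (\<Sum>i\<in>I. of_int (c i) * u i) = (\<Sum>i\<in>I. of_int (c i) * field_trace K (u i))"
    using assms
  proof (induction I rule: finite_induct)
    case empty
    have "field_trace K (emb 0 0 0 0) = 0" unfolding field_trace_emb by simp
    thus ?case using K_of_int[of 0] by (simp add: emb_def)
  next
    case (insert i I)
    hence "of_int (c i) * u i \<in> K" "u i \<in> K" by (auto intro: K_mult K_of_int)
    thus ?case using insert by (simp add: field_trace_add field_trace_scale K_add)
  qed
  thus "(\<Sum>i\<in>I. of_int (c i) * u i) \<in> K"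
    "field_trace K (\<Sum>i\<in>I. of_int (c i) * u i) = (\<Sum>i\<in>I. of_int (c i) * field_trace K (u i))" by auto
qed

lemma discriminant_eqI:
  assumes vs: "integral_basis K vs" and d: "of_int d = det (trace_matrix K vs)"
  shows "discriminant K = d"
  unfolding discriminant_def trace_matrix_def[symmetric]
proof (rule the_equality)
  show "\<exists>ws. integral_basis K ws \<and> of_int d = det (trace_matrix K ws)"
    using assms by blast
next
  fix d' assume "\<exists>ws. integral_basis K ws \<and> of_int d' = det (trace_matrix K ws)"
  then obtain ws where ws: "integral_basis K ws" "of_int d' = det (trace_matrix K ws)"
    by blast
  have "set vs \<subseteq> carrier (ring_of_integers K)" using vs unfolding integral_basis_def by (rule conjunct1)
  hence vs_K: "v \<in> K" if "v \<in> set vs" for v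
    using that by (auto dest: subsetD)
  have "det (trace_matrix K ws) = det (trace_matrix K vs)"
  proof (rule det_trace_matrix_unique[OF ws(1) vs])
    fix I and c :: "nat \<times> nat \<Rightarrow> int" and u :: "nat \<times> nat \<Rightarrow> complex"
    assume "finite I" and *: "\<And>i. i \<in> I \<Longrightarrow> u i \<in> {v * v' | v v'. v \<in> set vs \<and> v' \<in> set vs}"
    have "u i \<in> K" if i: "i \<in> I" for i
    proof -
      obtain v v' where "u i = v * v'" "v \<in> set vs" "v' \<in> set vs" using *[OF i] by blast
      thus ?thesis using vs_K by (simp only: K_mult)
    qed
    with \<open>finite I\<close> show "field_trace K (\<Sum>i\<in>I. of_int (c i) * u i) = (\<Sum>i\<in>I. of_int (c i) * field_trace K (u i))"
      by (rule field_trace_linear(2))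
  qed
  hence "(of_int d' :: complex) = of_int d" using ws d by simp
  thus "d' = d" by simp
qed

lemma field_trace_emb_mult:
  "field_trace K (emb x y z w * emb x' y' z' w') =
     of_rat (4 * (x * x' + of_int (g * r) * (y * y') + of_int (g * s) * (z * z') + of_int (r * s) * (w * w')))"
  unfolding emb_mult field_trace_emb ..

text \<open>With respect to 1, \<alpha>, \<beta>, \<gamma> the trace form is diagonal with entries
  4, 4 g r, 4 g s, 4 r s, which yields the factor 256 = 4^4; the coordinate matrix \<open>R\<close>
  enters on both sides and contributes the square of its diagonal product.\<close>

lemma det_trace_matrix_triangular:
  fixes R :: "nat \<Rightarrow> nat \<Rightarrow> rat"
  assumes tri: "\<And>i j. i < j \<Longrightarrow> j < 4 \<Longrightarrow> R i j = 0"
  defines "ws \<equiv> map (\<lambda>i. emb (R i 0) (R i 1) (R i 2) (R i 3)) [0..<4]"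
  shows "det (trace_matrix K ws) =
    of_rat (256 * (R 0 0 * R 1 1 * R 2 2 * R 3 3)\<^sup>2 * of_int (g * r) * of_int (g * s) * of_int (r * s))"
proof -
  define q :: "nat \<Rightarrow> int" where "q i = [1, g * r, g * s, r * s] ! i" for i
  define M :: "complex mat" where "M = mat 4 4 (\<lambda>(i, j). of_rat (R i j))"
  define D :: "complex mat" where "D = mat 4 4 (\<lambda>(i, j). if i = j then of_int (4 * q i) else 0)"
  have car: "M \<in> carrier_mat 4 4" "D \<in> carrier_mat 4 4" by (auto simp: M_def D_def)
  have idx4: "{0..<4} = {0, 1, 2, 3 :: nat}" by auto
  have upt4: "[0..<4] = [0, 1, 2, 3 :: nat]" by (simp add: upt_rec)
  have q: "q 0 = 1" "q 1 = g * r" "q 2 = g * s" "q 3 = r * s"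
    by (simp_all add: q_def)
  have "trace_matrix K ws = M * (D * transpose_mat M)"
  proof (rule eq_matI)
    fix i j assume "i < dim_row (M * (D * transpose_mat M))" "j < dim_col (M * (D * transpose_mat M))"
    hence ij: "i < 4" "j < 4" using car by auto
    have DM: "(D * transpose_mat M) $$ (k, j) = of_int (4 * q k) * of_rat (R j k)" if "k < 4" for k
    proof -
      have "(D * transpose_mat M) $$ (k, j) = (\<Sum>l\<in>{0..<4}. (if k = l then of_int (4 * q k) else 0) * of_rat (R j l))"
        using ij that by (auto simp: D_def M_def scalar_prod_def)
      also have "\<dots> = (\<Sum>l\<in>{0..<4}. if k = l then of_int (4 * q k) * of_rat (R j k) else 0)"
        by (rule sum.cong) auto
      finally show ?thesis using that by simp
    qed
    have "(M * (D * transpose_mat M)) $$ (i, j) = (\<Sum>k\<in>{0..<4}. of_rat (R i k) * (D * transpose_mat M) $$ (k, j))"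
      using ij car by (auto simp: M_def scalar_prod_def)
    also have "\<dots> = (\<Sum>k\<in>{0..<4}. of_rat (R i k) * (of_int (4 * q k) * of_rat (R j k)))"
      by (rule sum.cong) (simp_all only: DM atLeastLessThan_iff)
    also have "\<dots> = of_rat (\<Sum>k\<in>{0..<4}. R i k * (of_int (4 * q k) * R j k))"
      by (simp only: of_rat_sum of_rat_mult of_rat_of_int_eq)
    also have "(\<Sum>k\<in>{0..<4}. R i k * (of_int (4 * q k) * R j k)) = 4 * (R i 0 * R j 0 +
      of_int (g * r) * (R i 1 * R j 1) + of_int (g * s) * (R i 2 * R j 2) + of_int (r * s) * (R i 3 * R j 3))"
      unfolding idx4 q_def by (simp add: distrib_left)
    also have "of_rat \<dots> = field_trace K (ws ! i * ws ! j)"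
      unfolding ws_def using ij by (simp only: field_trace_emb_mult nth_map length_upt diff_zero nth_upt add_0)
    finally show "trace_matrix K ws $$ (i, j) = (M * (D * transpose_mat M)) $$ (i, j)"
      using ij by (simp add: trace_matrix_def ws_def)
  qed (use car in \<open>auto simp: trace_matrix_def ws_def\<close>)
  hence "det (trace_matrix K ws) = det M * (det D * det M)"
    using car by (simp add: det_mult[of _ 4] det_transpose[of _ 4])
  also have "det M = prod_list (diag_mat M)"
    using car by (intro det_lower_triangular[of 4]) (auto simp: M_def tri)
  also have "\<dots> = of_rat (R 0 0 * R 1 1 * R 2 2 * R 3 3)"
    using car by (simp add: diag_mat_def upt4) (simp add: M_def of_rat_mult)
  also have "det D = prod_list (diag_mat D)"
    using car by (intro det_lower_triangular[of 4]) (auto simp: D_def)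
  also have "\<dots> = of_int (256 * ((g * r) * (g * s) * (r * s)))"
    using car by (simp add: diag_mat_def upt4) (simp add: D_def q_def)
  finally show ?thesis
    by (simp only: of_rat_mult of_rat_of_int_eq power2_eq_square of_int_mult of_int_numeral of_rat_numeral_eq mult_ac)
qed

end

section \<open>Explicit integral bases and the value of the discriminant\<close>

lemma odd_int_mod_4: "odd (n :: int) \<Longrightarrow> n mod 4 = 1 \<or> n mod 4 = 3"
  by presburger

context biquadratic_field
begin

text \<open>Adding a conjugate gives the relative trace to a quadratic subfield, an algebraic
  integer with coordinates 2 x0 and 2 x1, 2 x2 or 2 x3. These are half-integers, whence denominators
  4.\<close>

lemma integral_quarters:
  assumes "algebraic_int (emb x0 x1 x2 x3)"
  obtains n0 n1 n2 n3 N1 N2 N3 :: int where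
    "x0 = of_int n0 / 4" "x1 = of_int n1 / 4" "x2 = of_int n2 / 4" "x3 = of_int n3 / 4"
    "n0\<^sup>2 - g * r * n1\<^sup>2 = 4 * N1" "n0\<^sup>2 - g * s * n2\<^sup>2 = 4 * N2" "n0\<^sup>2 - r * s * n3\<^sup>2 = 4 * N3"
proof -
  have int: "algebraic_int (emb x0 x1 x2 x3 + cj i j (emb x0 x1 x2 x3))" if "i \<in> sgns" "j \<in> sgns" for i j
    using that assms by (intro algebraic_int_add algebraic_int_cj) auto
  have *: "emb x0 x1 x2 x3 + cj 1 (- 1) (emb x0 x1 x2 x3) = of_rat (2 * x0) + of_rat (2 * x1) * \<alpha>"
    "emb x0 x1 x2 x3 + cj (- 1) 1 (emb x0 x1 x2 x3) = of_rat (2 * x0) + of_rat (2 * x2) * \<beta>"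
    "emb x0 x1 x2 x3 + cj (- 1) (- 1) (emb x0 x1 x2 x3) = of_rat (2 * x0) + of_rat (2 * x3) * \<gamma>"
    by (simp_all add: cj_emb emb_add) (simp_all add: emb_def)
  have "algebraic_int (of_rat (2 * x0) + of_rat (2 * x1) * \<alpha>)" using int[of 1 "- 1"] by (simp add: * sgns_def)
  then obtain a1 n1 N1 where 1: "2 * x0 = of_int a1 / 2" "2 * x1 = of_int n1 / 2" "a1\<^sup>2 - g * r * n1\<^sup>2 = 4 * N1"
    by (rule A.integral_coords)
  have "algebraic_int (of_rat (2 * x0) + of_rat (2 * x2) * \<beta>)" using int[of "- 1" 1] by (simp add: * sgns_def)
  then obtain a2 n2 N2 where 2: "2 * x0 = of_int a2 / 2" "2 * x2 = of_int n2 / 2" "a2\<^sup>2 - g * s * n2\<^sup>2 = 4 * N2"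
    by (rule B.integral_coords)
  have "algebraic_int (of_rat (2 * x0) + of_rat (2 * x3) * \<gamma>)" using int[of "- 1" "- 1"] by (simp add: * sgns_def)
  then obtain a3 n3 N3 where 3: "2 * x0 = of_int a3 / 2" "2 * x3 = of_int n3 / 2" "a3\<^sup>2 - r * s * n3\<^sup>2 = 4 * N3"
    by (rule C.integral_coords)
  have "a2 = a1" "a3 = a1" using 1(1) 2(1) 3(1) by simp_all
  thus ?thesis using 1 2 3 by (intro that[of a1 n1 n2 n3 N1 N2 N3]) auto
qed

definition row :: "(nat \<Rightarrow> nat \<Rightarrow> rat) \<Rightarrow> nat \<Rightarrow> complex" where
  "row R i = emb (R i 0) (R i 1) (R i 2) (R i 3)"

lemma sum_rows:
  "(\<Sum>i<4. of_int (c i) * row R i) = emb (\<Sum>i<4. of_int (c i) * R i 0) (\<Sum>i<4. of_int (c i) * R i 1)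
     (\<Sum>i<4. of_int (c i) * R i 2) (\<Sum>i<4. of_int (c i) * R i 3)"
proof -
  have "{..<4} = {0, 1, 2, 3 :: nat}" by auto
  thus ?thesis by (simp add: row_def emb_scale emb_add)
qed

definition triangular :: "(nat \<Rightarrow> nat \<Rightarrow> rat) \<Rightarrow> bool" where
  "triangular R \<longleftrightarrow> (\<forall>j<4. (\<forall>i<j. R i j = 0) \<and> R j j \<noteq> 0)"

lemma triangular_coeffs_unique:
  fixes c d :: "nat \<Rightarrow> int"
  assumes tri: "triangular R"
    and eq: "(\<Sum>i<4. of_int (c i) * row R i) = (\<Sum>i<4. of_int (d i) * row R i)" and "i < 4"
  shows "c i = d i"
proof -
  have idx: "{..<4} = {0, 1, 2, 3 :: nat}" by auto
  note eq' = eq[unfolded sum_rows emb_eq_iff, unfolded idx]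
  have z: "R 0 1 = 0" "R 0 2 = 0" "R 0 3 = 0" "R 1 2 = 0" "R 1 3 = 0" "R 2 3 = 0"
    using tri by (auto simp: triangular_def)
  have nz: "R 0 0 \<noteq> 0" "R 1 1 \<noteq> 0" "R 2 2 \<noteq> 0" "R 3 3 \<noteq> 0"
    using tri by (auto simp: triangular_def)
  \<comment> \<open>Back substitution: in the last coordinate only row 3 contributes.\<close>
  have 3: "c 3 = d 3" using eq' z nz by simp
  have 2: "c 2 = d 2" using eq' z nz 3 by simp
  have 1: "c 1 = d 1" using eq' z nz 3 2 by simp
  have 0: "c 0 = d 0" using eq' z nz 3 2 1 by simp
  from \<open>i < 4\<close> consider "i = 0" | "i = 1" | "i = 2" | "i = 3" by linarith
  thus ?thesis using 0 1 2 3 by cases simp_all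
qed

lemma integral_basis_rows:
  assumes tri: "triangular R"
    and int: "\<And>i. i < 4 \<Longrightarrow> algebraic_int (row R i)"
    and span: "\<And>u. u \<in> K \<Longrightarrow> algebraic_int u \<Longrightarrow> \<exists>c :: nat \<Rightarrow> int. u = (\<Sum>i<4. of_int (c i) * row R i)"
  shows "integral_basis K (map (row R) [0..<4])"
  unfolding integral_basis_def
proof (intro conjI ballI)
  show "set (map (row R) [0..<4]) \<subseteq> carrier (ring_of_integers K)"
    using int by (auto simp: row_def)
next
  fix u assume "u \<in> carrier (ring_of_integers K)"
  then obtain c :: "nat \<Rightarrow> int" where c: "u = (\<Sum>i<4. of_int (c i) * row R i)" using span by auto
  have sum_eq: "(\<Sum>i<length (map (row R) [0..<4]). of_int (cs ! i) * map (row R) [0..<4] ! i) =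
    (\<Sum>i<4. of_int (cs ! i) * row R i)" for cs :: "int list"
    by (rule sum.cong) simp_all
  show "\<exists>!cs :: int list. length cs = length (map (row R) [0..<4]) \<and>
    u = (\<Sum>i<length (map (row R) [0..<4]). of_int (cs ! i) * map (row R) [0..<4] ! i)"
    unfolding sum_eq
  proof (rule ex1I[of _ "map c [0..<4]"], intro conjI)
    show "u = (\<Sum>i<4. of_int (map c [0..<4] ! i) * row R i)" unfolding c by (rule sum.cong) simp_all
  next
    fix cs :: "int list"
    assume cs: "length cs = length (map (row R) [0..<4]) \<and> u = (\<Sum>i<4. of_int (cs ! i) * row R i)"
    hence eq: "(\<Sum>i<4. of_int (cs ! i) * row R i) = (\<Sum>i<4. of_int (c i) * row R i)" using c by argo
    show "cs = map c [0..<4]"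
    proof (rule nth_equalityI)
      fix i assume "i < length cs"
      hence "i < 4" using cs by simp
      hence "cs ! i = c i" by (rule triangular_coeffs_unique[OF tri eq])
      thus "cs ! i = map c [0..<4] ! i" using \<open>i < 4\<close> by simp
    qed (use cs in simp)
  qed simp
qed

lemma discriminant_rows:
  assumes tri: "triangular R"
    and basis: "integral_basis K (map (row R) [0..<4])"
    and d: "of_int d = 256 * (R 0 0 * R 1 1 * R 2 2 * R 3 3)\<^sup>2 * of_int (g * r) * of_int (g * s) * of_int (r * s)"
  shows "discriminant K = d"
proof (rule discriminant_eqI[OF basis])
  have rows: "map (row R) [0..<4] = map (\<lambda>i. emb (R i 0) (R i 1) (R i 2) (R i 3)) [0..<4]"
    by (simp add: row_def)
  have "det (trace_matrix K (map (row R) [0..<4])) =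
    of_rat (256 * (R 0 0 * R 1 1 * R 2 2 * R 3 3)\<^sup>2 * of_int (g * r) * of_int (g * s) * of_int (r * s))"
    unfolding rows by (rule det_trace_matrix_triangular) (use tri in \<open>auto simp: triangular_def\<close>)
  also have "\<dots> = of_rat (of_int d)" by (simp only: d)
  finally show "of_int d = det (trace_matrix K (map (row R) [0..<4]))" by simp
qed

text \<open>The rows hold the coordinates, with respect to \<open>1, \<alpha>, \<beta>, \<gamma>\<close>, of the two triangular integral bases
  in Williams' classification of biquadratic fields with odd radicands; \<open>\<epsilon> \<equiv> g (mod 4)\<close> is a sign.\<close>
definition basis_1_mod_4 :: "int \<Rightarrow> nat \<Rightarrow> nat \<Rightarrow> rat" where
  "basis_1_mod_4 \<epsilon> i j = [[1, 0, 0, 0], [1/2, 1/2, 0, 0], [1/2, 0, 1/2, 0], [1/4, 1/4, 1/4, of_int \<epsilon> / 4]] ! i ! j"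

definition basis_3_mod_4 :: "nat \<Rightarrow> nat \<Rightarrow> rat" where
  "basis_3_mod_4 i j = [[1, 0, 0, 0], [1/2, 1/2, 0, 0], [0, 0, 1, 0], [0, 0, 1/2, 1/2]] ! i ! j"

lemma algebraic_int_one: "algebraic_int (1 :: complex)"
  using algebraic_int_of_int[of 1] by simp

lemma less_4_cases: "i < 4 \<Longrightarrow> i = 0 \<or> i = 1 \<or> i = 2 \<or> i = (3 :: nat)"
  by linarith

lemma triangular_basis_1_mod_4: "\<epsilon> \<noteq> 0 \<Longrightarrow> triangular (basis_1_mod_4 \<epsilon>)"
  by (auto simp: triangular_def basis_1_mod_4_def numeral_eq_Suc less_Suc_eq)

lemma triangular_basis_3_mod_4: "triangular basis_3_mod_4"
  by (auto simp: triangular_def basis_3_mod_4_def numeral_eq_Suc less_Suc_eq)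

text \<open>The product of (1 + \<alpha>)/2 and (1 + \<beta>)/2 is (1 + \<alpha> + \<beta> + g
  \<gamma>)/4. Writing g = \<epsilon> + 4 k and subtracting k \<gamma> replaces g by the sign
  \<epsilon>, which is the last row.\<close>

lemma integral_basis_1_mod_4:
  assumes gr: "g * r mod 4 = 1" and gs: "g * s mod 4 = 1"
  shows "\<exists>\<epsilon>. \<epsilon>\<^sup>2 = 1 \<and> integral_basis K (map (row (basis_1_mod_4 \<epsilon>)) [0..<4])"
proof -
  obtain \<epsilon> k where \<epsilon>: "g = \<epsilon> + 4 * k" "\<epsilon> = 1 \<or> \<epsilon> = - 1"
  proof -
    from odd_grs(1) have "g mod 4 = 1 \<or> g mod 4 = 3" by (rule odd_int_mod_4)
    thus ?thesis
    proof
      assume "g mod 4 = 1"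
      thus ?thesis by (intro that[of 1 "g div 4"]) presburger+
    next
      assume "g mod 4 = 3"
      thus ?thesis by (intro that[of "- 1" "g div 4 + 1"]) presburger+
    qed
  qed
  have \<epsilon>\<epsilon>: "of_int \<epsilon> * of_int \<epsilon> = (1 :: rat)" using \<epsilon>(2) by auto
  have rs: "(r * s) mod 4 = 1"
  proof -
    have "(g * r) * (g * s) mod 4 = 1" using gr gs by (simp add: mod_mult_eq[of "g * r" 4 "g * s", symmetric])
    moreover have gg: "g * g = 1 + 8 * (2 * k * k) + 8 * \<epsilon> * k" using \<epsilon> by (auto simp: algebra_simps)
    have "(g * r) * (g * s) = (g * g) * (r * s)" by simp
    hence "(g * r) * (g * s) = r * s + 4 * ((2 * (2 * k * k) + 2 * \<epsilon> * k) * (r * s))"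
      unfolding gg by (simp add: algebra_simps)
    ultimately show ?thesis by simp
  qed
  have a: "algebraic_int ((1 + \<alpha>) / 2)" using A.algebraic_int_half[OF gr] .
  have b: "algebraic_int ((1 + \<beta>) / 2)" using B.algebraic_int_half[OF gs] .
  have rows: "row (basis_1_mod_4 \<epsilon>) 0 = 1" "row (basis_1_mod_4 \<epsilon>) 1 = (1 + \<alpha>) / 2" "row (basis_1_mod_4 \<epsilon>) 2 = (1 + \<beta>) / 2"
    "row (basis_1_mod_4 \<epsilon>) 3 = (1 + \<alpha>) / 2 * ((1 + \<beta>) / 2) - of_int k * \<gamma>"
  proof -
    show "row (basis_1_mod_4 \<epsilon>) 0 = 1" "row (basis_1_mod_4 \<epsilon>) 1 = (1 + \<alpha>) / 2" "row (basis_1_mod_4 \<epsilon>) 2 = (1 + \<beta>) / 2"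
      by (simp_all add: row_def basis_1_mod_4_def emb_def of_rat_divide field_simps)
    have "(1 + \<alpha>) / 2 * ((1 + \<beta>) / 2) = (1 + \<alpha> + \<beta> + of_int g * \<gamma>) / 4"
      using products(1) by (simp add: field_simps)
    thus "row (basis_1_mod_4 \<epsilon>) 3 = (1 + \<alpha>) / 2 * ((1 + \<beta>) / 2) - of_int k * \<gamma>"
      by (simp add: row_def basis_1_mod_4_def emb_def of_rat_divide \<epsilon>(1) field_simps)
  qed
  have int: "algebraic_int (row (basis_1_mod_4 \<epsilon>) i)" if "i < 4" for i
  proof -
    have "algebraic_int ((1 + \<alpha>) / 2 * ((1 + \<beta>) / 2) - of_int k * \<gamma>)"
      by (intro algebraic_int_diff algebraic_int_mult a b C.algebraic_int_sqrt algebraic_int_of_int)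
    thus ?thesis using less_4_cases[OF that] a b by (elim disjE) (simp_all only: rows algebraic_int_one)
  qed
  have "integral_basis K (map (row (basis_1_mod_4 \<epsilon>)) [0..<4])"
  proof (rule integral_basis_rows)
    show "triangular (basis_1_mod_4 \<epsilon>)" by (rule triangular_basis_1_mod_4) (use \<epsilon>(2) in auto)
    show "algebraic_int (row (basis_1_mod_4 \<epsilon>) i)" if "i < 4" for i using that by (rule int)
    fix u assume "u \<in> K" and u_int: "algebraic_int u"
    then obtain x0 x1 x2 x3 where u: "u = emb x0 x1 x2 x3" by (auto elim: K_E)
    obtain n0 n1 n2 n3 N1 N2 N3 :: int where
      n: "x0 = of_int n0 / 4" "x1 = of_int n1 / 4" "x2 = of_int n2 / 4" "x3 = of_int n3 / 4" and
      N: "n0\<^sup>2 - g * r * n1\<^sup>2 = 4 * N1" "n0\<^sup>2 - g * s * n2\<^sup>2 = 4 * N2" "n0\<^sup>2 - r * s * n3\<^sup>2 = 4 * N3"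
      using u_int unfolding u by (rule integral_quarters)
    have par: "even (n0 - n1)" "even (n0 - n2)" "even (n0 - n3)"
      using A.parity_if_1_mod_4[OF gr N(1)] B.parity_if_1_mod_4[OF gs N(2)] C.parity_if_1_mod_4[OF rs N(3)] by auto
    have "even (n0 - \<epsilon> * n3)" "even (n1 - \<epsilon> * n3)" "even (n2 - \<epsilon> * n3)"
      using par \<epsilon>(2) by auto
    then obtain k0 k1 k2 where k: "n0 = 2 * k0 + \<epsilon> * n3" "n1 = 2 * k1 + \<epsilon> * n3" "n2 = 2 * k2 + \<epsilon> * n3"
      by (metis dvdE diff_add_cancel)
    \<comment> \<open>Removing the \<gamma>, \<alpha> and \<beta> coordinates by rows 3, 1 and 2
      leaves a rational number, and a rational algebraic integer is an integer. The coefficient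
      \<epsilon> n3 is right because \<epsilon>^2 = 1.\<close>
    have eq: "emb ((of_int k0 - of_int k1 - of_int k2) / 2) 0 0 0 =
      u - of_int (\<epsilon> * n3) * row (basis_1_mod_4 \<epsilon>) 3 - of_int k1 * row (basis_1_mod_4 \<epsilon>) 1 - of_int k2 * row (basis_1_mod_4 \<epsilon>) 2"
      unfolding u row_def emb_scale emb_diff n emb_eq_iff
      using \<epsilon>\<epsilon> by (simp add: basis_1_mod_4_def k field_simps)
    have "algebraic_int (emb ((of_int k0 - of_int k1 - of_int k2) / 2) 0 0 0)"
      unfolding eq by (intro algebraic_int_diff algebraic_int_mult u_int int algebraic_int_of_int) auto
    then obtain m :: int where "(of_int k0 - of_int k1 - of_int k2) / 2 = (of_int m :: rat)"
      unfolding emb_of_rat[symmetric] using A.algebraic_int_rat by blast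
    hence "of_int m =
      u - of_int (\<epsilon> * n3) * row (basis_1_mod_4 \<epsilon>) 3 - of_int k1 * row (basis_1_mod_4 \<epsilon>) 1 - of_int k2 * row (basis_1_mod_4 \<epsilon>) 2"
      using eq by (simp only: emb_of_int)
    moreover have "u = t * 1 + b + c + a" if "t = u - a - b - c" for t a b c :: complex
      using that by simp
    ultimately have "u = of_int m * row (basis_1_mod_4 \<epsilon>) 0 + of_int k1 * row (basis_1_mod_4 \<epsilon>) 1 + of_int k2 * row (basis_1_mod_4 \<epsilon>) 2
      + of_int (\<epsilon> * n3) * row (basis_1_mod_4 \<epsilon>) 3"
      unfolding rows(1) by blast
    moreover have "{..<4} = {0, 1, 2, 3 :: nat}" by auto
    ultimately show "\<exists>c :: nat \<Rightarrow> int. u = (\<Sum>i<4. of_int (c i) * row (basis_1_mod_4 \<epsilon>) i)"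
      by (intro exI[of _ "\<lambda>i. [m, k1, k2, \<epsilon> * n3] ! i"]) (simp add: add.assoc)
  qed
  thus ?thesis using \<epsilon>(2) by (intro exI[of _ \<epsilon>]) auto
qed

text \<open>Here r s is also 3 modulo 4, so no quarters occur. The last row is \<beta> (1 +
  \<alpha>)/2 = (\<beta> + g \<gamma>)/2 minus k \<gamma>, where g = 2 k + 1.\<close>

lemma integral_basis_3_mod_4:
  assumes gr: "g * r mod 4 = 1" and gs: "g * s mod 4 = 3"
  shows "integral_basis K (map (row basis_3_mod_4) [0..<4])"
proof -
  have rs: "(r * s) mod 4 = 3"
  proof -
    have "(g * r) * (g * s) mod 4 = 3" using gr gs by (simp add: mod_mult_eq[of "g * r" 4 "g * s", symmetric])
    moreover obtain k where "g = 2 * k + 1" using odd_grs(1) by (rule oddE)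
    hence "(g * r) * (g * s) = r * s + 4 * ((k * k + k) * (r * s))"
      by (simp add: algebra_simps)
    ultimately show ?thesis by simp
  qed
  obtain k where gk: "g = 2 * k + 1" using odd_grs(1) by (rule oddE)
  have a: "algebraic_int ((1 + \<alpha>) / 2)" using A.algebraic_int_half[OF gr] .
  have rows: "row basis_3_mod_4 0 = 1" "row basis_3_mod_4 1 = (1 + \<alpha>) / 2" "row basis_3_mod_4 2 = \<beta>"
    "row basis_3_mod_4 3 = \<beta> * ((1 + \<alpha>) / 2) - of_int k * \<gamma>"
  proof -
    show "row basis_3_mod_4 0 = 1" "row basis_3_mod_4 1 = (1 + \<alpha>) / 2" "row basis_3_mod_4 2 = \<beta>"
      by (simp_all add: row_def basis_3_mod_4_def emb_def of_rat_divide field_simps)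
    have "\<beta> * ((1 + \<alpha>) / 2) = (\<beta> + of_int g * \<gamma>) / 2"
      using products(1) by (simp add: field_simps)
    thus "row basis_3_mod_4 3 = \<beta> * ((1 + \<alpha>) / 2) - of_int k * \<gamma>"
      by (simp add: row_def basis_3_mod_4_def emb_def of_rat_divide gk field_simps)
  qed
  have int: "algebraic_int (row basis_3_mod_4 i)" if "i < 4" for i
  proof -
    have "algebraic_int (\<beta> * ((1 + \<alpha>) / 2) - of_int k * \<gamma>)"
      by (intro algebraic_int_diff algebraic_int_mult a B.algebraic_int_sqrt C.algebraic_int_sqrt algebraic_int_of_int)
    thus ?thesis using less_4_cases[OF that] a B.algebraic_int_sqrt by (elim disjE) (simp_all only: rows algebraic_int_one)
  qed
  show ?thesis
  proof (rule integral_basis_rows)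
    show "triangular (basis_3_mod_4)" by (rule triangular_basis_3_mod_4)
    show "algebraic_int (row basis_3_mod_4 i)" if "i < 4" for i using that by (rule int)
    fix u assume "u \<in> K" and u_int: "algebraic_int u"
    then obtain x0 x1 x2 x3 where u: "u = emb x0 x1 x2 x3" by (auto elim: K_E)
    obtain n0 n1 n2 n3 N1 N2 N3 :: int where
      n: "x0 = of_int n0 / 4" "x1 = of_int n1 / 4" "x2 = of_int n2 / 4" "x3 = of_int n3 / 4" and
      N: "n0\<^sup>2 - g * r * n1\<^sup>2 = 4 * N1" "n0\<^sup>2 - g * s * n2\<^sup>2 = 4 * N2" "n0\<^sup>2 - r * s * n3\<^sup>2 = 4 * N3"
      using u_int unfolding u by (rule integral_quarters)
    have "even n0" "even n1" "even n2" "even n3"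
      using A.parity_if_1_mod_4[OF gr N(1)] B.parity_if_3_mod_4[OF gs N(2)] C.parity_if_3_mod_4[OF rs N(3)] by auto
    then obtain k0 k1 k2 k3 where k: "n0 = 2 * k0" "n1 = 2 * k1" "n2 = 2 * k2" "n3 = 2 * k3"
      by (elim evenE)
    \<comment> \<open>Rows 3 and 1 remove the \<gamma> and \<alpha> coordinates. The rest lies in
      the field of \<beta>, whose integers have integral coordinates because g s is 3 modulo
      4.\<close>
    have eq: "emb ((of_int k0 - of_int k1) / 2) 0 ((of_int k2 - of_int k3) / 2) 0 =
      u - of_int k3 * row basis_3_mod_4 3 - of_int k1 * row basis_3_mod_4 1"
      unfolding u row_def emb_scale emb_diff n emb_eq_iff
      by (simp add: basis_3_mod_4_def k field_simps)
    have "algebraic_int (emb ((of_int k0 - of_int k1) / 2) 0 ((of_int k2 - of_int k3) / 2) 0)"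
      unfolding eq by (intro algebraic_int_diff algebraic_int_mult u_int int algebraic_int_of_int) auto
    hence "algebraic_int (of_rat ((of_int k0 - of_int k1) / 2) + of_rat ((of_int k2 - of_int k3) / 2) * \<beta>)"
      by (simp add: emb_def)
    then obtain m0 m2 N where m: "(of_int k0 - of_int k1) / 2 = (of_int m0 / 2 :: rat)"
      "(of_int k2 - of_int k3) / 2 = (of_int m2 / 2 :: rat)" "m0\<^sup>2 - g * s * m2\<^sup>2 = 4 * N"
      by (rule B.integral_coords)
    then obtain l0 l2 where l: "m0 = 2 * l0" "m2 = 2 * l2"
      using B.parity_if_3_mod_4[OF gs m(3)] by (elim evenE)
    have "emb (of_int l0) 0 (of_int l2) 0 = u - of_int k3 * row basis_3_mod_4 3 - of_int k1 * row basis_3_mod_4 1"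
      using eq m by (simp add: l)
    moreover have "emb (of_int l0) 0 (of_int l2) 0 = of_int l0 * row basis_3_mod_4 0 + of_int l2 * row basis_3_mod_4 2"
      by (simp add: rows emb_def)
    moreover have "u = p + b + q + a" if "e = u - a - b" "e = p + q" for e a b p q :: complex
      using that by (simp add: algebra_simps)
    ultimately have "u = of_int l0 * row basis_3_mod_4 0 + of_int k1 * row basis_3_mod_4 1 + of_int l2 * row basis_3_mod_4 2 + of_int k3 * row basis_3_mod_4 3"
      by blast
    moreover have "{..<4} = {0, 1, 2, 3 :: nat}" by auto
    ultimately show "\<exists>c :: nat \<Rightarrow> int. u = (\<Sum>i<4. of_int (c i) * row basis_3_mod_4 i)"
      by (intro exI[of _ "\<lambda>i. [l0, k1, l2, k3] ! i"]) (simp add: add.assoc)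
  qed
qed

text \<open>The diagonal products of the two bases are \<epsilon>/16 and 1/4. Their squares turn the
  factor 256 into 1 and 16, and g r * g s * r s is the square of g r s.\<close>

lemma discriminant_if_1_mod_4:
  assumes gr: "g * r mod 4 = 1"
  shows "discriminant K = (g * r * s)\<^sup>2 \<or> discriminant K = 16 * (g * r * s)\<^sup>2"
    and "\<exists>ws. integral_basis K ws"
proof -
  have "odd (g * s)" using odd_grs by simp
  hence "g * s mod 4 = 1 \<or> g * s mod 4 = 3" by (rule odd_int_mod_4)
  hence "(\<exists>ws. integral_basis K ws) \<and> (discriminant K = (g * r * s)\<^sup>2 \<or> discriminant K = 16 * (g * r * s)\<^sup>2)"
  proof
    assume gs: "g * s mod 4 = 1"
    obtain \<epsilon> where \<epsilon>: "\<epsilon>\<^sup>2 = 1" "integral_basis K (map (row (basis_1_mod_4 \<epsilon>)) [0..<4])"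
      using integral_basis_1_mod_4[OF gr gs] by blast
    have "discriminant K = (g * r * s)\<^sup>2"
    proof (rule discriminant_rows[OF _ \<epsilon>(2)])
      show "triangular (basis_1_mod_4 \<epsilon>)" by (rule triangular_basis_1_mod_4) (use \<epsilon>(1) in auto)
      have "(of_int \<epsilon>)\<^sup>2 = (1 :: rat)" using \<epsilon>(1) by (metis of_int_1 of_int_power)
      thus "of_int ((g * r * s)\<^sup>2) = 256 * (basis_1_mod_4 \<epsilon> 0 0 * basis_1_mod_4 \<epsilon> 1 1 * basis_1_mod_4 \<epsilon> 2 2 * basis_1_mod_4 \<epsilon> 3 3)\<^sup>2 *
        rat_of_int (g * r) * of_int (g * s) * of_int (r * s)"
        by (simp add: basis_1_mod_4_def power_divide) (simp add: power2_eq_square)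
    qed
    with \<epsilon> show ?thesis by blast
  next
    assume gs: "g * s mod 4 = 3"
    have "discriminant K = 16 * (g * r * s)\<^sup>2"
    proof (rule discriminant_rows[OF _ integral_basis_3_mod_4[OF gr gs]])
      show "triangular (basis_3_mod_4)" by (rule triangular_basis_3_mod_4)
      show "of_int (16 * (g * r * s)\<^sup>2) = 256 * (basis_3_mod_4 0 0 * basis_3_mod_4 1 1 * basis_3_mod_4 2 2 * basis_3_mod_4 3 3)\<^sup>2 *
        rat_of_int (g * r) * of_int (g * s) * of_int (r * s)"
        by (simp add: basis_3_mod_4_def power_divide) (simp add: power2_eq_square)
    qed
    with integral_basis_3_mod_4[OF gr gs] show ?thesis by blast
  qed
  thus "discriminant K = (g * r * s)\<^sup>2 \<or> discriminant K = 16 * (g * r * s)\<^sup>2" "\<exists>ws. integral_basis K ws"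
    by blast+
qed

lemma integral_basis_and_discriminant:
  "(\<exists>ws. integral_basis K ws) \<and> (discriminant K = (g * r * s)\<^sup>2 \<or> discriminant K = 16 * (g * r * s)\<^sup>2)"
proof -
  interpret S: biquadratic_field g s r \<beta> \<alpha> \<gamma> by (rule swap)
  interpret T: biquadratic_field r g s \<alpha> \<gamma> \<beta> by (rule rotate)
  interpret TS: biquadratic_field r s g \<gamma> \<alpha> \<beta> by (rule T.swap)
  have K_eqs: "S.K = K" "TS.K = K" using K_swap K_rotate T.K_swap by simp_all
  have grs: "g * s * r = g * r * s" "r * s * g = g * r * s" by simp_all
  \<comment> \<open>Two of the three odd numbers g, r, s agree modulo 4, and their product is 1
    modulo 4.\<close>
  have "g * r mod 4 = 1 \<or> g * s mod 4 = 1 \<or> r * s mod 4 = 1"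
  proof (rule ccontr)
    assume neg: "\<not> ?thesis"
    have mods: "g * r mod 4 = (g mod 4) * (r mod 4) mod 4" "g * s mod 4 = (g mod 4) * (s mod 4) mod 4"
      "r * s mod 4 = (r mod 4) * (s mod 4) mod 4"
      by (simp_all only: mod_mult_eq)
    have "g mod 4 = 1 \<or> g mod 4 = 3" "r mod 4 = 1 \<or> r mod 4 = 3" "s mod 4 = 1 \<or> s mod 4 = 3"
      by (intro odd_int_mod_4 odd_grs)+
    thus False using neg unfolding mods by (elim disjE) simp_all
  qed
  then consider "g * r mod 4 = 1" | "g * s mod 4 = 1" | "r * s mod 4 = 1" by blast
  thus ?thesis
  proof cases
    case 1
    show ?thesis using discriminant_if_1_mod_4[OF 1] by (intro conjI)
  next
    case 2
    show ?thesis using S.discriminant_if_1_mod_4[OF 2] unfolding K_eqs grs by (intro conjI)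
  next
    case 3
    show ?thesis using TS.discriminant_if_1_mod_4[OF 3] unfolding K_eqs grs by (intro conjI)
  qed
qed

end

section \<open>Invertibility of ideals\<close>

lemma ideal_prod_least:
  assumes "\<And>a b. a \<in> A \<Longrightarrow> b \<in> B \<Longrightarrow> a * b \<in> M" "\<And>u v. u \<in> M \<Longrightarrow> v \<in> M \<Longrightarrow> u + v \<in> M"
  shows "ideal_prod complex_ring A B \<subseteq> M"
proof
  fix u assume "u \<in> ideal_prod complex_ring A B"
  thus "u \<in> M" by induction (use assms in simp_all)
qed

lemma ideal_prod_mult: "a \<in> A \<Longrightarrow> b \<in> B \<Longrightarrow> a * b \<in> ideal_prod complex_ring A B"
  using ideal_prod.prod[of a A b B complex_ring] by simp

lemma ideal_prod_add:
  "u \<in> ideal_prod complex_ring A B \<Longrightarrow> v \<in> ideal_prod complex_ring A B \<Longrightarrow> u + v \<in> ideal_prod complex_ring A B"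
  using ideal_prod.sum[of u complex_ring A B v] by simp

lemma ideal_prod_commute: "ideal_prod complex_ring A B = ideal_prod complex_ring B A"
proof -
  have "ideal_prod complex_ring A B \<subseteq> ideal_prod complex_ring B A" for A B
  proof (rule ideal_prod_least)
    fix a b assume "a \<in> A" "b \<in> B"
    hence "b * a \<in> ideal_prod complex_ring B A" by (intro ideal_prod_mult)
    thus "a * b \<in> ideal_prod complex_ring B A" by (simp only: mult.commute)
  qed (rule ideal_prod_add)
  thus ?thesis by blast
qed

lemma ideal_prod_assoc:
  "ideal_prod complex_ring (ideal_prod complex_ring A B) C = ideal_prod complex_ring A (ideal_prod complex_ring B C)"
proof -
  have le: "ideal_prod complex_ring (ideal_prod complex_ring A B) C \<subseteq> ideal_prod complex_ring A (ideal_prod complex_ring B C)"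
    for A B C
  proof (rule ideal_prod_least)
    fix u c assume u: "u \<in> ideal_prod complex_ring A B" and c: "c \<in> C"
    have "ideal_prod complex_ring A B \<subseteq> {u. u * c \<in> ideal_prod complex_ring A (ideal_prod complex_ring B C)}"
      using c by (intro ideal_prod_least)
        (auto simp: mult.assoc distrib_right intro: ideal_prod_mult ideal_prod_add)
    thus "u * c \<in> ideal_prod complex_ring A (ideal_prod complex_ring B C)" using u by blast
  qed (rule ideal_prod_add)
  \<comment> \<open>The reverse inclusion is the one already shown, read with the order of the
    factors reversed.\<close>
  have "ideal_prod complex_ring A (ideal_prod complex_ring B C) = ideal_prod complex_ring (ideal_prod complex_ring C B) A"
    by (simp only: ideal_prod_commute[of A] ideal_prod_commute[of B])
  also have "\<dots> \<subseteq> ideal_prod complex_ring C (ideal_prod complex_ring B A)" by (rule le)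
  also have "\<dots> = ideal_prod complex_ring (ideal_prod complex_ring A B) C"
    by (simp only: ideal_prod_commute[of C] ideal_prod_commute[of B])
  finally show ?thesis using le[of A B C] by blast
qed

definition scale_set :: "complex \<Rightarrow> complex set \<Rightarrow> complex set" where
  "scale_set c A = (\<lambda>z. c * z) ` A"

lemma scale_set_one [simp]: "scale_set 1 A = A"
  by (simp add: scale_set_def)

lemma scale_set_mult: "scale_set c (scale_set d A) = scale_set (c * d) A"
  by (simp add: scale_set_def image_image mult.assoc)

lemma ideal_prod_scale_set:
  "ideal_prod complex_ring (scale_set c A) B = scale_set c (ideal_prod complex_ring A B)"
proof
  show "ideal_prod complex_ring (scale_set c A) B \<subseteq> scale_set c (ideal_prod complex_ring A B)"
  proof (rule ideal_prod_least)
    fix a b assume "a \<in> scale_set c A" "b \<in> B"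
    thus "a * b \<in> scale_set c (ideal_prod complex_ring A B)"
      by (auto simp: scale_set_def mult.assoc intro!: imageI ideal_prod_mult)
  next
    fix u v assume "u \<in> scale_set c (ideal_prod complex_ring A B)" "v \<in> scale_set c (ideal_prod complex_ring A B)"
    then obtain u' v' where "u = c * u'" "v = c * v'" "u' \<in> ideal_prod complex_ring A B" "v' \<in> ideal_prod complex_ring A B"
      by (auto simp: scale_set_def)
    thus "u + v \<in> scale_set c (ideal_prod complex_ring A B)"
      unfolding scale_set_def by (intro image_eqI[of _ _ "u' + v'"]) (simp_all add: distrib_left ideal_prod_add)
  qed
  have "ideal_prod complex_ring A B \<subseteq> {u. c * u \<in> ideal_prod complex_ring (scale_set c A) B}"
  proof (rule ideal_prod_least)
    fix a b assume ab: "a \<in> A" "b \<in> B"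
    have "c * a \<in> scale_set c A" unfolding scale_set_def using ab(1) by (rule imageI)
    hence "(c * a) * b \<in> ideal_prod complex_ring (scale_set c A) B" using ab(2) by (rule ideal_prod_mult)
    thus "a * b \<in> {u. c * u \<in> ideal_prod complex_ring (scale_set c A) B}" by (simp add: mult.assoc)
  qed (simp add: distrib_left ideal_prod_add)
  thus "scale_set c (ideal_prod complex_ring A B) \<subseteq> ideal_prod complex_ring (scale_set c A) B"
    by (auto simp: scale_set_def)
qed

lemma ideal_prod_scale_set_right:
  "ideal_prod complex_ring A (scale_set c B) = scale_set c (ideal_prod complex_ring A B)"
  by (simp only: ideal_prod_commute[of A] ideal_prod_scale_set)

text \<open>Collects what the ideal theory rests on: a field closed under the operations, an
  integral basis, which makes the integers modulo n finite, and denominators, which put a positive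
  integer into every nonzero ideal.\<close>

locale number_ring =
  fixes K :: "complex set" and ws :: "complex list"
  assumes K_of_int: "of_int n \<in> K"
    and K_add: "u \<in> K \<Longrightarrow> v \<in> K \<Longrightarrow> u + v \<in> K"
    and K_mult: "u \<in> K \<Longrightarrow> v \<in> K \<Longrightarrow> u * v \<in> K"
    and K_inverse: "u \<in> K \<Longrightarrow> 1 / u \<in> K"
    and basis: "integral_basis K ws"
    and denominator: "u \<in> K \<Longrightarrow> \<exists>n :: int. n > 0 \<and> algebraic_int (of_int n * u)"
begin

definition Int_K :: "complex set" where
  "Int_K = {u \<in> K. algebraic_int u}"

lemma K_uminus: "u \<in> K \<Longrightarrow> - u \<in> K"
  using K_mult[OF K_of_int[of "- 1"]] by simp

lemma Int_of_int [simp]: "of_int n \<in> Int_K"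
  by (simp add: Int_K_def K_of_int)

lemma Int_0 [simp]: "0 \<in> Int_K" and Int_1 [simp]: "1 \<in> Int_K"
  using Int_of_int[of 0] Int_of_int[of 1] by simp_all

lemma Int_add: "u \<in> Int_K \<Longrightarrow> v \<in> Int_K \<Longrightarrow> u + v \<in> Int_K"
  by (simp add: Int_K_def K_add algebraic_int_add)

lemma Int_mult: "u \<in> Int_K \<Longrightarrow> v \<in> Int_K \<Longrightarrow> u * v \<in> Int_K"
  by (simp add: Int_K_def K_mult algebraic_int_mult)

lemma Int_uminus: "u \<in> Int_K \<Longrightarrow> - u \<in> Int_K"
  by (simp add: Int_K_def K_uminus)

lemma Int_diff: "u \<in> Int_K \<Longrightarrow> v \<in> Int_K \<Longrightarrow> u - v \<in> Int_K"
  using Int_add[OF _ Int_uminus] by fastforce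

lemma Int_sum: "(\<And>i. i \<in> A \<Longrightarrow> f i \<in> Int_K) \<Longrightarrow> sum f A \<in> Int_K"
  by (induction A rule: infinite_finite_induct) (auto intro: Int_add)

lemma Int_subset_K: "Int_K \<subseteq> K"
  by (auto simp: Int_K_def)

lemma basis_Int: "i < length ws \<Longrightarrow> ws ! i \<in> Int_K"
proof -
  have "set ws \<subseteq> Int_K"
    using basis unfolding integral_basis_def carrier_ring_of_integers Int_K_def by (rule conjunct1)
  thus "i < length ws \<Longrightarrow> ws ! i \<in> Int_K" using nth_mem by blast
qed

definition multiples :: "int \<Rightarrow> complex set" where
  "multiples n = scale_set (of_int n) Int_K"

lemma multiples_iff: "n \<noteq> 0 \<Longrightarrow> u \<in> multiples n \<longleftrightarrow> u / of_int n \<in> Int_K"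
  by (force simp: multiples_def scale_set_def)

lemma multiples_add: "u \<in> multiples n \<Longrightarrow> v \<in> multiples n \<Longrightarrow> u + v \<in> multiples n"
  unfolding multiples_def scale_set_def
  by (auto intro!: image_eqI[of _ _ "_ + _"] simp: Int_add distrib_left)

lemma multiples_mult: "a \<in> Int_K \<Longrightarrow> u \<in> multiples n \<Longrightarrow> a * u \<in> multiples n"
proof -
  assume "a \<in> Int_K" "u \<in> multiples n"
  then obtain v where "u = of_int n * v" "v \<in> Int_K" by (auto simp: multiples_def scale_set_def)
  thus "a * u \<in> multiples n" using \<open>a \<in> Int_K\<close>
    unfolding multiples_def scale_set_def by (intro image_eqI[of _ _ "a * v"]) (simp_all add: Int_mult)
qed

lemma multiples_diff: "u \<in> multiples n \<Longrightarrow> v \<in> multiples n \<Longrightarrow> u - v \<in> multiples n"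
  using multiples_add[of u n "- v"] multiples_mult[of "- 1" v n] Int_uminus[OF Int_1] by simp

lemma multiples_Int: "u \<in> multiples n \<Longrightarrow> u \<in> Int_K"
  by (auto simp: multiples_def scale_set_def intro: Int_mult)

text \<open>Reduce the coordinates in the integral basis modulo \<open>n\<close>. Finiteness of the
  residue ring takes the place of chain conditions in the arguments that follow.\<close>

lemma finite_representatives:
  assumes "n > 0"
  obtains R where "finite R" "R \<subseteq> Int_K" "\<And>u. u \<in> Int_K \<Longrightarrow> \<exists>\<rho>\<in>R. u - \<rho> \<in> multiples n"
proof -
  let ?L = "{..<length ws}"
  define R where "R = (\<lambda>c. \<Sum>i\<in>?L. of_int (c i) * ws ! i) ` (PiE ?L (\<lambda>_. {0..<n}))"
  have "finite R" unfolding R_def by (intro finite_imageI finite_PiE) auto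
  moreover have "R \<subseteq> Int_K" unfolding R_def
    by (rule image_subsetI, rule Int_sum, rule Int_mult) (simp_all add: basis_Int)
  moreover have "\<exists>\<rho>\<in>R. u - \<rho> \<in> multiples n" if u: "u \<in> Int_K" for u
  proof -
    have u': "u \<in> carrier (ring_of_integers K)" using u by (simp add: Int_K_def)
    obtain c :: "nat \<Rightarrow> int" where c: "u = (\<Sum>i\<in>?L. of_int (c i) * ws ! i)"
      using integral_basis_coeffs_ex[OF basis u'] by (elim exE)
    define \<rho> where "\<rho> = (\<Sum>i\<in>?L. of_int (restrict (\<lambda>i. c i mod n) ?L i) * ws ! i)"
    have "\<rho> \<in> R"
      unfolding \<rho>_def R_def using assms by (intro imageI restrict_PiE_iff[THEN iffD2]) auto
    have "u - \<rho> = (\<Sum>i\<in>?L. of_int (c i) * ws ! i - of_int (c i mod n) * ws ! i)"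
      unfolding c \<rho>_def by (simp add: sum_subtractf)
    also have "\<dots> = (\<Sum>i\<in>?L. of_int n * (of_int (c i div n) * ws ! i))"
    proof (rule sum.cong[OF refl])
      fix i
      have "of_int (c i) = of_int n * of_int (c i div n) + (of_int (c i mod n) :: complex)"
        by (metis mult_div_mod_eq of_int_add of_int_mult)
      thus "of_int (c i) * ws ! i - of_int (c i mod n) * ws ! i = of_int n * (of_int (c i div n) * ws ! i)"
        by (simp add: algebra_simps)
    qed
    also have "\<dots> = of_int n * (\<Sum>i\<in>?L. of_int (c i div n) * ws ! i)" by (simp only: sum_distrib_left)
    also have "\<dots> \<in> multiples n"
      unfolding multiples_def scale_set_def by (intro imageI Int_sum Int_mult basis_Int) auto
    finally show ?thesis using \<open>\<rho> \<in> R\<close> by blast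
  qed
  ultimately show ?thesis by (rule that)
qed

text \<open>Pigeonhole modulo \<open>n\<close>: two powers of \<open>u\<close> differ by an integer of \<open>K\<close>.\<close>
lemma integrally_closed:
  assumes u: "u \<in> K" and v: "v \<in> K" "v \<noteq> 0" and powers: "\<And>k. v * u ^ k \<in> Int_K"
  shows "u \<in> Int_K"
proof -
  obtain n :: int where n: "n > 0" "algebraic_int (of_int n * (1 / v))"
    using denominator[OF K_inverse[OF v(1)]] by blast
  have "of_int n * (1 / v) \<in> Int_K" using n(2) v(1) by (simp add: Int_K_def K_mult K_inverse K_of_int del: times_divide_eq_right)
  hence "(of_int n * (1 / v)) * (v * u ^ k) \<in> Int_K" for k using powers by (rule Int_mult)
  hence nu: "of_int n * u ^ k \<in> Int_K" for k using v(2) by simp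
  obtain R where R: "finite R" "\<And>u. u \<in> Int_K \<Longrightarrow> \<exists>\<rho>\<in>R. u - \<rho> \<in> multiples n"
    using finite_representatives[OF n(1)] by metis
  have "\<exists>\<rho>. \<forall>k. \<rho> k \<in> R \<and> of_int n * u ^ k - \<rho> k \<in> multiples n"
    using R(2)[OF nu] by (intro choice) blast
  then obtain \<rho> where \<rho>: "\<And>k. \<rho> k \<in> R" "\<And>k. of_int n * u ^ k - \<rho> k \<in> multiples n" by blast
  have "\<not> inj \<rho>"
    using R(1) \<rho>(1) by (metis finite_imageD finite_subset image_subsetI infinite_UNIV_nat)
  then obtain i j where ij: "i < j" "\<rho> i = \<rho> j"
    unfolding inj_on_def by (metis linorder_neqE_nat)
  have "(of_int n * u ^ j - \<rho> j) - (of_int n * u ^ i - \<rho> i) \<in> multiples n"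
    by (intro multiples_diff \<rho>(2))
  hence "of_int n * (u ^ j - u ^ i) \<in> multiples n" by (simp add: ij(2) algebra_simps)
  hence "u ^ j - u ^ i \<in> Int_K" using n(1) by (simp add: multiples_iff)
  hence diff: "algebraic_int (u ^ j - u ^ i)" by (simp add: Int_K_def)
  \<comment> \<open>So u solves a monic equation whose other coefficients are algebraic integers; i
    < j keeps the degree at j.\<close>
  have poly: "poly (monom 1 j - monom 1 i) u = u ^ j - u ^ i" by (simp add: poly_monom)
  have deg: "degree (monom 1 j - monom 1 i :: complex poly) = j"
    using ij(1) degree_add_eq_left[of "- monom 1 i :: complex poly" "monom 1 j"] by (simp add: degree_monom_eq)
  have "algebraic_int u"
    using diff poly by (rule algebraic_int_root) (use ij(1) in \<open>auto simp: deg\<close>)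
  thus ?thesis using u by (simp add: Int_K_def)
qed

text \<open>Any \<open>Int_K\<close>-submodule of K qualifies, without a common denominator.
  Products and \<open>inverse_ideal\<close> then belong here with no side conditions.\<close>

definition fractional :: "complex set \<Rightarrow> bool" where
  "fractional A \<longleftrightarrow> A \<subseteq> K \<and> 0 \<in> A \<and> (\<forall>u\<in>A. \<forall>v\<in>A. u + v \<in> A) \<and> (\<forall>a\<in>Int_K. \<forall>u\<in>A. a * u \<in> A)"

lemma fractionalD:
  assumes "fractional A"
  shows "u \<in> A \<Longrightarrow> u \<in> K" "0 \<in> A" "u \<in> A \<Longrightarrow> v \<in> A \<Longrightarrow> u + v \<in> A" "a \<in> Int_K \<Longrightarrow> u \<in> A \<Longrightarrow> a * u \<in> A"
  using assms by (auto simp: fractional_def)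

lemma fractional_diff: "fractional A \<Longrightarrow> u \<in> A \<Longrightarrow> v \<in> A \<Longrightarrow> u - v \<in> A"
  using fractionalD(3)[of A u "- v"] fractionalD(4)[of A "- 1" v] Int_uminus[OF Int_1] by simp

lemma fractional_Int: "fractional Int_K"
  by (auto simp: fractional_def Int_add Int_mult Int_K_def[symmetric] dest: subsetD[OF Int_subset_K])

lemma fractional_scale_set: "fractional A \<Longrightarrow> c \<in> K \<Longrightarrow> fractional (scale_set c A)"
  unfolding fractional_def scale_set_def
proof (intro conjI ballI)
  assume A: "A \<subseteq> K \<and> 0 \<in> A \<and> (\<forall>u\<in>A. \<forall>v\<in>A. u + v \<in> A) \<and> (\<forall>a\<in>Int_K. \<forall>u\<in>A. a * u \<in> A)" and c: "c \<in> K"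
  show "(*) c ` A \<subseteq> K" using A c by (auto intro: K_mult)
  show "0 \<in> (*) c ` A" using A by (intro image_eqI[of _ _ 0]) auto
  show "u + v \<in> (*) c ` A" if "u \<in> (*) c ` A" "v \<in> (*) c ` A" for u v
    using that A by (auto simp flip: distrib_left)
  show "a * u \<in> (*) c ` A" if "a \<in> Int_K" "u \<in> (*) c ` A" for a u
    using that A by (auto simp: mult.left_commute)
qed

lemma fractional_ideal_prod:
  assumes "fractional A" "fractional B"
  shows "fractional (ideal_prod complex_ring A B)"
  unfolding fractional_def
proof (intro conjI ballI)
  show "ideal_prod complex_ring A B \<subseteq> K"
    by (rule ideal_prod_least) (use assms in \<open>auto intro: K_mult K_add fractionalD\<close>)
  show "0 \<in> ideal_prod complex_ring A B"
    using ideal_prod_mult[of 0 A 0 B] assms fractionalD(2) by simp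
  show "u + v \<in> ideal_prod complex_ring A B"
    if "u \<in> ideal_prod complex_ring A B" "v \<in> ideal_prod complex_ring A B" for u v
    using that by (rule ideal_prod_add)
  show "a * u \<in> ideal_prod complex_ring A B" if "a \<in> Int_K" "u \<in> ideal_prod complex_ring A B" for a u
  proof -
    have "ideal_prod complex_ring A B \<subseteq> {u. a * u \<in> ideal_prod complex_ring A B}"
    proof (rule ideal_prod_least)
      fix x y assume xy: "x \<in> A" "y \<in> B"
      have "a * x \<in> A" using assms(1) \<open>a \<in> Int_K\<close> xy(1) by (rule fractionalD)
      hence "(a * x) * y \<in> ideal_prod complex_ring A B" using xy(2) by (rule ideal_prod_mult)
      thus "x * y \<in> {u. a * u \<in> ideal_prod complex_ring A B}" by (simp add: mult.assoc)
    qed (simp add: distrib_left ideal_prod_add)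
    thus ?thesis using that(2) by blast
  qed
qed

lemma ideal_prod_Int:
  assumes "fractional A"
  shows "ideal_prod complex_ring Int_K A = A"
proof
  show "ideal_prod complex_ring Int_K A \<subseteq> A"
    by (rule ideal_prod_least) (use fractionalD[OF assms] in blast)+
  show "A \<subseteq> ideal_prod complex_ring Int_K A"
    using ideal_prod_mult[OF Int_1] by fastforce
qed

lemma fractional_inverse: "fractional (inverse_ideal K I)"
  unfolding fractional_def
proof (intro conjI ballI)
  show "0 \<in> inverse_ideal K I" using K_of_int[of 0] by (simp add: inverse_ideal_def)
  show "u + v \<in> inverse_ideal K I" if "u \<in> inverse_ideal K I" "v \<in> inverse_ideal K I" for u v
    using that by (auto simp: inverse_ideal_def distrib_right intro: K_add algebraic_int_add)
  show "a * u \<in> inverse_ideal K I" if "a \<in> Int_K" "u \<in> inverse_ideal K I" for a u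
    using that by (auto simp: inverse_ideal_def Int_K_def mult.assoc intro: K_mult algebraic_int_mult)
qed (auto simp: inverse_ideal_def)

lemma inverse_idealD: "u \<in> inverse_ideal K I \<Longrightarrow> z \<in> I \<Longrightarrow> u * z \<in> Int_K"
  by (simp add: inverse_ideal_def Int_K_def)

lemma inverse_idealI: "u \<in> K \<Longrightarrow> (\<And>z. z \<in> I \<Longrightarrow> u * z \<in> Int_K) \<Longrightarrow> u \<in> inverse_ideal K I"
  by (simp add: inverse_ideal_def Int_K_def)

definition int_ideal :: "complex set \<Rightarrow> bool" where
  "int_ideal I \<longleftrightarrow> fractional I \<and> I \<subseteq> Int_K \<and> I \<noteq> {0}"

lemma int_idealD:
  assumes "int_ideal I"
  shows "fractional I" "u \<in> I \<Longrightarrow> u \<in> Int_K" "\<exists>u\<in>I. u \<noteq> 0"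
  using assms fractionalD(2)[of I] by (auto simp: int_ideal_def)

lemma int_ideal_eq_Int: "int_ideal I \<Longrightarrow> 1 \<in> I \<Longrightarrow> I = Int_K"
  using fractionalD(4)[OF int_idealD(1), of I _ 1] int_idealD(2)[of I] by auto

lemma one_in_inverse: "int_ideal I \<Longrightarrow> 1 \<in> inverse_ideal K I"
  using K_of_int[of 1] int_idealD(2) by (auto intro: inverse_idealI)

lemma int_ideal_contains_int:
  assumes "int_ideal I"
  obtains n :: int where "n > 0" "of_int n \<in> I"
proof -
  obtain u where u: "u \<in> I" "u \<noteq> 0" using int_idealD(3)[OF assms] by blast
  have "u \<in> K" using u assms int_idealD(1) fractionalD(1) by blast
  then obtain n :: int where n: "n > 0" "algebraic_int (of_int n * (1 / u))"
    using denominator[OF K_inverse] by blast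
  have "of_int n * (1 / u) \<in> Int_K"
    using n(2) \<open>u \<in> K\<close> by (simp add: Int_K_def K_mult K_inverse K_of_int del: times_divide_eq_right)
  hence "(of_int n * (1 / u)) * u \<in> I" using fractionalD(4)[OF int_idealD(1)[OF assms]] u(1) by blast
  thus ?thesis using n(1) u(2) by (intro that[of n]) simp_all
qed

text \<open>If \<open>I\<close> is a proper ideal containing \<open>n\<close>, the elements killed modulo \<open>n\<close> by some \<open>1 - e\<close> with
  \<open>e \<in> I\<close> form a proper ideal \<open>D\<close>. An element \<open>z\<close> outside \<open>D\<close> generating a minimal ideal above \<open>D\<close>
  satisfies \<open>z I \<subseteq> D\<close>, and multiplying \<open>z\<close> by a suitable \<open>1 - e\<close> moves \<open>z I\<close> into the multiples of \<open>n\<close>.\<close>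
lemma inverse_of_proper_ideal:
  assumes I: "int_ideal I" and proper: "1 \<notin> I"
  shows "\<exists>x\<in>inverse_ideal K I. x \<notin> Int_K"
proof -
  have fr: "fractional I" using I by (rule int_idealD)
  note I_Int = int_idealD(2)[OF I] and I_add = fractionalD(3)[OF fr] and I_mult = fractionalD(4)[OF fr]
  obtain n :: int where n: "n > 0" "of_int n \<in> I" using int_ideal_contains_int[OF I] .
  obtain R where R: "finite R" "R \<subseteq> Int_K" "\<And>u. u \<in> Int_K \<Longrightarrow> \<exists>\<rho>\<in>R. u - \<rho> \<in> multiples n"
    using finite_representatives[OF n(1)] by metis
  define D where "D = {z \<in> Int_K. \<exists>e\<in>I. (1 - e) * z \<in> multiples n}"
  have D_I: "z \<in> D" if "z \<in> Int_K" "e \<in> I" "(1 - e) * z \<in> multiples n" for z e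
    using that unfolding D_def by blast
  have mult_D: "z \<in> D" if "z \<in> multiples n" for z
    using D_I[OF multiples_Int[OF that] fractionalD(2)[OF fr]] that by simp
  \<comment> \<open>The factors 1 - e are closed under multiplication: (1 - e)(1 - e') = 1 - (e + e'
    - e e').\<close>
  have combine: "e + e' - e * e' \<in> I" if "e \<in> I" "e' \<in> I" for e e'
    using that fractional_diff[OF fr I_add] I_mult I_Int by blast
  have one_minus: "1 - e \<in> Int_K" if "e \<in> I" for e
    using Int_diff[OF Int_1] I_Int[OF that] by blast
  have D_add: "u + v \<in> D" if uv: "u \<in> D" "v \<in> D" for u v
  proof -
    obtain e e' where e: "e \<in> I" "(1 - e) * u \<in> multiples n" "e' \<in> I" "(1 - e') * v \<in> multiples n"
      "u \<in> Int_K" "v \<in> Int_K"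
      using uv by (auto simp: D_def)
    have "(1 - e') * ((1 - e) * u) + (1 - e) * ((1 - e') * v) \<in> multiples n"
      using multiples_add[OF multiples_mult[OF one_minus[OF e(3)] e(2)] multiples_mult[OF one_minus[OF e(1)] e(4)]] .
    moreover have "(1 - (e + e' - e * e')) * (u + v) = (1 - e') * ((1 - e) * u) + (1 - e) * ((1 - e') * v)"
      by (simp add: algebra_simps)
    ultimately have "(1 - (e + e' - e * e')) * (u + v) \<in> multiples n" by (simp only:)
    thus ?thesis by (rule D_I[OF Int_add[OF e(5,6)] combine[OF e(1,3)]])
  qed
  have D_mult: "a * u \<in> D" if a: "a \<in> Int_K" and u: "u \<in> D" for a u
  proof -
    obtain e where e: "e \<in> I" "(1 - e) * u \<in> multiples n" "u \<in> Int_K" using u by (auto simp: D_def)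
    have "a * ((1 - e) * u) \<in> multiples n" using a e(2) by (rule multiples_mult)
    hence "(1 - e) * (a * u) \<in> multiples n" by (simp only: mult.left_commute)
    thus ?thesis by (rule D_I[OF Int_mult[OF a e(3)] e(1)])
  qed
  have D_div: "z \<in> D" if z: "(1 - e) * z \<in> D" "e \<in> I" "z \<in> Int_K" for z e
  proof -
    obtain e' where e': "e' \<in> I" "(1 - e') * ((1 - e) * z) \<in> multiples n" using z(1) by (auto simp: D_def)
    have "(1 - (e + e' - e * e')) * z = (1 - e') * ((1 - e) * z)" by (simp add: algebra_simps)
    hence "(1 - (e + e' - e * e')) * z \<in> multiples n" using e'(2) by (simp only:)
    thus ?thesis by (rule D_I[OF z(3) combine[OF z(2) e'(1)]])
  qed
  have D_Int: "u \<in> Int_K" if "u \<in> D" for u using that by (simp add: D_def)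
  have "1 \<notin> D"
  proof
    assume "1 \<in> D"
    then obtain e where e: "e \<in> I" "1 - e \<in> multiples n" by (auto simp: D_def)
    then obtain y where y: "1 - e = of_int n * y" "y \<in> Int_K" by (auto simp: multiples_def scale_set_def)
    have "y * of_int n + e \<in> I" by (rule I_add[OF I_mult[OF y(2) n(2)] e(1)])
    moreover have "y * of_int n + e = 1" using y(1) by (simp add: algebra_simps)
    ultimately show False using proper by simp
  qed
  \<comment> \<open>The representatives that lie in the ideal generated by z and \<open>D\<close>.
    Since \<open>D\<close> contains the multiples of n, their number measures this ideal, and a z of
    least count replaces a minimal ideal above \<open>D\<close>.\<close>
  define S where "S z = {\<rho> \<in> R. \<exists>a\<in>Int_K. \<exists>d\<in>D. \<rho> = a * z + d}" for z
  obtain z where z: "z \<in> Int_K" "z \<notin> D" and min: "\<And>z'. z' \<in> Int_K \<Longrightarrow> z' \<notin> D \<Longrightarrow> card (S z) \<le> card (S z')"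
    using ex_has_least_nat[of "\<lambda>z. z \<in> Int_K \<and> z \<notin> D" 1 "\<lambda>z. card (S z)"] \<open>1 \<notin> D\<close> by auto
  \<comment> \<open>Otherwise i z and z generate the same ideal over \<open>D\<close>, so (1 - a i)
    z lies in \<open>D\<close> for some a. As a i belongs to \<open>I\<close>, the factor can be
    cancelled by \<open>D_div\<close>, and z would lie in \<open>D\<close>.\<close>
  have zI: "i * z \<in> D" if i: "i \<in> I" for i
  proof (rule ccontr)
    assume notin: "i * z \<notin> D"
    have iz: "i * z \<in> Int_K" using I_Int[OF i] z(1) by (rule Int_mult)
    have "S (i * z) \<subseteq> S z"
    proof
      fix \<rho> assume "\<rho> \<in> S (i * z)"
      then obtain a d where "\<rho> \<in> R" "a \<in> Int_K" "d \<in> D" "\<rho> = a * (i * z) + d" by (auto simp: S_def)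
      hence "\<rho> = (a * i) * z + d" "a * i \<in> Int_K" using I_Int[OF i] by (simp_all add: mult.assoc Int_mult)
      thus "\<rho> \<in> S z" using \<open>\<rho> \<in> R\<close> \<open>d \<in> D\<close> unfolding S_def by blast
    qed
    moreover have "finite (S z)" using R(1) by (simp add: S_def)
    ultimately have eq: "S (i * z) = S z" using min[OF iz notin] by (intro card_seteq) auto
    obtain \<rho> where \<rho>: "\<rho> \<in> R" "z - \<rho> \<in> multiples n" using R(3)[OF z(1)] by blast
    have "\<rho> = 1 * z + (- 1) * (z - \<rho>)" by simp
    moreover have "(- 1) * (z - \<rho>) \<in> D" using D_mult[OF Int_uminus[OF Int_1] mult_D[OF \<rho>(2)]] .
    ultimately have "\<rho> \<in> S z" using \<rho>(1) Int_1 unfolding S_def by blast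
    hence "\<rho> \<in> S (i * z)" by (simp only: eq)
    then obtain a d where ad: "a \<in> Int_K" "d \<in> D" "\<rho> = a * (i * z) + d" unfolding S_def by blast
    have "(1 - a * i) * z = d + (z - \<rho>)" by (simp add: ad(3) algebra_simps)
    hence "(1 - a * i) * z \<in> D" using D_add[OF ad(2) mult_D[OF \<rho>(2)]] by simp
    hence "z \<in> D" using I_mult[OF ad(1) i] z(1) by (rule D_div)
    thus False using z(2) by blast
  qed
  have ex_e: "\<exists>e\<in>I. \<forall>d\<in>T. (1 - e) * d \<in> multiples n" if "finite T" "T \<subseteq> D" for T
    using that
  proof (induction T rule: finite_induct)
    case empty
    show ?case using n(2) by auto
  next
    case (insert t T)
    then obtain e where e: "e \<in> I" "\<And>d. d \<in> T \<Longrightarrow> (1 - e) * d \<in> multiples n" by auto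
    obtain e' where e': "e' \<in> I" "(1 - e') * t \<in> multiples n" using insert.prems by (auto simp: D_def)
    have eq: "(1 - (e + e' - e * e')) * d = (1 - e') * ((1 - e) * d)"
      "(1 - (e + e' - e * e')) * d = (1 - e) * ((1 - e') * d)" for d
      by (simp_all add: algebra_simps)
    have "(1 - (e + e' - e * e')) * t \<in> multiples n"
      unfolding eq(2) using multiples_mult[OF one_minus[OF e(1)] e'(2)] .
    moreover have "(1 - (e + e' - e * e')) * d \<in> multiples n" if "d \<in> T" for d
      unfolding eq(1) using multiples_mult[OF one_minus[OF e'(1)] e(2)[OF that]] .
    ultimately show ?case using combine[OF e(1) e'(1)] by blast
  qed
  \<comment> \<open>One representative in \<open>D\<close> is chosen for each of the finitely many
    classes of \<open>D\<close> modulo n. A single e that kills these kills all of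
    \<open>D\<close>.\<close>
  define rep where "rep \<rho> = (SOME d. d \<in> D \<and> d - \<rho> \<in> multiples n)" for \<rho>
  define R' where "R' = {\<rho> \<in> R. \<exists>d\<in>D. d - \<rho> \<in> multiples n}"
  have rep: "rep \<rho> \<in> D \<and> rep \<rho> - \<rho> \<in> multiples n" if "\<rho> \<in> R'" for \<rho>
    unfolding rep_def by (rule someI_ex) (use that in \<open>auto simp: R'_def\<close>)
  obtain e where e: "e \<in> I" "\<And>\<rho>. \<rho> \<in> R' \<Longrightarrow> (1 - e) * rep \<rho> \<in> multiples n"
    using ex_e[of "rep ` R'"] rep R(1) by (auto simp: R'_def)
  have kill: "(1 - e) * d \<in> multiples n" if d: "d \<in> D" for d
  proof -
    obtain \<rho> where \<rho>: "\<rho> \<in> R" "d - \<rho> \<in> multiples n" using R(3)[OF D_Int[OF d]] by blast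
    hence R': "\<rho> \<in> R'" using d by (auto simp: R'_def)
    have "(1 - e) * rep \<rho> + (1 - e) * ((d - \<rho>) - (rep \<rho> - \<rho>)) \<in> multiples n"
      using multiples_add[OF e(2)[OF R'] multiples_mult[OF one_minus[OF e(1)] multiples_diff[OF \<rho>(2)]]] rep[OF R']
      by blast
    thus ?thesis by (simp add: algebra_simps)
  qed
  \<comment> \<open>Because \<open>D\<close> is killed and z \<open>I\<close> lies in
    \<open>D\<close>, x maps \<open>I\<close> into the integers; x itself is not integral, as that
    would put z into \<open>D\<close>.\<close>
  define x where "x = (1 - e) * z / of_int n"
  have xn: "x * of_int n = (1 - e) * z" using n(1) by (simp add: x_def)
  have "x \<in> K"
    using K_mult[OF _ K_inverse[OF K_of_int[of n]], of "(1 - e) * z"] Int_mult[OF one_minus[OF e(1)] z(1)] Int_subset_K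
    by (auto simp: x_def)
  moreover have "x * i \<in> Int_K" if i: "i \<in> I" for i
  proof -
    have "(1 - e) * (i * z) / of_int n \<in> Int_K" using kill[OF zI[OF i]] n(1) by (simp add: multiples_iff)
    thus ?thesis by (simp add: x_def mult_ac)
  qed
  ultimately have "x \<in> inverse_ideal K I" by (rule inverse_idealI)
  moreover have "x \<notin> Int_K"
  proof
    assume "x \<in> Int_K"
    hence "(1 - e) * z \<in> multiples n" using n(1) by (simp add: multiples_iff x_def)
    hence "z \<in> D" using e(1) z(1) by (auto simp: D_def)
    thus False using z(2) by blast
  qed
  ultimately show ?thesis by blast
qed

text \<open>If the product J of \<open>I\<close> and its inverse were proper, some nonintegral x
  would map J into the integers. Then x maps the inverse of \<open>I\<close> into itself, so all
  powers of x have a common denominator, contrary to integral closedness.\<close>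

lemma int_ideal_invertible:
  assumes I: "int_ideal I"
  shows "ideal_prod complex_ring I (inverse_ideal K I) = Int_K"
proof -
  let ?J = "ideal_prod complex_ring I (inverse_ideal K I)"
  have J_Int: "?J \<subseteq> Int_K"
  proof (rule ideal_prod_least)
    fix a b assume "a \<in> I" "b \<in> inverse_ideal K I"
    hence "b * a \<in> Int_K" by (intro inverse_idealD)
    thus "a * b \<in> Int_K" by (simp only: mult.commute)
  qed (rule Int_add)
  have sub: "I \<subseteq> ?J" using ideal_prod_mult[OF _ one_in_inverse[OF I], of _ I] by auto
  have frJ: "fractional ?J" using I by (intro fractional_ideal_prod fractional_inverse int_idealD)
  obtain i0 where i0: "i0 \<in> I" "i0 \<noteq> 0" using int_idealD(3)[OF I] by blast
  hence J: "int_ideal ?J" using frJ J_Int sub by (auto simp: int_ideal_def)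
  have "1 \<in> ?J"
  proof (rule ccontr)
    assume "1 \<notin> ?J"
    then obtain x where x: "x \<in> inverse_ideal K ?J" "x \<notin> Int_K" using inverse_of_proper_ideal[OF J] by blast
    have xK: "x \<in> K" using x(1) by (simp add: inverse_ideal_def)
    have stable: "x * y \<in> inverse_ideal K I" if y: "y \<in> inverse_ideal K I" for y
    proof (rule inverse_idealI)
      show "x * y \<in> K" using xK y fractionalD(1)[OF fractional_inverse] by (intro K_mult)
      fix i assume "i \<in> I"
      hence "i * y \<in> ?J" using y by (rule ideal_prod_mult)
      hence "x * (i * y) \<in> Int_K" using x(1) by (intro inverse_idealD)
      thus "x * y * i \<in> Int_K" by (simp only: mult_ac)
    qed
    have "x ^ k \<in> inverse_ideal K I" for k
      by (induction k) (use one_in_inverse[OF I] stable in auto)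
    hence "x ^ k * i0 \<in> Int_K" for k using i0(1) by (rule inverse_idealD)
    hence "x \<in> Int_K"
      using integrally_closed[OF xK _ i0(2)] i0(1) int_idealD(2)[OF I] Int_subset_K by (auto simp: mult.commute)
    thus False using x(2) by blast
  qed
  thus ?thesis using int_ideal_eq_Int[OF J] by blast
qed

lemma ring_ring_of_integers: "ring (ring_of_integers K)"
proof -
  have "subring Int_K complex_ring"
  proof (rule ring.subringI)
    show "ring complex_ring" by (rule ring_from_type_algebra)
    fix u assume "u \<in> Int_K"
    have "u \<oplus>\<^bsub>complex_ring\<^esub> (- u) = \<zero>\<^bsub>complex_ring\<^esub>" by simp
    hence "\<ominus>\<^bsub>complex_ring\<^esub> u = - u"
      by (intro abelian_group.minus_equality[OF ring.is_abelian_group[OF ring_from_type_algebra]]) simp_all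
    thus "\<ominus>\<^bsub>complex_ring\<^esub> u \<in> Int_K" using \<open>u \<in> Int_K\<close> by (simp add: Int_uminus)
  qed (auto intro: Int_add Int_mult)
  hence "ring (complex_ring \<lparr>carrier := Int_K\<rparr>)"
    by (rule ring.subring_is_ring[OF ring_from_type_algebra])
  thus ?thesis by (simp add: ring_of_integers_def Int_K_def)
qed

lemma ring_of_integers_simps:
  "\<zero>\<^bsub>ring_of_integers K\<^esub> = 0" "u \<oplus>\<^bsub>ring_of_integers K\<^esub> v = u + v" "u \<otimes>\<^bsub>ring_of_integers K\<^esub> v = u * v"
  "carrier (ring_of_integers K) = Int_K"
  by (simp_all add: ring_of_integers_def ring_of_type_algebra_def Int_K_def)

lemma ring_of_integers_uminus: "u \<in> Int_K \<Longrightarrow> \<ominus>\<^bsub>ring_of_integers K\<^esub> u = - u"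
  by (rule abelian_group.minus_equality[OF ring.is_abelian_group[OF ring_ring_of_integers]])
    (simp_all add: ring_of_integers_simps Int_uminus del: carrier_ring_of_integers)

lemma nonzero_ideals_eq: "nonzero_ideals K = {I. int_ideal I}"
proof -
  have "ideal I (ring_of_integers K) \<and> I \<noteq> {0} \<longleftrightarrow> int_ideal I" for I
  proof
    assume *: "ideal I (ring_of_integers K) \<and> I \<noteq> {0}"
    hence id: "ideal I (ring_of_integers K)" by simp
    note add = ideal.axioms(1)[OF id]
    have "I \<subseteq> Int_K"
      using additive_subgroup.a_subset[OF add] unfolding ring_of_integers_simps .
    moreover have "0 \<in> I"
      using additive_subgroup.zero_closed[OF add] unfolding ring_of_integers_simps .
    moreover have "u + v \<in> I" if "u \<in> I" "v \<in> I" for u v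
      using additive_subgroup.a_closed[OF add that] unfolding ring_of_integers_simps .
    moreover have "a * u \<in> I" if "a \<in> Int_K" "u \<in> I" for a u
      using ideal.I_l_closed[OF id that(2), of a] that(1) unfolding ring_of_integers_simps by blast
    ultimately show "int_ideal I" using * Int_subset_K unfolding int_ideal_def fractional_def by blast
  next
    assume I: "int_ideal I"
    note fr = int_idealD(1)[OF I]
    have "subgroup I (add_monoid (ring_of_integers K))"
    proof (rule subgroup.intro)
      show "I \<subseteq> carrier (add_monoid (ring_of_integers K))"
        using int_idealD(2)[OF I] by (auto simp: ring_of_integers_simps simp del: carrier_ring_of_integers)
      show "u \<otimes>\<^bsub>add_monoid (ring_of_integers K)\<^esub> v \<in> I" if "u \<in> I" "v \<in> I" for u v
        using fractionalD(3)[OF fr that] by (simp add: ring_of_integers_simps)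
      show "\<one>\<^bsub>add_monoid (ring_of_integers K)\<^esub> \<in> I"
        using fractionalD(2)[OF fr] by (simp add: ring_of_integers_simps)
      show "inv\<^bsub>add_monoid (ring_of_integers K)\<^esub> u \<in> I" if "u \<in> I" for u
      proof -
        have "- u \<in> I" using fractional_diff[OF fr fractionalD(2)[OF fr] that] by simp
        thus ?thesis using ring_of_integers_uminus[OF int_idealD(2)[OF I that]] by (simp add: a_inv_def)
      qed
    qed
    hence "ideal I (ring_of_integers K)"
    proof (rule idealI[OF ring_ring_of_integers])
      fix a u assume au: "a \<in> I" "u \<in> carrier (ring_of_integers K)"
      hence "u * a \<in> I" using fractionalD(4)[OF fr] unfolding ring_of_integers_simps by blast
      thus "u \<otimes>\<^bsub>ring_of_integers K\<^esub> a \<in> I" "a \<otimes>\<^bsub>ring_of_integers K\<^esub> u \<in> I"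
        unfolding ring_of_integers_simps by (simp_all only: mult.commute)
    qed
    thus "ideal I (ring_of_integers K) \<and> I \<noteq> {0}" using I by (simp add: int_ideal_def)
  qed
  thus ?thesis by (simp add: nonzero_ideals_def)
qed

section \<open>Euclidean ideals and the class group\<close>

definition ideal_power :: "complex set \<Rightarrow> nat \<Rightarrow> complex set" where
  "ideal_power C k = (ideal_prod complex_ring C ^^ k) Int_K"

lemma ideal_power_simps [simp]:
  "ideal_power C 0 = Int_K" "ideal_power C (Suc k) = ideal_prod complex_ring C (ideal_power C k)"
  by (simp_all add: ideal_power_def)

lemma fractional_ideal_power: "fractional C \<Longrightarrow> fractional (ideal_power C k)"
  by (induction k) (simp_all add: fractional_Int fractional_ideal_prod)

lemma ideal_power_add:
  assumes "fractional C"
  shows "ideal_prod complex_ring (ideal_power C k) (ideal_power C l) = ideal_power C (k + l)"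
  by (induction k) (simp_all add: ideal_prod_Int fractional_ideal_power assms ideal_prod_assoc)

text \<open>The inverse of \<open>I\<close> contains 1, so y and therefore x - y lie in the inverse
  of \<open>I\<close> times C. This makes the ideal J of the descent integral, and cancelling C
  against its inverse relates the class of J to that of \<open>I\<close>.\<close>

lemma euclidean_step:
  assumes I: "int_ideal I" and C: "int_ideal C"
    and x: "x \<in> ideal_prod complex_ring (inverse_ideal K I) C" and y: "y \<in> C" and xy: "x \<noteq> y"
  defines "J \<equiv> scale_set (x - y) (ideal_prod complex_ring I (inverse_ideal K C))"
  shows "int_ideal J" and "ideal_prod complex_ring C J = scale_set (x - y) I" and "x - y \<in> K"
proof -
  note frI = int_idealD(1)[OF I] and frC = int_idealD(1)[OF C]
  let ?B = "ideal_prod complex_ring (inverse_ideal K I) C"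
  have frB: "fractional ?B" by (intro fractional_ideal_prod fractional_inverse frC)
  have "1 * y \<in> ?B" using one_in_inverse[OF I] y by (rule ideal_prod_mult)
  hence t: "x - y \<in> ?B" using fractional_diff[OF frB x] by simp
  thus tK: "x - y \<in> K" using fractionalD(1)[OF frB] by blast
  have frJ: "fractional J"
    unfolding J_def using tK by (intro fractional_scale_set fractional_ideal_prod fractional_inverse frI)
  have "J \<subseteq> ideal_prod complex_ring ?B (ideal_prod complex_ring I (inverse_ideal K C))"
    unfolding J_def scale_set_def using t by (auto intro: ideal_prod_mult)
  also have "ideal_prod complex_ring ?B (ideal_prod complex_ring I (inverse_ideal K C)) =
    ideal_prod complex_ring (inverse_ideal K I) (ideal_prod complex_ring (ideal_prod complex_ring C I) (inverse_ideal K C))"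
    by (simp only: ideal_prod_assoc)
  also have "ideal_prod complex_ring C I = ideal_prod complex_ring I C" by (rule ideal_prod_commute)
  also have "ideal_prod complex_ring (inverse_ideal K I) (ideal_prod complex_ring (ideal_prod complex_ring I C) (inverse_ideal K C))
    = ideal_prod complex_ring (ideal_prod complex_ring (inverse_ideal K I) I) (ideal_prod complex_ring C (inverse_ideal K C))"
    by (simp only: ideal_prod_assoc)
  also have "\<dots> = Int_K"
    by (simp only: ideal_prod_commute[of _ I] int_ideal_invertible[OF I] int_ideal_invertible[OF C]
      ideal_prod_Int fractional_Int)
  finally have J_Int: "J \<subseteq> Int_K" .
  obtain i where i: "i \<in> I" "i \<noteq> 0" using int_idealD(3)[OF I] by blast
  have "i * 1 \<in> ideal_prod complex_ring I (inverse_ideal K C)"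
    using i(1) one_in_inverse[OF C] by (rule ideal_prod_mult)
  hence "(x - y) * i \<in> J" unfolding J_def scale_set_def by (intro imageI) simp
  moreover have "(x - y) * i \<noteq> 0" using i(2) xy by simp
  ultimately have "J \<noteq> {0}" by blast
  thus "int_ideal J" using frJ J_Int by (simp add: int_ideal_def)
  have "ideal_prod complex_ring C (ideal_prod complex_ring I (inverse_ideal K C))
    = ideal_prod complex_ring (ideal_prod complex_ring C (inverse_ideal K C)) I"
    by (simp only: ideal_prod_assoc ideal_prod_commute[of I])
  also have "\<dots> = I" by (simp only: int_ideal_invertible[OF C] ideal_prod_Int[OF frI])
  finally show "ideal_prod complex_ring C J = scale_set (x - y) I"
    unfolding J_def by (simp only: ideal_prod_scale_set_right)
qed

text \<open>Every v in the inverse of \<open>I\<close> then multiplies C into itself, hence C times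
  its inverse, which is all of \<open>Int_K\<close>, into \<open>Int_K\<close>. So v is integral,
  and \<open>I\<close> cannot be proper.\<close>

lemma int_ideal_eq_Int_if_no_step:
  assumes I: "int_ideal I" and C: "int_ideal C"
    and sub: "ideal_prod complex_ring (inverse_ideal K I) C \<subseteq> C"
  shows "I = Int_K"
proof (rule int_ideal_eq_Int[OF I], rule ccontr)
  assume "1 \<notin> I"
  then obtain v where v: "v \<in> inverse_ideal K I" "v \<notin> Int_K" using inverse_of_proper_ideal[OF I] by blast
  have "ideal_prod complex_ring C (inverse_ideal K C) \<subseteq> {u. v * u \<in> Int_K}"
  proof (rule ideal_prod_least)
    fix c d assume "c \<in> C" "d \<in> inverse_ideal K C"
    hence "v * c \<in> C" using sub ideal_prod_mult[OF v(1)] by blast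
    hence "d * (v * c) \<in> Int_K" using \<open>d \<in> inverse_ideal K C\<close> by (intro inverse_idealD)
    thus "c * d \<in> {u. v * u \<in> Int_K}" by (simp add: mult_ac)
  qed (simp add: distrib_left Int_add)
  hence "v * 1 \<in> Int_K" unfolding int_ideal_invertible[OF C] using Int_1 by blast
  thus False using v(2) by simp
qed

text \<open>Each step satisfies C J = (x - y) I, so it splits one factor C off the class of
  \<open>I\<close>; the descent stops exactly at \<open>Int_K\<close>. For this reason nonnegative
  exponents suffice.\<close>

lemma euclidean_ideal_generates_class_group:
  assumes euc: "euclidean_ideal K C" and I: "int_ideal I"
  shows "int_ideal C \<and> (\<exists>k. \<exists>c\<in>K. c \<noteq> 0 \<and> I = scale_set c (ideal_power C k))"
proof -
  from euc have C: "int_ideal C" by (simp add: euclidean_ideal_def nonzero_ideals_eq)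
  from euc obtain W :: "complex set set" and r \<Psi> where "euclidean_function K C W r \<Psi>"
    unfolding euclidean_ideal_def by blast
  hence wo: "well_order_on W r"
    and step: "\<And>I x. int_ideal I \<Longrightarrow> x \<in> ideal_prod complex_ring (inverse_ideal K I) C - C \<Longrightarrow>
      \<exists>y\<in>C. (\<Psi> (scale_set (x - y) (ideal_prod complex_ring I (inverse_ideal K C))), \<Psi> I) \<in> r - Id"
    unfolding euclidean_function_def nonzero_ideals_eq scale_set_def by blast+
  have "wf (r - Id)" using wo by (simp add: well_order_on_def)
  hence "wf (inv_image (r - Id) \<Psi>)" by (rule wf_inv_image)
  hence "int_ideal I \<longrightarrow> (\<exists>k. \<exists>c\<in>K. c \<noteq> 0 \<and> I = scale_set c (ideal_power C k))"
  proof (induction I rule: wf_induct_rule)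
    case (less I)
    show ?case
    proof
      assume I: "int_ideal I"
      show "\<exists>k. \<exists>c\<in>K. c \<noteq> 0 \<and> I = scale_set c (ideal_power C k)"
      proof (cases "ideal_prod complex_ring (inverse_ideal K I) C \<subseteq> C")
        case True
        have "I = scale_set 1 (ideal_power C 0)" using int_ideal_eq_Int_if_no_step[OF I C True] by simp
        moreover have "1 \<in> K" using K_of_int[of 1] by simp
        ultimately show ?thesis by (intro exI[of _ 0] bexI[of _ 1] conjI one_neq_zero)
      next
        case False
        then obtain x where x: "x \<in> ideal_prod complex_ring (inverse_ideal K I) C" "x \<notin> C" by blast
        then obtain y where y: "y \<in> C"
          "(\<Psi> (scale_set (x - y) (ideal_prod complex_ring I (inverse_ideal K C))), \<Psi> I) \<in> r - Id"
          using step[OF I, of x] by blast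
        have ne: "x \<noteq> y" using x(2) y(1) by blast
        note J = euclidean_step[OF I C x(1) y(1) ne]
        have "(scale_set (x - y) (ideal_prod complex_ring I (inverse_ideal K C)), I) \<in> inv_image (r - Id) \<Psi>"
          using y(2) by (simp only: in_inv_image)
        from less[OF this] J(1)
        obtain k c where kc: "c \<in> K" "c \<noteq> 0"
          "scale_set (x - y) (ideal_prod complex_ring I (inverse_ideal K C)) = scale_set c (ideal_power C k)"
          by blast
        have "scale_set (x - y) I = scale_set c (ideal_power C (Suc k))"
          using J(2) unfolding kc(3) ideal_prod_scale_set_right by simp
        hence "scale_set (1 / (x - y)) (scale_set (x - y) I) = scale_set (1 / (x - y)) (scale_set c (ideal_power C (Suc k)))"
          by (rule arg_cong)
        hence "I = scale_set (c / (x - y)) (ideal_power C (Suc k))"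
          using ne by (simp add: scale_set_mult del: ideal_power_simps)
        moreover have "c / (x - y) \<in> K" using K_mult[OF kc(1) K_inverse[OF J(3)]] by simp
        moreover have "c / (x - y) \<noteq> 0" using kc(2) ne by simp
        ultimately show ?thesis by (intro exI[of _ "Suc k"] bexI[of _ "c / (x - y)"] conjI)
      qed
    qed
  qed
  thus ?thesis using I C by blast
qed

definition principal :: "complex set \<Rightarrow> bool" where
  "principal A \<longleftrightarrow> (\<exists>c\<in>K. c \<noteq> 0 \<and> A = scale_set c Int_K)"

lemma principal_ideal_prod:
  assumes "principal A" "principal B"
  shows "principal (ideal_prod complex_ring A B)"
proof -
  obtain a b where ab: "a \<in> K" "a \<noteq> 0" "A = scale_set a Int_K" "b \<in> K" "b \<noteq> 0" "B = scale_set b Int_K"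
    using assms by (auto simp: principal_def)
  have "ideal_prod complex_ring A B = scale_set (a * b) Int_K"
    by (simp only: ab ideal_prod_scale_set ideal_prod_scale_set_right scale_set_mult
      ideal_prod_Int fractional_Int mult.commute)
  moreover have "a * b \<in> K" "a * b \<noteq> 0" using ab by (simp_all add: K_mult)
  ultimately show ?thesis unfolding principal_def by blast
qed

lemma principal_scale_set: "principal A \<Longrightarrow> c \<in> K \<Longrightarrow> c \<noteq> 0 \<Longrightarrow> principal (scale_set c A)"
proof -
  assume "principal A" and c: "c \<in> K" "c \<noteq> 0"
  then obtain a where "a \<in> K" "a \<noteq> 0" "A = scale_set a Int_K" unfolding principal_def by blast
  thus "principal (scale_set c A)"
    unfolding principal_def using c by (intro bexI[of _ "c * a"]) (simp_all add: scale_set_mult K_mult)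
qed

lemma principal_cancel:
  assumes "principal A" "principal (ideal_prod complex_ring A B)" "fractional B"
  shows "principal B"
proof -
  obtain a b where ab: "a \<in> K" "a \<noteq> 0" "A = scale_set a Int_K" "b \<in> K" "b \<noteq> 0"
    "ideal_prod complex_ring A B = scale_set b Int_K"
    using assms by (auto simp: principal_def)
  have "scale_set a B = scale_set b Int_K"
    using ab(6) by (simp only: ab(3) ideal_prod_scale_set ideal_prod_Int[OF assms(3)])
  hence "scale_set (1 / a) (scale_set a B) = scale_set (1 / a) (scale_set b Int_K)" by (rule arg_cong)
  hence "B = scale_set (b / a) Int_K" using ab(2) by (simp add: scale_set_mult)
  moreover have "b / a \<in> K" "b / a \<noteq> 0" using ab K_mult[OF ab(4) K_inverse[OF ab(1)]] by simp_all
  ultimately show ?thesis unfolding principal_def by blast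
qed

text \<open>The substitute for a cyclic group having at most one element of order two;
  \<open>H\<close> will be the set of exponents with principal power. For e = gcd k l, Bezout and
  cancellation give 2 e in \<open>H\<close>, and one of k / e, l / e and their sum is even.\<close>

lemma nat_submonoid_two_torsion:
  fixes H :: "nat set"
  assumes zero: "0 \<in> H" and add: "\<And>k l. k \<in> H \<Longrightarrow> l \<in> H \<Longrightarrow> k + l \<in> H"
    and cancel: "\<And>k l. k \<in> H \<Longrightarrow> k + l \<in> H \<Longrightarrow> l \<in> H"
    and double: "2 * k \<in> H" "2 * l \<in> H"
  shows "k \<in> H \<or> l \<in> H \<or> k + l \<in> H"
proof -
  have mult: "m * h \<in> H" if "h \<in> H" for m h :: nat
    by (induction m) (simp_all add: zero add that)
  define e where "e = gcd k l"
  have "2 * e \<in> H"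
  proof (cases "k = 0")
    case True
    thus ?thesis using double by (simp add: e_def)
  next
    case False
    obtain x y where "2 * k * x = 2 * l * y + gcd (2 * k) (2 * l)" using bezout_nat[of "2 * k" "2 * l"] False by auto
    moreover have "gcd (2 * k) (2 * l) = 2 * e" unfolding e_def by (rule gcd_mult_distrib_nat[symmetric])
    ultimately have "x * (2 * k) = y * (2 * l) + 2 * e" by (simp add: mult_ac)
    hence "y * (2 * l) + 2 * e \<in> H" using mult[OF double(1), of x] by simp
    thus ?thesis using cancel mult[OF double(2), of y] by blast
  qed
  hence even: "e * m \<in> H" if "even m" for m
    using mult[of "2 * e" "m div 2"] that by (metis dvd_mult_div_cancel mult.assoc mult.commute)
  have "e dvd k" "e dvd l" by (simp_all add: e_def)
  then obtain k' l' where kl: "k = e * k'" "l = e * l'" by (elim dvdE)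
  have "even k' \<or> even l' \<or> even (k' + l')" by auto
  thus ?thesis
    unfolding kl distrib_left[symmetric] using even[of k'] even[of l'] even[of "k' + l'"] by argo
qed

lemma euclidean_ideal_two_torsion:
  assumes euc: "euclidean_ideal K C" and P: "int_ideal P" "principal (ideal_prod complex_ring P P)"
    and Q: "int_ideal Q" "principal (ideal_prod complex_ring Q Q)"
  shows "principal P \<or> principal Q \<or> principal (ideal_prod complex_ring P Q)"
proof -
  obtain k x where P': "x \<in> K" "x \<noteq> 0" "P = scale_set x (ideal_power C k)" and C: "int_ideal C"
    using euclidean_ideal_generates_class_group[OF euc P(1)] by blast
  obtain l y where Q': "y \<in> K" "y \<noteq> 0" "Q = scale_set y (ideal_power C l)"
    using euclidean_ideal_generates_class_group[OF euc Q(1)] by blast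
  note frC = int_idealD(1)[OF C]
  note powers = ideal_prod_scale_set ideal_prod_scale_set_right scale_set_mult ideal_power_add[OF frC]
  have unscale: "principal A" if A: "principal (scale_set c A)" and c: "c \<in> K" "c \<noteq> 0" for c A
  proof -
    have "principal (scale_set (1 / c) (scale_set c A))"
      by (rule principal_scale_set[OF A K_inverse[OF c(1)]]) (simp add: c(2))
    thus ?thesis using c(2) by (simp add: scale_set_mult)
  qed
  define H where "H = {k. principal (ideal_power C k)}"
  have "k \<in> H \<or> l \<in> H \<or> k + l \<in> H"
  proof (rule nat_submonoid_two_torsion)
    have "1 \<in> K" using K_of_int[of 1] by simp
    hence "principal Int_K" unfolding principal_def by (intro bexI[of _ 1]) simp_all
    thus "0 \<in> H" by (simp add: H_def)
    show "k + l \<in> H" if "k \<in> H" "l \<in> H" for k l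
      using that principal_ideal_prod[of "ideal_power C k" "ideal_power C l"]
      unfolding H_def ideal_power_add[OF frC] by blast
    show "l \<in> H" if "k \<in> H" "k + l \<in> H" for k l
      using that principal_cancel[of "ideal_power C k" "ideal_power C l"] fractional_ideal_power[OF frC]
      unfolding H_def ideal_power_add[OF frC] by blast
    have "principal (scale_set (x * x) (ideal_power C (k + k)))"
      using P(2) unfolding P'(3) powers .
    hence "principal (ideal_power C (k + k))"
      by (rule unscale) (simp_all add: P' K_mult)
    thus "2 * k \<in> H" by (simp add: H_def mult_2)
    have "principal (scale_set (y * y) (ideal_power C (l + l)))"
      using Q(2) unfolding Q'(3) powers .
    hence "principal (ideal_power C (l + l))"
      by (rule unscale) (simp_all add: Q' K_mult)
    thus "2 * l \<in> H" by (simp add: H_def mult_2)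
  qed
  thus ?thesis
  proof (elim disjE)
    assume "k \<in> H"
    hence "principal P" unfolding P'(3) H_def mem_Collect_eq by (rule principal_scale_set[OF _ P'(1,2)])
    thus ?thesis by blast
  next
    assume "l \<in> H"
    hence "principal Q" unfolding Q'(3) H_def mem_Collect_eq by (rule principal_scale_set[OF _ Q'(1,2)])
    thus ?thesis by blast
  next
    assume "k + l \<in> H"
    hence "principal (ideal_power C (k + l))" by (simp add: H_def)
    hence "principal (scale_set (x * y) (ideal_power C (k + l)))"
      by (rule principal_scale_set) (simp_all add: P' Q' K_mult)
    hence "principal (ideal_prod complex_ring P Q)" unfolding P'(3) Q'(3) powers by (simp only: mult.commute)
    thus ?thesis by blast
  qed
qed

text \<open>If c generates P, then c^2 and n generate the same fractional ideal, so their quotient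
  is a unit. Integrality of both quotients is all that is passed on, which frees the later argument
  from ideals.\<close>

lemma square_generator:
  assumes "principal P" "ideal_prod complex_ring P P = scale_set n Int_K" "n \<in> K" "n \<noteq> 0"
  obtains c where "c \<in> K" "c \<noteq> 0" "c\<^sup>2 / n \<in> Int_K" "n / c\<^sup>2 \<in> Int_K"
proof -
  obtain c where c: "c \<in> K" "c \<noteq> 0" "P = scale_set c Int_K" using assms(1) by (auto simp: principal_def)
  have eq: "scale_set (c * c) Int_K = scale_set n Int_K"
    using assms(2) unfolding c(3) ideal_prod_scale_set ideal_prod_scale_set_right scale_set_mult
      ideal_prod_Int[OF fractional_Int] .
  have "c * c * 1 \<in> scale_set n Int_K" unfolding eq[symmetric] unfolding scale_set_def by (intro imageI Int_1)
  then obtain u where u: "c * c = n * u" "u \<in> Int_K" by (auto simp: scale_set_def)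
  have "n * 1 \<in> scale_set (c * c) Int_K" unfolding eq unfolding scale_set_def by (intro imageI Int_1)
  then obtain v where v: "n = c * c * v" "v \<in> Int_K" by (auto simp: scale_set_def)
  have "c\<^sup>2 / n = u" unfolding power2_eq_square u(1) using assms(4) by simp
  hence "c\<^sup>2 / n \<in> Int_K" using u(2) by (simp only:)
  moreover have "n / c\<^sup>2 = v" unfolding power2_eq_square by (subst v(1)) (simp add: c(2))
  hence "n / c\<^sup>2 \<in> Int_K" using v(2) by (simp only:)
  ultimately show ?thesis using c(1,2) that by blast
qed

end

section \<open>Squares up to units\<close>

text \<open>One sign and one of 25 representatives of units for each of the three quadratic subfields.\<close>
definition max_classes :: nat where "max_classes = 2 * 25 * 25 * 25"

context biquadratic_field
begin

lemma K_denominator: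
  assumes "u \<in> K"
  shows "\<exists>n :: int. n > 0 \<and> algebraic_int (of_int n * u)"
proof -
  obtain x y z w where u: "u = emb x y z w" using assms by (rule K_E)
  have rat: "\<exists>d :: int. d > 0 \<and> (\<exists>k. of_int d * q = of_int k)" for q :: rat
  proof -
    obtain a b where "b > 0" "q = of_int a / of_int b"
      by (metis Fract_of_int_quotient Rat_cases_nonzero quotient_of_unique)
    thus ?thesis by (intro exI[of _ b]) auto
  qed
  obtain d1 k1 d2 k2 d3 k3 d4 k4 :: int where d: "d1 > 0" "d2 > 0" "d3 > 0" "d4 > 0"
    and k: "of_int d1 * x = of_int k1" "of_int d2 * y = of_int k2" "of_int d3 * z = of_int k3" "of_int d4 * w = of_int k4"
    using rat[of x] rat[of y] rat[of z] rat[of w] by blast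
  define n where "n = d1 * d2 * d3 * d4"
  have coords: "of_int n * x = of_int (k1 * d2 * d3 * d4)" "of_int n * y = of_int (d1 * k2 * d3 * d4)"
    "of_int n * z = of_int (d1 * d2 * k3 * d4)" "of_int n * w = of_int (d1 * d2 * d3 * k4)"
    by (simp_all add: n_def mult_ac flip: k)
  have "of_int n * u = of_int (k1 * d2 * d3 * d4) + of_int (d1 * k2 * d3 * d4) * \<alpha>
    + of_int (d1 * d2 * k3 * d4) * \<beta> + of_int (d1 * d2 * d3 * k4) * \<gamma>"
    unfolding u emb_scale coords by (simp only: emb_def of_rat_of_int_eq)
  also have "algebraic_int \<dots>"
    by (intro algebraic_int_add algebraic_int_mult algebraic_int_of_int A.algebraic_int_sqrt
      B.algebraic_int_sqrt C.algebraic_int_sqrt)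
  finally show ?thesis using d by (intro exI[of _ n]) (simp add: n_def)
qed

lemma number_ring: "integral_basis K ws \<Longrightarrow> number_ring K ws"
  by unfold_locales (assumption | rule K_of_int K_add K_mult K_inverse K_denominator)+

lemma cj_cj: "u \<in> K \<Longrightarrow> cj i j (cj k l u) = cj (i * k) (j * l) u"
  by (elim K_E) (simp add: cj_emb mult_ac)

lemma sgns_cases: "1 \<in> sgns" "- 1 \<in> sgns"
  by (auto simp: sgns_def)

text \<open>Each sign pair other than (1, 1) fixes one of \<alpha>, \<beta>, \<gamma>, and the
  product is the relative norm to the field generated by it; the pair (-1, -1) fixes
  \<gamma>.\<close>

lemma relative_norm_in_F:
  assumes "u \<in> K"
  shows "u * cj 1 (- 1) u \<in> A.F" "u * cj (- 1) 1 u \<in> B.F" "u * cj (- 1) (- 1) u \<in> C.F"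
proof -
  obtain x y z w where u: "u = emb x y z w" using assms by (rule K_E)
  have F: "emb p q 0 0 \<in> A.F" "emb p 0 q 0 \<in> B.F" "emb p 0 0 q \<in> C.F" for p q
    by (simp_all add: emb_def)
  have "u * cj 1 (- 1) u = emb (x * x + of_int (g * r) * (y * y) - of_int (g * s) * (z * z) - of_int (r * s) * (w * w))
    (2 * x * y - 2 * of_int s * z * w) 0 0"
    unfolding u cj_emb emb_mult by (simp add: emb_eq_iff algebra_simps)
  thus "u * cj 1 (- 1) u \<in> A.F" by (simp only: F)
  have "u * cj (- 1) 1 u = emb (x * x - of_int (g * r) * (y * y) + of_int (g * s) * (z * z) - of_int (r * s) * (w * w))
    0 (2 * x * z - 2 * of_int r * y * w) 0"
    unfolding u cj_emb emb_mult by (simp add: emb_eq_iff algebra_simps)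
  thus "u * cj (- 1) 1 u \<in> B.F" by (simp only: F)
  have "u * cj (- 1) (- 1) u = emb (x * x - of_int (g * r) * (y * y) - of_int (g * s) * (z * z) + of_int (r * s) * (w * w))
    0 0 (2 * x * w - 2 * of_int g * y * z)"
    unfolding u cj_emb emb_mult by (simp add: emb_eq_iff algebra_simps)
  thus "u * cj (- 1) (- 1) u \<in> C.F" by (simp only: F)
qed

definition norm_K :: "complex \<Rightarrow> complex" where
  "norm_K u = u * cj 1 (- 1) u * cj (- 1) 1 u * cj (- 1) (- 1) u"

lemma norm_K_rational:
  assumes "u \<in> K"
  obtains q where "norm_K u = of_rat q"
proof -
  obtain x y where xy: "u * cj 1 (- 1) u = of_rat x + of_rat y * \<alpha>"
    using relative_norm_in_F(1)[OF assms] by (rule A.F_E)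
  have emb: "of_rat x + of_rat y * \<alpha> = emb x y 0 0" by (simp add: emb_def)
  have "cj (- 1) 1 (u * cj 1 (- 1) u) = cj (- 1) 1 u * cj (- 1) (- 1) u"
    using assms by (simp add: cj_mult sgns_cases cj_in_K cj_cj)
  moreover have "cj (- 1) 1 (u * cj 1 (- 1) u) = of_rat x - of_rat y * \<alpha>"
    unfolding xy emb cj_emb by (simp add: emb_def of_rat_minus)
  ultimately have "norm_K u = (of_rat x + of_rat y * \<alpha>) * (of_rat x - of_rat y * \<alpha>)"
    unfolding norm_K_def xy[symmetric] by (simp add: mult.assoc)
  also have "\<dots> = of_rat (x\<^sup>2 - of_int (g * r) * y\<^sup>2)" by (rule A.mult_conj)
  finally show ?thesis by (rule that)
qed

lemma norm_K_mult: "u \<in> K \<Longrightarrow> v \<in> K \<Longrightarrow> norm_K (u * v) = norm_K u * norm_K v"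
  by (simp add: norm_K_def cj_mult sgns_cases)

lemma norm_K_of_int: "norm_K (of_int n) = of_int n ^ 4"
  by (simp add: norm_K_def cj_of_int power4_eq_xxxx)

lemma algebraic_int_norm_K: "u \<in> K \<Longrightarrow> algebraic_int u \<Longrightarrow> norm_K u \<in> \<int>"
proof -
  assume u: "u \<in> K" "algebraic_int u"
  obtain q where q: "norm_K u = of_rat q" using norm_K_rational[OF u(1)] .
  have "algebraic_int (norm_K u)"
    unfolding norm_K_def by (intro algebraic_int_mult algebraic_int_cj sgns_cases u)
  thus ?thesis by (rule rational_algebraic_int_is_int) (simp add: q)
qed

text \<open>With \<open>c\<^sup>2 = n u\<close>, the relative norms of \<open>c\<close> are \<open>n\<close> times units \<open>\<epsilon>\<^sub>i\<close> of the quadratic subfields,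
  and \<open>c\<^sup>2\<close> times the norm of \<open>c\<close> is the product of the relative norms, so \<open>c\<^sup>2 = \<plusminus>n \<epsilon>\<^sub>1 \<epsilon>\<^sub>2 \<epsilon>\<^sub>3\<close>.\<close>
lemma generator_square_factorisation:
  fixes n :: int
  assumes n: "n > 0" and c: "c \<in> K" "c \<noteq> 0" "algebraic_int (c\<^sup>2 / of_int n)" "algebraic_int (of_int n / c\<^sup>2)"
  obtains t e1 e2 e3 where "t = 1 \<or> t = - 1" "e1 \<in> A.U" "e2 \<in> B.U" "e3 \<in> C.U" "c\<^sup>2 = t * of_int n * (e1 * e2 * e3)"
proof -
  define u where "u = c\<^sup>2 / of_int n"
  have n_K: "1 / of_int n \<in> K" by (intro K_inverse K_of_int)
  have cc: "c * c \<in> K" by (intro K_mult c)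
  have u: "u \<in> K" "algebraic_int u" using K_mult[OF cc n_K] c(3) by (simp_all add: u_def power2_eq_square)
  have u': "1 / u \<in> K" "algebraic_int (1 / u)" using K_inverse[OF u(1)] c(4) by (simp_all add: u_def)
  have u_ne: "u \<noteq> 0" using c(2) n by (simp add: u_def)
  have c_u: "c * c = of_int n * u" using n by (simp add: u_def power2_eq_square)
  have "norm_K u * norm_K (1 / u) = norm_K 1" using u_ne by (simp flip: norm_K_mult[OF u(1) u'(1)])
  also have "norm_K 1 = 1" using norm_K_of_int[of 1] by simp
  finally have *: "norm_K u * norm_K (1 / u) = 1" .
  obtain m m' where m: "norm_K u = of_int m" "norm_K (1 / u) = of_int m'"
    using algebraic_int_norm_K[OF u] algebraic_int_norm_K[OF u'] by (elim Ints_cases)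
  have "of_int (m * m') = (of_int 1 :: complex)" using * by (simp add: m)
  hence "m * m' = 1" by (simp only: of_int_eq_iff)
  hence m1: "m = 1 \<or> m = - 1" by (auto simp: zmult_eq_1_iff)
  \<comment> \<open>The norm of c is a rational number with square n^4 m. This excludes m = -1 and
    makes the norm of c equal to n^2 up to the sign t.\<close>
  obtain q where q: "norm_K c = of_rat q" using norm_K_rational[OF c(1)] .
  have "norm_K c * norm_K c = of_int n ^ 4 * of_int m"
    using norm_K_mult[OF c(1) c(1)] norm_K_mult[OF K_of_int u(1), of n] by (simp add: c_u norm_K_of_int m)
  hence "of_rat (q * q) = (of_rat (of_int n ^ 4 * of_int m) :: complex)"
    by (simp add: q of_rat_mult of_rat_power)
  hence qq: "q * q = of_int n ^ 4 * of_int m" by (simp only: of_rat_eq_iff)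
  have "0 \<le> q * q" by simp
  moreover have "(of_int n :: rat) ^ 4 > 0" using n by simp
  ultimately have "(of_int m :: rat) \<ge> 0" unfolding qq by (simp add: zero_le_mult_iff)
  hence "m = 1" using m1 by auto
  hence "q * q = of_int n ^ 2 * of_int n ^ 2" using qq by (simp flip: power_add)
  hence "q = of_int n ^ 2 \<or> q = - (of_int n ^ 2)" by (simp only: square_eq_iff)
  then obtain t :: int where t: "t = 1 \<or> t = - 1" "q = of_int t * of_int n ^ 2" by force
  \<comment> \<open>The square of \<open>c * cj i j c / of_int n\<close> is
    \<open>u * cj i j u\<close>, a unit, and integrality passes from a square to its root.\<close>
  have unit: "c * cj i j c \<noteq> 0 \<and> algebraic_int (c * cj i j c / of_int n) \<and> algebraic_int (1 / (c * cj i j c / of_int n))"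
    if ij: "i \<in> sgns" "j \<in> sgns" for i j
  proof (intro conjI)
    show ne: "c * cj i j c \<noteq> 0" using c cj_eq_0_iff[OF ij c(1)] by simp
    have cj_c: "cj i j c * cj i j c = of_int n * cj i j u"
      using cj_mult[OF ij c(1) c(1)] cj_mult[OF ij K_of_int u(1), of n] by (simp add: c_u cj_of_int)
    have "(c * cj i j c / of_int n)\<^sup>2 = (c * c) * (cj i j c * cj i j c) / (of_int n * of_int n)"
      by (simp add: power2_eq_square)
    also have "\<dots> = u * cj i j u" unfolding c_u cj_c using n by simp
    finally have sq: "(c * cj i j c / of_int n)\<^sup>2 = u * cj i j u" .
    have "algebraic_int (u * cj i j u)" by (intro algebraic_int_mult algebraic_int_cj u ij)
    thus "algebraic_int (c * cj i j c / of_int n)"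
      unfolding sq[symmetric] by (rule algebraic_int_power_cancel) simp
    have "cj i j u * cj i j (1 / u) = cj i j (of_int 1)"
      using u_ne by (simp flip: cj_mult[OF ij u(1) u'(1)])
    hence prod: "cj i j u * cj i j (1 / u) = 1" unfolding cj_of_int by simp
    hence "cj i j u \<noteq> 0" by (intro notI) simp
    hence "cj i j (1 / u) = 1 / cj i j u" using prod by (simp only: eq_divide_eq mult.commute if_True if_False simp_thms)
    hence "(1 / (c * cj i j c / of_int n))\<^sup>2 = (1 / u) * cj i j (1 / u)"
      using sq by (simp only: power_one_over) simp
    moreover have "algebraic_int ((1 / u) * cj i j (1 / u))" by (intro algebraic_int_mult algebraic_int_cj u' ij)
    ultimately show "algebraic_int (1 / (c * cj i j c / of_int n))"
      by (intro algebraic_int_power_cancel[of "1 / (c * cj i j c / of_int n)" 2]) simp_all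
  qed
  define e1 where "e1 = c * cj 1 (- 1) c / of_int n"
  define e2 where "e2 = c * cj (- 1) 1 c / of_int n"
  define e3 where "e3 = c * cj (- 1) (- 1) c / of_int n"
  have F: "e1 \<in> A.F" "e2 \<in> B.F" "e3 \<in> C.F"
    using A.F_mult[OF relative_norm_in_F(1)[OF c(1)] A.F_inverse[OF A.F_of_int[of n]]]
      B.F_mult[OF relative_norm_in_F(2)[OF c(1)] B.F_inverse[OF B.F_of_int[of n]]]
      C.F_mult[OF relative_norm_in_F(3)[OF c(1)] C.F_inverse[OF C.F_of_int[of n]]]
    by (simp_all add: e1_def e2_def e3_def)
  have n0: "x / of_int n \<noteq> 0" if "x \<noteq> 0" for x :: complex using n that by simp
  note unit1 = unit[OF sgns_cases(1,2)] and unit2 = unit[OF sgns_cases(2,1)] and unit3 = unit[OF sgns_cases(2,2)]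
  have "e1 \<noteq> 0 \<and> algebraic_int e1 \<and> algebraic_int (1 / e1)"
    unfolding e1_def by (intro conjI n0 unit1[THEN conjunct1] unit1[THEN conjunct2, THEN conjunct1] unit1[THEN conjunct2, THEN conjunct2])
  hence U1: "e1 \<in> A.U" unfolding A.U_def using F(1) by blast
  have "e2 \<noteq> 0 \<and> algebraic_int e2 \<and> algebraic_int (1 / e2)"
    unfolding e2_def by (intro conjI n0 unit2[THEN conjunct1] unit2[THEN conjunct2, THEN conjunct1] unit2[THEN conjunct2, THEN conjunct2])
  hence U2: "e2 \<in> B.U" unfolding B.U_def using F(2) by blast
  have "e3 \<noteq> 0 \<and> algebraic_int e3 \<and> algebraic_int (1 / e3)"
    unfolding e3_def by (intro conjI n0 unit3[THEN conjunct1] unit3[THEN conjunct2, THEN conjunct1] unit3[THEN conjunct2, THEN conjunct2])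
  hence U3: "e3 \<in> C.U" unfolding C.U_def using F(3) by blast
  \<comment> \<open>The three relative norms contain c three times and each other conjugate once:
    together c^2 times the absolute norm.\<close>
  have "(c * p / m) * (c * q' / m) * (c * d / m) * m ^ 3 = c * c * (c * p * q' * d)" if "m \<noteq> 0" for m p q' d :: complex
    using that by (simp add: power3_eq_cube)
  hence "e1 * e2 * e3 * of_int n ^ 3 = c * c * norm_K c"
    using n unfolding e1_def e2_def e3_def norm_K_def by simp
  also have "norm_K c = of_int t * of_int n ^ 2" by (simp add: q t of_rat_mult of_rat_power)
  finally have eq: "e1 * e2 * e3 * of_int n ^ 3 = c * c * (of_int t * of_int n ^ 2)" .
  have "c * c * t' = m * e" if "e * m ^ 3 = c * c * (t' * m ^ 2)" "m \<noteq> 0" for e m t' :: complex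
    using that by (simp add: power3_eq_cube power2_eq_square) (simp only: mult_ac)
  from this[OF eq] have "c * c * of_int t = of_int n * (e1 * e2 * e3)" using n by simp
  hence "c * c * of_int t * of_int t = of_int t * of_int n * (e1 * e2 * e3)" by (simp only: mult_ac)
  moreover have "of_int t * of_int t = (1 :: complex)" using t(1) by auto
  hence "c * c * of_int t * of_int t = c\<^sup>2" by (simp only: mult.assoc power2_eq_square mult_1_right)
  ultimately have "c\<^sup>2 = of_int t * of_int n * (e1 * e2 * e3)" by (simp only:)
  thus ?thesis using t(1) by (intro that[OF _ U1 U2 U3, of "of_int t"]) auto
qed

text \<open>Dividing c by the square roots of the square parts of the three units leaves \<rho> with
  \<rho>^2 = n \<kappa>. The set of possible \<kappa> depends on neither n nor c, and its size not
  even on the field.\<close>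

lemma square_classes:
  "\<exists>S. finite S \<and> card S \<le> max_classes \<and>
    (\<forall>n c. n > 0 \<longrightarrow> c \<in> K \<longrightarrow> c \<noteq> 0 \<longrightarrow> algebraic_int (c\<^sup>2 / of_int n) \<longrightarrow> algebraic_int (of_int n / c\<^sup>2) \<longrightarrow>
      (\<exists>\<kappa>\<in>S. \<exists>\<rho>\<in>K. \<rho> \<noteq> 0 \<and> \<rho>\<^sup>2 = of_int n * \<kappa>))"
proof -
  obtain E1 where E1: "finite E1" "card E1 \<le> 25" "\<forall>u\<in>A.U. \<exists>e\<in>E1. \<exists>v\<in>A.F. v \<noteq> 0 \<and> u = e * v\<^sup>2"
    using A.unit_square_class_representatives by blast
  obtain E2 where E2: "finite E2" "card E2 \<le> 25" "\<forall>u\<in>B.U. \<exists>e\<in>E2. \<exists>v\<in>B.F. v \<noteq> 0 \<and> u = e * v\<^sup>2"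
    using B.unit_square_class_representatives by blast
  obtain E3 where E3: "finite E3" "card E3 \<le> 25" "\<forall>u\<in>C.U. \<exists>e\<in>E3. \<exists>v\<in>C.F. v \<noteq> 0 \<and> u = e * v\<^sup>2"
    using C.unit_square_class_representatives by blast
  let ?T = "{1, - 1 :: complex} \<times> E1 \<times> E2 \<times> E3"
  define S where "S = (\<lambda>(t, e1, e2, e3). t * (e1 * e2 * e3)) ` ?T"
  have fin: "finite ?T" using E1(1) E2(1) E3(1) by simp
  have "card S \<le> card ?T" unfolding S_def using fin by (rule card_image_le)
  also have "\<dots> = 2 * (card E1 * (card E2 * card E3))"
    unfolding card_cartesian_product by simp
  also have "\<dots> \<le> 2 * (25 * (25 * 25))"
    by (rule mult_le_mono[OF le_refl mult_le_mono[OF E1(2) mult_le_mono[OF E2(2) E3(2)]]])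
  finally have "card S \<le> max_classes" unfolding max_classes_def by simp
  moreover have "\<exists>\<kappa>\<in>S. \<exists>\<rho>\<in>K. \<rho> \<noteq> 0 \<and> \<rho>\<^sup>2 = of_int n * \<kappa>"
    if nc: "n > 0" "c \<in> K" "c \<noteq> 0" "algebraic_int (c\<^sup>2 / of_int n)" "algebraic_int (of_int n / c\<^sup>2)" for n c
  proof -
    obtain t u1 u2 u3 where u: "t = 1 \<or> t = - 1" "u1 \<in> A.U" "u2 \<in> B.U" "u3 \<in> C.U"
      "c\<^sup>2 = t * of_int n * (u1 * u2 * u3)"
      using nc by (rule generator_square_factorisation)
    obtain e1 v1 where 1: "e1 \<in> E1" "v1 \<in> A.F" "v1 \<noteq> 0" "u1 = e1 * v1\<^sup>2" using E1(3)[rule_format, OF u(2)] by blast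
    obtain e2 v2 where 2: "e2 \<in> E2" "v2 \<in> B.F" "v2 \<noteq> 0" "u2 = e2 * v2\<^sup>2" using E2(3)[rule_format, OF u(3)] by blast
    obtain e3 v3 where 3: "e3 \<in> E3" "v3 \<in> C.F" "v3 \<noteq> 0" "u3 = e3 * v3\<^sup>2" using E3(3)[rule_format, OF u(4)] by blast
    define v where "v = v1 * v2 * v3"
    have "v1 \<in> K" "v2 \<in> K" "v3 \<in> K" using 1(2) 2(2) 3(2) F_subset_K by blast+
    hence v: "v \<in> K" "v \<noteq> 0" using 1(3) 2(3) 3(3) by (simp_all add: v_def K_mult)
    have "(c * (1 / v))\<^sup>2 = c\<^sup>2 / v\<^sup>2" by (simp add: power_divide)
    also have "\<dots> = of_int n * (t * (e1 * e2 * e3)) * (v\<^sup>2 / v\<^sup>2)"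
      unfolding u(5) 1(4) 2(4) 3(4) by (simp add: v_def power_mult_distrib mult_ac)
    also have "\<dots> = of_int n * (t * (e1 * e2 * e3))" using v(2) by simp
    finally have "(c * (1 / v))\<^sup>2 = of_int n * (t * (e1 * e2 * e3))" .
    moreover have "t * (e1 * e2 * e3) \<in> S"
      unfolding S_def using u(1) 1(1) 2(1) 3(1) by (intro image_eqI[of _ _ "(t, e1, e2, e3)"]) auto
    moreover have "c * (1 / v) \<in> K" using nc(2) v by (intro K_mult K_inverse)
    moreover have "c * (1 / v) \<noteq> 0" using nc(3) v(2) by simp
    ultimately show ?thesis by blast
  qed
  moreover have "finite S" unfolding S_def using fin by (rule finite_imageI)
  ultimately show ?thesis by (intro exI[of _ S] conjI allI impI)
qed

text \<open>Every automorphism maps a root \<rho> of an integer to \<rho> or - \<rho>, so two of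
  them, one negating \<alpha> and one negating \<beta>, suffice to show that at most one coordinate
  of \<rho> is nonzero.\<close>

lemma rational_square_root_cases:
  assumes "\<rho> \<in> K" "\<rho>\<^sup>2 = of_int m"
  obtains q :: rat and d where "d \<in> {1, g * r, g * s, r * s}" "of_int m = q\<^sup>2 * of_int d"
proof -
  obtain x y z w where \<rho>: "\<rho> = emb x y z w" using assms(1) by (rule K_E)
  have pm: "cj i j \<rho> = \<rho> \<or> cj i j \<rho> = - \<rho>" if "i \<in> sgns" "j \<in> sgns" for i j
  proof -
    have "cj i j \<rho> * cj i j \<rho> = cj i j (\<rho> * \<rho>)" using cj_mult[OF that assms(1) assms(1)] by simp
    also have "\<dots> = \<rho> * \<rho>" using assms(2) by (simp add: cj_of_int flip: power2_eq_square)
    finally show ?thesis by (simp only: square_eq_iff)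
  qed
  have "(z = 0 \<and> w = 0) \<or> (x = 0 \<and> y = 0)"
    using pm[OF sgns_cases(1,2)] unfolding \<rho> cj_emb emb_uminus emb_eq_iff by auto
  moreover have "(y = 0 \<and> w = 0) \<or> (x = 0 \<and> z = 0)"
    using pm[OF sgns_cases(2,1)] unfolding \<rho> cj_emb emb_uminus emb_eq_iff by auto
  moreover have sq: "x * x + of_int (g * r) * (y * y) + of_int (g * s) * (z * z) + of_int (r * s) * (w * w) = of_int m"
    using assms(2) unfolding power2_eq_square \<rho> emb_mult emb_of_int emb_eq_iff by blast
  ultimately consider "y = 0" "z = 0" "w = 0" | "x = 0" "z = 0" "w = 0" | "x = 0" "y = 0" "w = 0" | "x = 0" "y = 0" "z = 0"
    by blast
  thus ?thesis
  proof cases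
    case 1
    thus ?thesis using sq by (intro that[of 1 x]) (simp_all add: power2_eq_square)
  next
    case 2
    thus ?thesis using sq by (intro that[of "g * r" y]) (simp_all add: power2_eq_square mult_ac)
  next
    case 3
    thus ?thesis using sq by (intro that[of "g * s" z]) (simp_all add: power2_eq_square mult_ac)
  next
    case 4
    thus ?thesis using sq by (intro that[of "r * s" w]) (simp_all add: power2_eq_square mult_ac)
  qed
qed

end

text \<open>The square of (n, \<alpha>) is generated by n^2, n \<alpha> and \<alpha>^2 = n m. All
  are multiples of n, and Bezout for the coprime n and m combines the first and the last to
  n.\<close>

lemma (in number_ring) ramified_ideal:
  fixes n m :: int
  assumes n: "n > 0" and \<alpha>: "\<alpha> \<in> Int_K" "\<alpha> * \<alpha> = of_int (n * m)" and coprime: "coprime n m"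
  defines "P \<equiv> {of_int n * x + \<alpha> * y | x y. x \<in> Int_K \<and> y \<in> Int_K}"
  shows "int_ideal P" and "ideal_prod complex_ring P P = scale_set (of_int n) Int_K"
proof -
  have PI: "of_int n * x + \<alpha> * y \<in> P" if "x \<in> Int_K" "y \<in> Int_K" for x y
    using that by (auto simp: P_def)
  have PE: "\<exists>x\<in>Int_K. \<exists>y\<in>Int_K. u = of_int n * x + \<alpha> * y" if "u \<in> P" for u
    using that by (auto simp: P_def)
  have "P \<subseteq> Int_K" using PE \<alpha>(1) by (metis Int_add Int_mult Int_of_int subsetI)
  moreover have "fractional P"
    unfolding fractional_def
  proof (intro conjI ballI)
    show "P \<subseteq> K" using \<open>P \<subseteq> Int_K\<close> Int_subset_K by blast
    show "0 \<in> P" using PI[of 0 0] by simp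
    show "u + v \<in> P" if "u \<in> P" "v \<in> P" for u v
    proof -
      obtain x y x' y' where "x \<in> Int_K" "y \<in> Int_K" "x' \<in> Int_K" "y' \<in> Int_K"
        "u = of_int n * x + \<alpha> * y" "v = of_int n * x' + \<alpha> * y'" using PE[OF \<open>u \<in> P\<close>] PE[OF \<open>v \<in> P\<close>] by blast
      thus ?thesis using PI[of "x + x'" "y + y'"] by (simp add: Int_add algebra_simps)
    qed
    show "a * u \<in> P" if "a \<in> Int_K" "u \<in> P" for a u
    proof -
      obtain x y where "x \<in> Int_K" "y \<in> Int_K" "u = of_int n * x + \<alpha> * y" using PE[OF \<open>u \<in> P\<close>] by blast
      thus ?thesis using PI[of "a * x" "a * y"] \<open>a \<in> Int_K\<close> by (simp add: Int_mult algebra_simps)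
    qed
  qed
  moreover have n_P: "of_int n \<in> P" using PI[OF Int_1 Int_0] by simp
  moreover have "(of_int n :: complex) \<noteq> 0" using n by simp
  ultimately show "int_ideal P" unfolding int_ideal_def by blast
  show "ideal_prod complex_ring P P = scale_set (of_int n) Int_K"
  proof
    show "ideal_prod complex_ring P P \<subseteq> scale_set (of_int n) Int_K"
    proof (rule ideal_prod_least)
      fix u v assume "u \<in> P" "v \<in> P"
      then obtain x y x' y' where xy: "x \<in> Int_K" "y \<in> Int_K" "x' \<in> Int_K" "y' \<in> Int_K"
        and uv: "u = of_int n * x + \<alpha> * y" "v = of_int n * x' + \<alpha> * y'" using PE by meson
      have "u * v = of_int n * (of_int n * (x * x')) + of_int n * (\<alpha> * (x * y' + y * x')) + (\<alpha> * \<alpha>) * (y * y')"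
        unfolding uv by (simp add: algebra_simps)
      also have "\<dots> = of_int n * (of_int n * (x * x') + \<alpha> * (x * y' + y * x') + of_int m * (y * y'))"
        unfolding \<alpha>(2) by (simp add: algebra_simps)
      also have "\<dots> \<in> scale_set (of_int n) Int_K"
        unfolding scale_set_def by (intro imageI Int_add Int_mult xy \<alpha>(1) Int_of_int)
      finally show "u * v \<in> scale_set (of_int n) Int_K" .
    next
      show "u + v \<in> scale_set (of_int n) Int_K"
        if "u \<in> scale_set (of_int n) Int_K" "v \<in> scale_set (of_int n) Int_K" for u v
        using multiples_add that unfolding multiples_def by blast
    qed
    show "scale_set (of_int n) Int_K \<subseteq> ideal_prod complex_ring P P"
    proof
      fix u assume "u \<in> scale_set (of_int n) Int_K"
      then obtain z where z: "z \<in> Int_K" "u = of_int n * z" by (auto simp: scale_set_def)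
      obtain p q where "p * n + q * m = 1" using bezout_int[of n m] coprime by auto
      hence pq: "of_int p * of_int n + of_int q * of_int m = (1 :: complex)"
        by (metis of_int_1 of_int_add of_int_mult)
      have \<alpha>_P: "\<alpha> \<in> P" using PI[OF Int_0 Int_1] by simp
      have "of_int n * (of_int p * z) \<in> P" using PI[of "of_int p * z" 0] z(1) by (simp add: Int_mult)
      moreover have "\<alpha> * (of_int q * z) \<in> P" using PI[of 0 "of_int q * z"] z(1) by (simp add: Int_mult)
      ultimately have "of_int n * (of_int n * (of_int p * z)) + \<alpha> * (\<alpha> * (of_int q * z)) \<in> ideal_prod complex_ring P P"
        by (intro ideal_prod_add ideal_prod_mult n_P \<alpha>_P)
      moreover have "a * (a * (b * z)) + \<alpha> * (\<alpha> * (c * z)) = a * z"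
        if "\<alpha> * \<alpha> = a * d" "b * a + c * d = 1" for a b c d
      proof -
        have "a * (a * (b * z)) + \<alpha> * (\<alpha> * (c * z)) = a * a * b * z + (\<alpha> * \<alpha>) * c * z"
          by (simp only: mult.assoc)
        also have "\<dots> = a * z * (b * a + c * d)"
          unfolding that(1) by (simp only: distrib_left mult_ac)
        finally show ?thesis unfolding that(2) by simp
      qed
      from this[OF \<alpha>(2)[unfolded of_int_mult] pq]
      have "of_int n * (of_int n * (of_int p * z)) + \<alpha> * (\<alpha> * (of_int q * z)) = u" by (simp only: z(2))
      ultimately show "u \<in> ideal_prod complex_ring P P" by (simp only:)
    qed
  qed
qed

lemma squarefree_coprime_cofactor:
  assumes "squarefree (n * m :: int)"
  shows "coprime n m"
proof (rule coprimeI)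
  fix d assume "d dvd n" "d dvd m"
  hence "d\<^sup>2 dvd n * m" unfolding power2_eq_square by (rule mult_dvd_mono)
  thus "is_unit d" using assms by (rule squarefreeD[rotated])
qed

lemma squarefree_product_square_imp_eq:
  fixes n n' :: int and q :: rat
  assumes "n > 0" "n' > 0" "squarefree n" "squarefree n'" "of_int (n * n') = q\<^sup>2"
  shows "n = n'"
proof -
  have "of_int n * (q / of_int n)\<^sup>2 = of_int n'"
    using assms(1,5) by (simp add: power_divide power2_eq_square[of "of_int n"] flip: assms(5))
  then obtain k where k: "q / of_int n = of_int k"
    using rat_square_times_squarefree_int[OF assms(3)] by (metis Ints_cases)
  have "of_int (n * k\<^sup>2) = (of_int n' :: rat)"
    using \<open>of_int n * (q / of_int n)\<^sup>2 = of_int n'\<close> unfolding k by simp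
  hence nk: "n' = n * k\<^sup>2" by (simp only: of_int_eq_iff)
  hence "k\<^sup>2 dvd n'" by simp
  hence "k dvd 1" using assms(4) by (rule squarefreeD[rotated])
  hence "k\<^sup>2 = 1" by (auto simp: zdvd1_eq power2_eq_1_iff)
  thus ?thesis using nk by simp
qed

context biquadratic_field
begin

section \<open>From a Euclidean ideal to a bound on divisors\<close>

text \<open>In ideal terms: n generates the square of a principal fractional ideal.\<close>

definition square_up_to_unit :: "int \<Rightarrow> bool" where
  "square_up_to_unit n \<longleftrightarrow>
     (\<exists>c\<in>K. c \<noteq> 0 \<and> algebraic_int (c\<^sup>2 / of_int n) \<and> algebraic_int (of_int n / c\<^sup>2))"

lemma euclidean_imp_square_up_to_unit:
  assumes euc: "admits_euclidean_ideal K"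
    and n: "n > 0" "n dvd g * r" and n': "n' > 0" "n' dvd g * r"
  shows "square_up_to_unit n \<or> square_up_to_unit n' \<or> square_up_to_unit (n * n')"
proof -
  obtain ws where "integral_basis K ws" using integral_basis_and_discriminant by (elim conjE exE)
  then interpret N: number_ring K ws by (rule number_ring)
  obtain I where I: "euclidean_ideal K I" using euc by (auto simp: admits_euclidean_ideal_def)
  have ex: "\<exists>P. N.int_ideal P \<and> ideal_prod complex_ring P P = scale_set (of_int n) N.Int_K"
    if n: "n > 0" "n dvd g * r" for n
  proof -
    obtain m where m: "g * r = n * m" using n(2) by (rule dvdE)
    have "coprime n m" by (rule squarefree_coprime_cofactor) (use sqf(1) m in simp)
    moreover have "\<alpha> \<in> N.Int_K" using K_gens(1) A.algebraic_int_sqrt by (simp add: N.Int_K_def)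
    moreover have "\<alpha> * \<alpha> = of_int (n * m)" using A.sqrt' by (simp only: m)
    ultimately show ?thesis using N.ramified_ideal[OF n(1)] by blast
  qed
  obtain P where P: "N.int_ideal P" "ideal_prod complex_ring P P = scale_set (of_int n) N.Int_K"
    using ex[OF n] by blast
  obtain Q where Q: "N.int_ideal Q" "ideal_prod complex_ring Q Q = scale_set (of_int n') N.Int_K"
    using ex[OF n'] by blast
  have princ: "N.principal (scale_set (of_int k) N.Int_K)" if "k > 0" for k
    unfolding N.principal_def using that N.K_of_int by (intro bexI[of _ "of_int k"]) auto
  have PQ: "ideal_prod complex_ring (ideal_prod complex_ring P Q) (ideal_prod complex_ring P Q)
    = scale_set (of_int (n * n')) N.Int_K"
  proof -
    have "ideal_prod complex_ring (ideal_prod complex_ring P Q) (ideal_prod complex_ring P Q)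
      = ideal_prod complex_ring (ideal_prod complex_ring P Q) (ideal_prod complex_ring Q P)"
      by (simp only: ideal_prod_commute[of P Q])
    also have "\<dots> = ideal_prod complex_ring (ideal_prod complex_ring P (ideal_prod complex_ring Q Q)) P"
      by (simp only: ideal_prod_assoc)
    also have "\<dots> = ideal_prod complex_ring (ideal_prod complex_ring Q Q) (ideal_prod complex_ring P P)"
      by (simp only: ideal_prod_assoc ideal_prod_commute[of P "ideal_prod complex_ring _ _"])
    also have "\<dots> = scale_set (of_int n' * of_int n) N.Int_K"
      unfolding P(2) Q(2) by (simp only: ideal_prod_scale_set ideal_prod_scale_set_right scale_set_mult
        N.ideal_prod_Int N.fractional_Int mult.commute)
    finally show ?thesis by (simp add: mult.commute)
  qed
  have sq: "square_up_to_unit k"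
    if A: "N.principal A" "ideal_prod complex_ring A A = scale_set (of_int k) N.Int_K" "k > 0" for A k
  proof -
    have k: "(of_int k :: complex) \<in> K" "(of_int k :: complex) \<noteq> 0" using A(3) by (simp_all add: K_of_int)
    obtain c where "c \<in> K" "c \<noteq> 0" "c\<^sup>2 / of_int k \<in> N.Int_K" "of_int k / c\<^sup>2 \<in> N.Int_K"
      using A(1,2) k by (rule N.square_generator)
    thus ?thesis unfolding square_up_to_unit_def N.Int_K_def by blast
  qed
  have "N.principal P \<or> N.principal Q \<or> N.principal (ideal_prod complex_ring P Q)"
    by (rule N.euclidean_ideal_two_torsion[OF I P(1) _ Q(1)]) (simp_all only: P(2) Q(2) princ n n')
  thus ?thesis using sq[OF _ P(2) n(1)] sq[OF _ Q(2) n'(1)] sq[OF _ PQ mult_pos_pos[OF n(1) n'(1)]] by blast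
qed

lemma square_up_to_unit_classes:
  "\<exists>S. finite S \<and> card S \<le> max_classes \<and>
    (\<forall>n. n > 0 \<longrightarrow> square_up_to_unit n \<longrightarrow> (\<exists>\<kappa>\<in>S. \<exists>\<rho>\<in>K. \<rho> \<noteq> 0 \<and> \<rho>\<^sup>2 = of_int n * \<kappa>))"
  using square_classes unfolding square_up_to_unit_def by blast

text \<open>A divisor is recovered from three data: whether it is twisted (2 values), the class
  \<kappa> (at most \<open>max_classes\<close>) and the square class of its product with a fixed
  divisor of the same kind (4 values).\<close>

theorem euclidean_imp_few_divisors:
  assumes euc: "admits_euclidean_ideal K"
  shows "card {n. n > 0 \<and> n dvd g * r} \<le> 8 * max_classes"
proof -
  define Div where "Div = {n. n > 0 \<and> n dvd g * r}"
  have "g * r \<noteq> 0" using grs_nonzero by simp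
  hence fin: "finite Div" unfolding Div_def by (intro finite_subset[OF _ finite_divisors_int[of "g * r"]]) auto
  have Div_sqf: "squarefree n" if "n \<in> Div" for n
    using that squarefree_mono[OF _ sqf(1)] by (auto simp: Div_def)
  obtain S where S: "finite S" "card S \<le> max_classes"
    "\<forall>n. n > 0 \<longrightarrow> square_up_to_unit n \<longrightarrow> (\<exists>\<kappa>\<in>S. \<exists>\<rho>\<in>K. \<rho> \<noteq> 0 \<and> \<rho>\<^sup>2 = of_int n * \<kappa>)"
    using square_up_to_unit_classes by (elim exE conjE)
  \<comment> \<open>If some divisor fails to be a square up to a unit, it serves as the twist for
    all others; otherwise 1 does.\<close>
  have "\<exists>n0>0. \<forall>n\<in>Div. square_up_to_unit n \<or> square_up_to_unit (n0 * n)"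
  proof (cases "\<forall>n\<in>Div. square_up_to_unit n")
    case True
    thus ?thesis by (intro exI[of _ 1]) simp
  next
    case False
    then obtain n0 where n0: "n0 \<in> Div" "\<not> square_up_to_unit n0" by blast
    hence n0': "n0 > 0" "n0 dvd g * r" by (simp_all add: Div_def)
    have "square_up_to_unit n \<or> square_up_to_unit (n0 * n)" if "n \<in> Div" for n
      using euclidean_imp_square_up_to_unit[OF euc n0', of n] n0(2) that unfolding Div_def by blast
    thus ?thesis using n0'(1) by blast
  qed
  then obtain n0 where n0: "n0 > 0" "\<forall>n\<in>Div. square_up_to_unit n \<or> square_up_to_unit (n0 * n)" by blast
  define f where "f n = (if square_up_to_unit n then n else n0 * n)" for n
  have f: "f n > 0 \<and> square_up_to_unit (f n)" if "n \<in> Div" for n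
    using that n0 by (auto simp: f_def Div_def)
  have "\<exists>\<kappa>. \<forall>n\<in>Div. \<kappa> n \<in> S \<and> (\<exists>\<rho>\<in>K. \<rho> \<noteq> 0 \<and> \<rho>\<^sup>2 = of_int (f n) * \<kappa> n)"
    by (rule bchoice) (use f S(3) in blast)
  then obtain \<kappa> where \<kappa>: "\<And>n. n \<in> Div \<Longrightarrow> \<kappa> n \<in> S" "\<And>n. n \<in> Div \<Longrightarrow> \<exists>\<rho>\<in>K. \<rho> \<noteq> 0 \<and> \<rho>\<^sup>2 = of_int (f n) * \<kappa> n"
    by blast
  define key where "key n = (square_up_to_unit n, \<kappa> n)" for n
  have same_key: "\<exists>d\<in>{1, g * r, g * s, r * s}. \<exists>q :: rat. of_int (n * n') = q\<^sup>2 * of_int d"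
    if nn': "n \<in> Div" "n' \<in> Div" "key n = key n'" for n n'
  proof -
    obtain \<rho> where \<rho>: "\<rho> \<in> K" "\<rho> \<noteq> 0" "\<rho>\<^sup>2 = of_int (f n) * \<kappa> n" using \<kappa>(2)[OF nn'(1)] by blast
    obtain \<rho>' where \<rho>': "\<rho>' \<in> K" "\<rho>' \<noteq> 0" "\<rho>'\<^sup>2 = of_int (f n') * \<kappa> n" using \<kappa>(2)[OF nn'(2)] nn'(3) by (auto simp: key_def)
    have f0: "(of_int (f n) :: complex) \<noteq> 0" "(of_int n0 :: complex) \<noteq> 0" using f[OF nn'(1)] n0(1) by auto
    have \<kappa>0: "\<kappa> n \<noteq> 0" using \<rho> by auto
    have "\<kappa> n = \<rho> * \<rho> * (1 / of_int (f n))" using \<rho>(3) f0 by (simp add: power2_eq_square)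
    hence \<kappa>K: "\<kappa> n \<in> K" using K_mult[OF K_mult[OF \<rho>(1,1)] K_inverse[OF K_of_int[of "f n"]]] by simp
    \<comment> \<open>With equal keys the same \<kappa> occurs in both squares and cancels. If the
      key says twisted, both sides also carry n0, and n0^2 is divided out below.\<close>
    define \<theta> where "\<theta> = \<rho> * \<rho>' * (1 / \<kappa> n)"
    have \<theta>: "\<theta> \<in> K" unfolding \<theta>_def by (intro K_mult K_inverse \<rho> \<rho>' \<kappa>K)
    have "\<theta>\<^sup>2 = (\<rho>\<^sup>2 * \<rho>'\<^sup>2) / (\<kappa> n)\<^sup>2" by (simp add: \<theta>_def power_mult_distrib power_divide)
    also have "\<dots> = of_int (f n) * of_int (f n')"
      unfolding \<rho>(3) \<rho>'(3) using \<kappa>0 by (simp add: power2_eq_square)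
    finally have \<theta>2: "\<theta>\<^sup>2 = of_int (f n) * of_int (f n')" .
    have "\<exists>\<theta>\<in>K. \<theta>\<^sup>2 = of_int (n * n')"
    proof (cases "square_up_to_unit n")
      case True
      moreover from this have "square_up_to_unit n'" using nn'(3) by (simp add: key_def)
      ultimately show ?thesis using \<theta> \<theta>2 by (auto simp: f_def)
    next
      case False
      moreover from this have "\<not> square_up_to_unit n'" using nn'(3) by (simp add: key_def)
      ultimately have fs: "f n = n0 * n" "f n' = n0 * n'" by (simp_all add: f_def)
      have "(\<theta> * (1 / of_int n0))\<^sup>2 = \<theta>\<^sup>2 / (of_int n0 * of_int n0)" by (simp add: power2_eq_square)
      also have "\<dots> = of_int (n * n')" unfolding \<theta>2 fs using f0(2) by simp
      finally show ?thesis using K_mult[OF \<theta> K_inverse[OF K_of_int[of n0]]] by blast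
    qed
    thus ?thesis by (meson rational_square_root_cases)
  qed
  \<comment> \<open>A fixed divisor for each key, with which all others of that key are compared.
    Two divisors with the same key and the same square class relative to it have a square product,
    hence are equal, being squarefree and positive.\<close>
  define rep where "rep k = (SOME n. n \<in> Div \<and> key n = k)" for k
  have rep: "rep (key n) \<in> Div \<and> key (rep (key n)) = key n" if "n \<in> Div" for n
    unfolding rep_def by (rule someI_ex) (use that in blast)
  have "\<exists>d. \<forall>n\<in>Div. d n \<in> {1, g * r, g * s, r * s} \<and> (\<exists>q :: rat. of_int (n * rep (key n)) = q\<^sup>2 * of_int (d n))"
    by (rule bchoice) (use same_key rep in metis)
  then obtain d where d: "\<And>n. n \<in> Div \<Longrightarrow> d n \<in> {1, g * r, g * s, r * s}"
    "\<And>n. n \<in> Div \<Longrightarrow> \<exists>q :: rat. of_int (n * rep (key n)) = q\<^sup>2 * of_int (d n)" by blast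
  have "inj_on (\<lambda>n. (key n, d n)) Div"
  proof (rule inj_onI)
    fix n n' assume nn': "n \<in> Div" "n' \<in> Div" "(key n, d n) = (key n', d n')"
    define m where "m = rep (key n)"
    have m: "m > 0" using rep[OF nn'(1)] by (simp add: m_def Div_def)
    obtain q where q: "of_int (n * m) = q\<^sup>2 * (of_int (d n) :: rat)" using d(2)[OF nn'(1)] unfolding m_def by blast
    obtain q' where q': "of_int (n' * m) = q'\<^sup>2 * (of_int (d n) :: rat)"
      using d(2)[OF nn'(2)] nn'(3) by (auto simp: m_def)
    have "of_int (n * n') * (of_int m)\<^sup>2 = (of_int (n * m) * of_int (n' * m) :: rat)"
      by (simp add: power2_eq_square)
    also have "\<dots> = (q * q' * of_int (d n))\<^sup>2" unfolding q q' by (simp add: power2_eq_square)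
    finally have "of_int (n * n') = (q * q' * of_int (d n) / of_int m)\<^sup>2"
      using m by (simp add: power_divide eq_divide_eq)
    thus "n = n'"
      using nn'(1,2) Div_sqf by (intro squarefree_product_square_imp_eq[of n n']) (auto simp: Div_def)
  qed
  moreover have "(\<lambda>n. (key n, d n)) ` Div \<subseteq> (UNIV \<times> S) \<times> {1, g * r, g * s, r * s}"
    using \<kappa>(1) d(1) by (auto simp: key_def)
  ultimately have "card Div \<le> card (((UNIV :: bool set) \<times> S) \<times> {1, g * r, g * s, r * s})"
    using S(1) by (intro card_inj_on_le) auto
  also have "\<dots> = 2 * card S * card {1, g * r, g * s, r * s}" by (simp only: card_cartesian_product card_UNIV_bool)
  also have "\<dots> \<le> 2 * max_classes * 4"
    using card_length[of "[1, g * r, g * s, r * s]"] S(2) by (intro mult_le_mono) auto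
  finally show ?thesis by (simp add: Div_def)
qed

end

section \<open>The family of fields\<close>

interpretation complex_ring: cring complex_ring
  by (rule cring_from_type_algebra)

lemma complex_ring_minus [simp]: "\<ominus>\<^bsub>complex_ring\<^esub> x = - x"
  by (rule complex_ring.minus_equality) simp_all

lemma complex_ring_inv: "x \<noteq> 0 \<Longrightarrow> inv\<^bsub>complex_ring\<^esub> x = 1 / x"
  by (rule complex_ring.comm_inv_char) simp_all

lemma generate_field_subset:
  assumes "H \<subseteq> F" "1 \<in> F" "\<And>u. u \<in> F \<Longrightarrow> - u \<in> F" "\<And>u. u \<in> F \<Longrightarrow> 1 / u \<in> F"
    "\<And>u v. u \<in> F \<Longrightarrow> v \<in> F \<Longrightarrow> u + v \<in> F" "\<And>u v. u \<in> F \<Longrightarrow> v \<in> F \<Longrightarrow> u * v \<in> F"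
  shows "generate_field complex_ring H \<subseteq> F"
proof
  fix u assume "u \<in> generate_field complex_ring H"
  thus "u \<in> F"
    by induction (use assms in \<open>auto simp: complex_ring_inv\<close>)
qed

lemma
  shows generate_field_uminus: "u \<in> generate_field complex_ring H \<Longrightarrow> - u \<in> generate_field complex_ring H"
    and generate_field_add: "u \<in> generate_field complex_ring H \<Longrightarrow> v \<in> generate_field complex_ring H \<Longrightarrow>
      u + v \<in> generate_field complex_ring H"
    and generate_field_mult: "u \<in> generate_field complex_ring H \<Longrightarrow> v \<in> generate_field complex_ring H \<Longrightarrow>
      u * v \<in> generate_field complex_ring H"
    and generate_field_inverse: "u \<in> generate_field complex_ring H \<Longrightarrow> u \<noteq> 0 \<Longrightarrow> 1 / u \<in> generate_field complex_ring H"
  using generate_field.a_inv[of u complex_ring H] generate_field.eng_add[of u complex_ring H v]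
    generate_field.eng_mult[of u complex_ring H v] generate_field.m_inv[of u complex_ring H]
  by (simp_all add: complex_ring_inv)

lemma generate_field_of_rat: "of_rat q \<in> generate_field complex_ring H"
proof -
  let ?G = "generate_field complex_ring H"
  have one: "1 \<in> ?G" using generate_field.one[of complex_ring H] by simp
  have zero: "0 \<in> ?G" using generate_field_add[OF one generate_field_uminus[OF one]] by simp
  have nat: "of_nat n \<in> ?G" for n
    by (induction n) (simp_all add: zero one generate_field_add)
  have int: "of_int n \<in> ?G" for n
    using nat[of "nat n"] generate_field_uminus[OF nat[of "nat (- n)"]] by (cases "n \<ge> 0") simp_all
  obtain a b where q: "b > 0" "q = of_int a / of_int b"
    by (metis Fract_of_int_quotient Rat_cases_nonzero quotient_of_unique)
  have "of_int a * (1 / of_int b) \<in> ?G"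
    using q(1) by (intro generate_field_mult generate_field_inverse int) simp
  thus ?thesis by (simp add: q of_rat_divide)
qed

lemma (in biquadratic_field) generate_field_eq_K: "generate_field complex_ring {\<alpha>, \<beta>} = K"
proof
  show "generate_field complex_ring {\<alpha>, \<beta>} \<subseteq> K"
  proof (rule generate_field_subset)
    show "1 \<in> K" using K_of_int[of 1] by simp
  qed (simp_all add: K_gens K_uminus K_inverse K_add K_mult)
  show "K \<subseteq> generate_field complex_ring {\<alpha>, \<beta>}"
  proof
    fix u assume "u \<in> K"
    then obtain x y z w where u: "u = emb x y z w" by (rule K_E)
    have gens: "\<alpha> \<in> generate_field complex_ring {\<alpha>, \<beta>}" "\<beta> \<in> generate_field complex_ring {\<alpha>, \<beta>}"
      by (simp_all add: generate_field.incl)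
    have "\<gamma> = of_rat (1 / of_int g) * (\<alpha> * \<beta>)"
      using products(1) grs_nonzero by (simp add: of_rat_divide)
    also have "\<dots> \<in> generate_field complex_ring {\<alpha>, \<beta>}"
      by (intro generate_field_mult generate_field_of_rat gens)
    finally have "\<gamma> \<in> generate_field complex_ring {\<alpha>, \<beta>}" .
    thus "u \<in> generate_field complex_ring {\<alpha>, \<beta>}"
      unfolding u emb_def by (intro generate_field_add generate_field_mult generate_field_of_rat gens)
  qed
qed

lemma subfield_Rats: "subfield \<rat> complex_ring"
proof (rule field.subfieldI'[OF field_from_type_algebra])
  show "subring \<rat> complex_ring"
    by (rule complex_ring.subringI) auto
  show "inv\<^bsub>complex_ring\<^esub> k \<in> \<rat>" if "k \<in> \<rat> - {\<zero>\<^bsub>complex_ring\<^esub>}" for k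
    using that by (auto simp: complex_ring_inv)
qed

lemma mem_Span_Nil: "u \<in> complex_ring.Span \<rat> [] \<longleftrightarrow> u = 0"
  by simp

lemma mem_Span_Cons:
  "u \<in> complex_ring.Span \<rat> (a # Us) \<longleftrightarrow> (\<exists>q v. v \<in> complex_ring.Span \<rat> Us \<and> u = of_rat q * a + v)"
  using complex_ring.line_extension_mem_iff[of u \<rat> a "complex_ring.Span \<rat> Us"] by (auto simp: Rats_def)

text \<open>Serves to exclude degenerate pairs of radicands: for these the generated field would lie
  in a quadratic field, against dimension 4.\<close>

lemma (in quadratic_field) dimension_subset_F:
  assumes "complex_ring.dimension n \<rat> G" "G \<subseteq> F"
  shows "n \<le> 2"
proof -
  have span: "u \<in> complex_ring.Span \<rat> [\<delta>, 1] \<longleftrightarrow> (\<exists>y x. u = of_rat y * \<delta> + of_rat x)" for u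
    unfolding mem_Span_Cons mem_Span_Nil by auto
  have indep: "complex_ring.independent \<rat> [\<delta>, 1]"
  proof (intro complex_ring.li_Cons complex_ring.li_Nil)
    show "\<delta> \<notin> complex_ring.Span \<rat> [1]"
    proof
      assume "\<delta> \<in> complex_ring.Span \<rat> [1]"
      then obtain q where "\<delta> = of_rat q" unfolding mem_Span_Cons mem_Span_Nil by auto
      hence "of_rat 0 + of_rat 1 * \<delta> = of_rat q + of_rat 0 * \<delta>" by simp
      thus False using coords_unique(2) by fastforce
    qed
  qed simp_all
  obtain Vs where Vs: "complex_ring.independent \<rat> Vs" "length Vs = n" "complex_ring.Span \<rat> Vs = G"
    using complex_ring.exists_base[OF subfield_Rats assms(1)] by blast
  have "set Vs \<subseteq> G"
    using complex_ring.Span_base_incl[OF subfield_Rats, of Vs] complex_ring.independent_in_carrier[OF Vs(1)] Vs(3) by simp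
  also have "G \<subseteq> complex_ring.Span \<rat> [\<delta>, 1]"
  proof
    fix u assume "u \<in> G"
    hence "u \<in> F" using assms(2) by blast
    then obtain x y where "u = of_rat x + of_rat y * \<delta>" by (rule F_E)
    hence "u = of_rat y * \<delta> + of_rat x" by simp
    thus "u \<in> complex_ring.Span \<rat> [\<delta>, 1]" unfolding span by blast
  qed
  finally have "length Vs \<le> length [\<delta>, 1]"
    by (rule complex_ring.independent_length_le[OF subfield_Rats Vs(1) indep])
  thus ?thesis using Vs(2) by simp
qed

lemma (in quadratic_field) generate_field_subset_F:
  assumes "H \<subseteq> F"
  shows "generate_field complex_ring H \<subseteq> F"
proof (rule generate_field_subset[OF assms])
  show "1 \<in> F" using F_of_int[of 1] by simp
qed (simp_all add: F_uminus F_inverse F_add F_mult)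

lemma (in biquadratic_field) dimension_K: "complex_ring.dimension 4 \<rat> K"
proof -
  have step: "of_rat x = emb x 0 0 0" "of_rat y * \<alpha> + emb x 0 0 0 = emb x y 0 0"
    "of_rat z * \<beta> + emb x y 0 0 = emb x y z 0" "of_rat w * \<gamma> + emb x y z 0 = emb x y z w" for x y z w
    by (simp_all add: emb_def)
  have mem1: "u \<in> complex_ring.Span \<rat> [1] \<longleftrightarrow> (\<exists>x. u = emb x 0 0 0)" for u
    unfolding mem_Span_Cons mem_Span_Nil by (simp add: step(1))
  have mem2: "u \<in> complex_ring.Span \<rat> [\<alpha>, 1] \<longleftrightarrow> (\<exists>x y. u = emb x y 0 0)" for u
  proof -
    have "?thesis \<longleftrightarrow> (\<exists>y x. u = of_rat y * \<alpha> + emb x 0 0 0) = (\<exists>x y. u = emb x y 0 0)"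
      unfolding mem_Span_Cons[of u \<alpha>] mem1 by blast
    thus ?thesis unfolding step(2) by blast
  qed
  have mem3: "u \<in> complex_ring.Span \<rat> [\<beta>, \<alpha>, 1] \<longleftrightarrow> (\<exists>x y z. u = emb x y z 0)" for u
  proof -
    have "?thesis \<longleftrightarrow> (\<exists>z x y. u = of_rat z * \<beta> + emb x y 0 0) = (\<exists>x y z. u = emb x y z 0)"
      unfolding mem_Span_Cons[of u \<beta>] mem2 by blast
    thus ?thesis unfolding step(3) by blast
  qed
  have mem4: "u \<in> complex_ring.Span \<rat> [\<gamma>, \<beta>, \<alpha>, 1] \<longleftrightarrow> (\<exists>x y z w. u = emb x y z w)" for u
  proof -
    have "?thesis \<longleftrightarrow> (\<exists>w x y z. u = of_rat w * \<gamma> + emb x y z 0) = (\<exists>x y z w. u = emb x y z w)"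
      unfolding mem_Span_Cons[of u \<gamma>] mem3 by blast
    thus ?thesis unfolding step(4) by blast
  qed
  have indep: "complex_ring.independent \<rat> [\<gamma>, \<beta>, \<alpha>, 1]"
  proof (intro complex_ring.li_Cons complex_ring.li_Nil)
    show "\<gamma> \<notin> complex_ring.Span \<rat> [\<beta>, \<alpha>, 1]"

    proof
      assume "\<gamma> \<in> complex_ring.Span \<rat> [\<beta>, \<alpha>, 1]"
      hence "\<gamma> \<in> {emb x y z 0 | x y z. True}" unfolding mem3 by blast
      then obtain x y z where "\<gamma> = emb x y z 0" by (elim CollectE exE conjE)
      hence "emb 0 0 0 1 = emb x y z 0" by (rule trans[OF emb_gens(3)[symmetric]])
      thus False unfolding emb_eq_iff by simp
    qed
    show "\<beta> \<notin> complex_ring.Span \<rat> [\<alpha>, 1]"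

    proof
      assume "\<beta> \<in> complex_ring.Span \<rat> [\<alpha>, 1]"
      hence "\<beta> \<in> {emb x y 0 0 | x y. True}" unfolding mem2 by blast
      then obtain x y where "\<beta> = emb x y 0 0" by (elim CollectE exE conjE)
      hence "emb 0 0 1 0 = emb x y 0 0" by (rule trans[OF emb_gens(2)[symmetric]])
      thus False unfolding emb_eq_iff by simp
    qed
    show "\<alpha> \<notin> complex_ring.Span \<rat> [1]"

    proof
      assume "\<alpha> \<in> complex_ring.Span \<rat> [1]"
      hence "\<alpha> \<in> {emb x 0 0 0 | x. True}" unfolding mem1 by blast
      then obtain x where "\<alpha> = emb x 0 0 0" by (elim CollectE exE conjE)
      hence "emb 0 1 0 0 = emb x 0 0 0" by (rule trans[OF emb_gens(1)[symmetric]])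
      thus False unfolding emb_eq_iff by simp
    qed
  qed simp_all
  have "complex_ring.Span \<rat> [\<gamma>, \<beta>, \<alpha>, 1] = K"
    unfolding set_eq_iff mem4 K_def by blast
  from complex_ring.dimensionI[OF subfield_Rats indep this]
  show ?thesis by (simp add: numeral_eq_Suc)
qed

text \<open>The root \<gamma> is defined as the product of the two principal roots divided by g, not
  as a principal root: for two negative radicands these differ by a sign, and
  \<open>products\<close> would fail.\<close>

lemma biquadratic_field_csqrt:
  fixes a b :: int
  assumes odd: "odd a" "odd b" and sqf: "squarefree a" "squarefree b" and ne: "a \<noteq> 1" "b \<noteq> 1" "a \<noteq> b"
  obtains g r s \<gamma> where "biquadratic_field g r s (csqrt (of_int a)) (csqrt (of_int b)) \<gamma>" "a = g * r" "b = g * s"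
proof -
  define g where "g = gcd a b"
  have g0: "g \<noteq> 0" using odd(1) by (auto simp: g_def)
  obtain r s where "a = r * g" "b = s * g" "coprime r s"
    using gcd_coprime_exists[of a b] g0 unfolding g_def by blast
  hence rs: "a = g * r" "b = g * s" by simp_all
  define \<gamma> where "\<gamma> = csqrt (of_int a) * csqrt (of_int b) / of_int g"
  have sqr: "csqrt (of_int a) * csqrt (of_int a) = of_int g * of_int r" "csqrt (of_int b) * csqrt (of_int b) = of_int g * of_int s"
    using power2_csqrt[of "of_int a"] power2_csqrt[of "of_int b"] rs by (simp_all add: power2_eq_square)
  have "squarefree r" "squarefree s" using sqf squarefree_multD(2) rs by metis+
  have "biquadratic_field g r s (csqrt (of_int a)) (csqrt (of_int b)) \<gamma>"
  proof
    show "(csqrt (of_int a))\<^sup>2 = of_int (g * r)" "(csqrt (of_int b))\<^sup>2 = of_int (g * s)" by (simp_all add: rs)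
    have "\<gamma>\<^sup>2 = (csqrt (of_int a) * csqrt (of_int a)) * (csqrt (of_int b) * csqrt (of_int b)) / (of_int g * of_int g)"
      by (simp add: \<gamma>_def power2_eq_square mult_ac)
    thus "\<gamma>\<^sup>2 = of_int (r * s)" unfolding sqr using g0 by simp
    show "csqrt (of_int a) * csqrt (of_int b) = of_int g * \<gamma>" using g0 by (simp add: \<gamma>_def)
    have "csqrt (of_int a) * \<gamma> = (csqrt (of_int a) * csqrt (of_int a)) * csqrt (of_int b) / of_int g" by (simp add: \<gamma>_def)
    thus "csqrt (of_int a) * \<gamma> = of_int r * csqrt (of_int b)" unfolding sqr using g0 by simp
    have "csqrt (of_int b) * \<gamma> = (csqrt (of_int b) * csqrt (of_int b)) * csqrt (of_int a) / of_int g" by (simp add: \<gamma>_def mult_ac)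
    thus "csqrt (of_int b) * \<gamma> = of_int s * csqrt (of_int a)" unfolding sqr using g0 by simp
    show "squarefree (g * r)" "squarefree (g * s)" "g * r \<noteq> 1" "g * s \<noteq> 1" using sqf ne rs by simp_all
    show "squarefree (r * s)" using \<open>coprime r s\<close> \<open>squarefree r\<close> \<open>squarefree s\<close> by (rule squarefree_mult_coprime)
    show "r * s \<noteq> 1" using ne(3) rs by (auto simp: zmult_eq_1_iff)
    show "odd g" "odd r" "odd s" using odd rs by simp_all
  qed
  thus ?thesis using rs by (rule that)
qed

lemma odd_biquadratic_fieldsE:
  assumes "K \<in> odd_biquadratic_fields"
  obtains g r s \<gamma> where "biquadratic_field g r s (csqrt (of_int (g * r))) (csqrt (of_int (g * s))) \<gamma>"
    "K = biquadratic_field.K (csqrt (of_int (g * r))) (csqrt (of_int (g * s))) \<gamma>"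
    "K = generate_field complex_ring {csqrt (of_int (g * r)), csqrt (of_int (g * s))}"
proof -
  obtain a b :: int where ab: "odd a" "odd b" "squarefree a" "squarefree b"
    and K: "K = generate_field complex_ring {csqrt (of_int a), csqrt (of_int b)}"
    and dim: "complex_ring.dimension 4 \<rat> K"
    using assms unfolding odd_biquadratic_fields_def mem_Collect_eq by (elim exE conjE)
  have in_quadratic: False
    if d: "squarefree d" "d \<noteq> 1" "{csqrt (of_int a), csqrt (of_int b)} \<subseteq> {1, csqrt (of_int d)}" for d
  proof -
    interpret Q: quadratic_field d "csqrt (of_int d)" by unfold_locales (simp_all add: d)
    have "1 \<in> Q.F" using Q.F_of_int[of 1] by (simp only: of_int_1)
    moreover have "csqrt (of_int d) \<in> Q.F"
      using Q.in_F[of 0 1] by (simp only: of_rat_0 of_rat_1 add_0 mult_1)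
    ultimately have "{1, csqrt (of_int d)} \<subseteq> Q.F" unfolding insert_subset by (intro conjI empty_subsetI)
    with d(3) have "{csqrt (of_int a), csqrt (of_int b)} \<subseteq> Q.F" by (rule order_trans)
    hence "K \<subseteq> Q.F" unfolding K by (rule Q.generate_field_subset_F)
    thus False using Q.dimension_subset_F[OF dim] by simp
  qed
  \<comment> \<open>For a = b = 1 no radicand generates a quadratic field, so an arbitrary one, -1,
    is taken to contain the generators.\<close>
  have "squarefree (- 1 :: int)" by simp
  hence not_both: "a \<noteq> 1 \<or> b \<noteq> 1" using in_quadratic[of "- 1"] by auto
  have ne: "a \<noteq> 1" "b \<noteq> 1" "a \<noteq> b"
  proof -
    show "a \<noteq> 1" using in_quadratic[of b] not_both ab(4) by auto
    show "b \<noteq> 1" using in_quadratic[of a] not_both ab(3) by auto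
    show "a \<noteq> b" using in_quadratic[of a] not_both ab(3) by auto
  qed
  obtain g r s \<gamma> where bq: "biquadratic_field g r s (csqrt (of_int a)) (csqrt (of_int b)) \<gamma>"
    and rs: "a = g * r" "b = g * s" by (rule biquadratic_field_csqrt[OF ab ne])
  show ?thesis
  proof (rule that)
    show "biquadratic_field g r s (csqrt (of_int (g * r))) (csqrt (of_int (g * s))) \<gamma>"
      using bq unfolding rs .
    show "K = biquadratic_field.K (csqrt (of_int (g * r))) (csqrt (of_int (g * s))) \<gamma>"
      unfolding K biquadratic_field.generate_field_eq_K[OF bq] unfolding rs ..
    show "K = generate_field complex_ring {csqrt (of_int (g * r)), csqrt (of_int (g * s))}"
      unfolding K rs ..
  qed
qed

lemma generate_field_csqrt_in_family:
  fixes a b :: int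
  assumes "odd a" "odd b" "squarefree a" "squarefree b" "a \<noteq> 1" "b \<noteq> 1" "a \<noteq> b"
  shows "generate_field complex_ring {csqrt (of_int a), csqrt (of_int b)} \<in> odd_biquadratic_fields"
proof -
  obtain g r s \<gamma> where bq: "biquadratic_field g r s (csqrt (of_int a)) (csqrt (of_int b)) \<gamma>"
    using assms by (rule biquadratic_field_csqrt)
  have dim: "complex_ring.dimension 4 \<rat> (generate_field complex_ring {csqrt (of_int a), csqrt (of_int b)})"
    unfolding biquadratic_field.generate_field_eq_K[OF bq] by (rule biquadratic_field.dimension_K[OF bq])
  show ?thesis
    unfolding odd_biquadratic_fields_def mem_Collect_eq
    by (rule exI[of _ a], rule exI[of _ b]) (intro conjI assms refl dim)
qed

section \<open>Counting\<close>

definition field_of_pair :: "int \<times> int \<Rightarrow> complex set" where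
  "field_of_pair p = generate_field complex_ring {csqrt (of_int (fst p)), csqrt (of_int (snd p))}"

lemma (in biquadratic_field) abs_discriminant:
  "(g * r * s)\<^sup>2 \<le> \<bar>discriminant K\<bar>" "\<bar>discriminant K\<bar> \<le> 16 * (g * r * s)\<^sup>2"
  using integral_basis_and_discriminant by auto

lemma field_in_up_to_discriminantE:
  assumes "K \<in> up_to_discriminant odd_biquadratic_fields x"
  obtains g r s \<gamma> where "biquadratic_field g r s (csqrt (of_int (g * r))) (csqrt (of_int (g * s))) \<gamma>"
    "K = biquadratic_field.K (csqrt (of_int (g * r))) (csqrt (of_int (g * s))) \<gamma>"
    "K = field_of_pair (g * r, g * s)" "nat \<bar>g * r * s\<bar> \<in> {1..nat \<lfloor>sqrt x\<rfloor>}"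
proof -
  from assms have K: "K \<in> odd_biquadratic_fields" and x: "real_of_int \<bar>discriminant K\<bar> \<le> x"
    unfolding up_to_discriminant_def by simp_all
  from K obtain g r s \<gamma> where
    bq: "biquadratic_field g r s (csqrt (of_int (g * r))) (csqrt (of_int (g * s))) \<gamma>" and
    K1: "K = biquadratic_field.K (csqrt (of_int (g * r))) (csqrt (of_int (g * s))) \<gamma>" and
    K2: "K = generate_field complex_ring {csqrt (of_int (g * r)), csqrt (of_int (g * s))}"
    by (rule odd_biquadratic_fieldsE)
  have "(real_of_int \<bar>g * r * s\<bar>)\<^sup>2 = real_of_int ((g * r * s)\<^sup>2)" by simp
  also have "\<dots> \<le> real_of_int \<bar>discriminant K\<bar>"
    unfolding K1 of_int_le_iff by (rule biquadratic_field.abs_discriminant(1)[OF bq])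
  also have "\<dots> \<le> x" by (rule x)
  finally have "real_of_int \<bar>g * r * s\<bar> \<le> sqrt x" by (rule real_le_rsqrt)
  hence "\<bar>g * r * s\<bar> \<le> \<lfloor>sqrt x\<rfloor>" by (simp only: le_floor_iff)
  moreover have "g * r * s \<noteq> 0" using biquadratic_field.grs_nonzero[OF bq] by simp
  hence "1 \<le> \<bar>g * r * s\<bar>" by linarith
  ultimately have "nat \<bar>g * r * s\<bar> \<in> {1..nat \<lfloor>sqrt x\<rfloor>}" unfolding atLeastAtMost_iff by linarith
  moreover have "K = field_of_pair (g * r, g * s)" unfolding field_of_pair_def fst_conv snd_conv by (rule K2)
  ultimately show ?thesis using that[OF bq K1] by blast
qed

section \<open>Upper bound for the fields with a Euclidean ideal\<close>

text \<open>For M = |g r s| both radicands g r and g s are signed divisors of M, so these pairs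
  cover all fields belonging to M.\<close>

definition divisor_pairs :: "nat \<Rightarrow> (int \<times> int) set" where
  "divisor_pairs M = {a. a dvd int M} \<times> {a. a dvd int M}"

lemma finite_divisor_pairs: "M > 0 \<Longrightarrow> finite (divisor_pairs M)"
  unfolding divisor_pairs_def by (intro finite_cartesian_product finite_divisors_int) simp_all

lemma pair_in_divisor_pairs: "(g * r, g * s) \<in> divisor_pairs (nat \<bar>g * r * s :: int\<bar>)"
proof -
  have "g * r dvd g * r * s" "g * s dvd g * r * s" by (auto intro: dvdI)
  thus ?thesis by (simp add: divisor_pairs_def)
qed

lemma finite_up_to_discriminant: "finite (up_to_discriminant odd_biquadratic_fields x)"
proof (rule finite_subset)
  show "up_to_discriminant odd_biquadratic_fields x \<subseteq> (\<Union>M\<in>{1..nat \<lfloor>sqrt x\<rfloor>}. field_of_pair ` divisor_pairs M)"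
  proof
    fix K assume "K \<in> up_to_discriminant odd_biquadratic_fields x"
    then obtain g r s \<gamma> where K: "K = field_of_pair (g * r, g * s)" "nat \<bar>g * r * s\<bar> \<in> {1..nat \<lfloor>sqrt x\<rfloor>}"
      by (rule field_in_up_to_discriminantE)
    have "K \<in> field_of_pair ` divisor_pairs (nat \<bar>g * r * s\<bar>)"
      unfolding K(1) by (rule imageI[OF pair_in_divisor_pairs])
    thus "K \<in> (\<Union>M\<in>{1..nat \<lfloor>sqrt x\<rfloor>}. field_of_pair ` divisor_pairs M)" using K(2) by (rule UN_I[rotated])
  qed
  show "finite (\<Union>M\<in>{1..nat \<lfloor>sqrt x\<rfloor>}. field_of_pair ` divisor_pairs M)"
    by (intro finite_UN_I finite_imageI finite_divisor_pairs) auto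
qed

lemma card_divisors_mult_le:
  fixes a b :: int
  assumes "a \<noteq> 0" "b \<noteq> 0"
  shows "card {n. n > 0 \<and> n dvd a * b} \<le> card {n. n > 0 \<and> n dvd a} * card {n. n > 0 \<and> n dvd b}"
proof -
  let ?D = "\<lambda>a :: int. {n. n > 0 \<and> n dvd a}"
  have fin: "finite (?D a)" if "a \<noteq> 0" for a
    by (rule finite_subset[OF _ finite_divisors_int[OF that]]) auto
  have "?D (a * b) \<subseteq> (\<lambda>(k, l). k * l) ` (?D a \<times> ?D b)"
  proof
    fix n assume "n \<in> ?D (a * b)"
    hence n: "n > 0" "n dvd a * b" by auto
    obtain k l where kl: "n = k * l" "k dvd a" "l dvd b" using division_decomp[OF n(2)] by blast
    have "n = \<bar>k\<bar> * \<bar>l\<bar>" using n(1) kl(1) by (simp flip: abs_mult)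
    moreover have "\<bar>k\<bar> \<in> ?D a" "\<bar>l\<bar> \<in> ?D b" using kl n(1) by auto
    ultimately show "n \<in> (\<lambda>(k, l). k * l) ` (?D a \<times> ?D b)"
      by (intro image_eqI[of _ _ "(\<bar>k\<bar>, \<bar>l\<bar>)"]) simp_all
  qed
  hence "card (?D (a * b)) \<le> card ((\<lambda>(k, l). k * l) ` (?D a \<times> ?D b))"
    using fin assms by (intro card_mono finite_imageI finite_cartesian_product) auto
  also have "\<dots> \<le> card (?D a \<times> ?D b)" using fin assms by (intro card_image_le finite_cartesian_product)
  finally show ?thesis by (simp add: card_cartesian_product)
qed

lemma card_signed_divisors_le:
  fixes a :: int
  assumes "a \<noteq> 0"
  shows "card {n. n dvd a} \<le> 2 * card {n. n > 0 \<and> n dvd a}"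
proof -
  let ?D = "{n. n > 0 \<and> n dvd a}"
  have fin: "finite ?D" by (rule finite_subset[OF _ finite_divisors_int[OF assms]]) auto
  have "n \<in> ?D \<union> uminus ` ?D" if "n dvd a" for n
  proof (cases "n > 0")
    case False
    hence "- n \<in> ?D" using that assms by (cases "n = 0") auto
    hence "- (- n) \<in> uminus ` ?D" by (rule imageI)
    thus ?thesis by simp
  qed (use that in simp)
  hence "card {n. n dvd a} \<le> card (?D \<union> uminus ` ?D)"
    using fin by (intro card_mono) auto
  also have "\<dots> \<le> card ?D + card (uminus ` ?D)" by (rule card_Un_le)
  also have "\<dots> \<le> 2 * card ?D" using card_image_le[OF fin, of uminus] by simp
  finally show ?thesis .
qed

text \<open>Both g r and g s have at most \<open>8 * max_classes\<close> positive divisors, and g r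
  s divides their product; the factor 2 counts signs, and the square counts pairs.\<close>

definition max_pairs :: nat where
  "max_pairs = (2 * (8 * max_classes * (8 * max_classes)))\<^sup>2"

text \<open>A Euclidean ideal restricts M = |g r s| to integers with boundedly many divisors, each
  carrying boundedly many fields, and the discriminant bounds M by sqrt x.\<close>

lemma card_euclidean_le:
  "card (up_to_discriminant euclidean_odd_biquadratic_fields x) \<le> max_pairs * nat \<lfloor>sqrt x\<rfloor>"
proof -
  define B where "B = {M \<in> {1..nat \<lfloor>sqrt x\<rfloor>}. card (divisor_pairs M) \<le> max_pairs}"
  have "up_to_discriminant euclidean_odd_biquadratic_fields x \<subseteq> (\<Union>M\<in>B. field_of_pair ` divisor_pairs M)"
  proof
    fix K assume "K \<in> up_to_discriminant euclidean_odd_biquadratic_fields x"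
    hence K: "K \<in> up_to_discriminant odd_biquadratic_fields x" and euc: "admits_euclidean_ideal K"
      unfolding up_to_discriminant_def euclidean_odd_biquadratic_fields_def by simp_all
    from K obtain g r s \<gamma> where
      bq: "biquadratic_field g r s (csqrt (of_int (g * r))) (csqrt (of_int (g * s))) \<gamma>" and
      K1: "K = biquadratic_field.K (csqrt (of_int (g * r))) (csqrt (of_int (g * s))) \<gamma>" and
      K2: "K = field_of_pair (g * r, g * s)" and M: "nat \<bar>g * r * s\<bar> \<in> {1..nat \<lfloor>sqrt x\<rfloor>}"
      by (rule field_in_up_to_discriminantE)
    note nz = biquadratic_field.grs_nonzero[OF bq]
    have nz': "g * r \<noteq> 0" "g * s \<noteq> 0" using nz by simp_all
    have 1: "card {n. n > 0 \<and> n dvd g * r} \<le> 8 * max_classes"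
      using euc unfolding K1 by (rule biquadratic_field.euclidean_imp_few_divisors[OF bq])
    have 2: "card {n. n > 0 \<and> n dvd g * s} \<le> 8 * max_classes"
      \<comment> \<open>The divisor bound concerns g r; exchanging \<alpha> and \<beta> applies it
        to g s.\<close>
      using euc unfolding K1 biquadratic_field.K_swap[OF bq, symmetric]
      by (rule biquadratic_field.euclidean_imp_few_divisors[OF biquadratic_field.swap[OF bq]])
    define T where "T = card {n. n dvd g * r * s}"
    have "card {n. n dvd g * r * s} \<le> card {n. n dvd (g * r) * (g * s)}"
      using nz by (intro card_mono finite_divisors_int) (auto intro: dvd_trans)
    also have "\<dots> \<le> 2 * card {n. n > 0 \<and> n dvd (g * r) * (g * s)}"
      using nz by (intro card_signed_divisors_le) simp
    also have "\<dots> \<le> 2 * (card {n. n > 0 \<and> n dvd g * r} * card {n. n > 0 \<and> n dvd g * s})"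
      by (rule mult_le_mono2[OF card_divisors_mult_le[OF nz']])
    also have "\<dots> \<le> 2 * (8 * max_classes * (8 * max_classes))"
      by (rule mult_le_mono2[OF mult_le_mono[OF 1 2]])
    finally have T: "T \<le> 2 * (8 * max_classes * (8 * max_classes))" unfolding T_def .
    have "card (divisor_pairs (nat \<bar>g * r * s\<bar>)) = T * T"
      unfolding divisor_pairs_def T_def by (simp add: card_cartesian_product)
    also have "\<dots> \<le> max_pairs" unfolding max_pairs_def power2_eq_square by (rule mult_le_mono[OF T T])
    finally have "nat \<bar>g * r * s\<bar> \<in> B" using M by (simp add: B_def)
    moreover have "K \<in> field_of_pair ` divisor_pairs (nat \<bar>g * r * s\<bar>)"
      unfolding K2 by (rule imageI[OF pair_in_divisor_pairs])
    ultimately show "K \<in> (\<Union>M\<in>B. field_of_pair ` divisor_pairs M)" by (rule UN_I)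
  qed
  moreover have finB: "finite B" unfolding B_def by simp
  moreover have finM: "finite (field_of_pair ` divisor_pairs M)" if "M \<in> B" for M
    using that by (intro finite_imageI finite_divisor_pairs) (simp add: B_def)
  ultimately have "card (up_to_discriminant euclidean_odd_biquadratic_fields x) \<le> card (\<Union>M\<in>B. field_of_pair ` divisor_pairs M)"
    by (intro card_mono finite_UN_I) simp_all
  also have "\<dots> \<le> (\<Sum>M\<in>B. card (field_of_pair ` divisor_pairs M))" using finB by (rule card_UN_le)
  also have "\<dots> \<le> (\<Sum>M\<in>B. max_pairs)"
  proof (rule sum_mono)
    fix M assume "M \<in> B"
    hence "M > 0" "card (divisor_pairs M) \<le> max_pairs" by (auto simp: B_def)
    thus "card (field_of_pair ` divisor_pairs M) \<le> max_pairs"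
      using card_image_le[OF finite_divisor_pairs, of M field_of_pair] by linarith
  qed
  also have "\<dots> = max_pairs * card B" by simp
  also have "card B \<le> card {1..nat \<lfloor>sqrt x\<rfloor>}" unfolding B_def by (intro card_mono) auto
  finally show ?thesis by simp
qed

section \<open>Lower bound for the whole family\<close>

text \<open>A positive squarefree radicand is determined by its square class, and the classes that
  become squares in the field are known. It bounds how many prime pairs can share a field.\<close>

lemma csqrt_in_K_cases:
  assumes bq: "biquadratic_field g r s \<alpha> \<beta> \<gamma>" and d: "d > 0" "squarefree d" "csqrt (of_int d) \<in> biquadratic_field.K \<alpha> \<beta> \<gamma>"
    and pos: "g * r > 0" "g * s > 0"
  shows "d \<in> {1, g * r, g * s, r * s}"
proof -
  interpret biquadratic_field g r s \<alpha> \<beta> \<gamma> by (rule bq)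
  obtain q :: rat and e where e: "e \<in> {1, g * r, g * s, r * s}" "of_int d = q\<^sup>2 * of_int e"
    using d(3) power2_csqrt by (rule rational_square_root_cases)
  have "(g * g) * (r * s) > 0" using mult_pos_pos[OF pos] by (simp add: mult_ac)
  moreover have "g * g > 0" using grs_nonzero by (simp flip: power2_eq_square)
  ultimately have "r * s > 0" by (simp only: zero_less_mult_pos)
  hence e_pos: "e > 0" "squarefree e" using e(1) pos sqf by auto
  have "of_int (d * e) = (q * of_int e)\<^sup>2" using e(2) by (simp add: power2_eq_square)
  hence "d = e" by (rule squarefree_product_square_imp_eq[OF d(1) e_pos(1) d(2) e_pos(2)])
  thus ?thesis using e(1) by simp
qed

text \<open>Radicands p and b with g = 1. The range of b depends on p, because the discriminant has
  the size of (p b)^2.\<close>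

definition prime_pairs :: "nat set \<Rightarrow> (nat \<Rightarrow> nat) \<Rightarrow> (nat \<times> nat) set" where
  "prime_pairs P J = (SIGMA p:P. {b. odd b \<and> squarefree b \<and> \<not> p dvd b \<and> 1 < b \<and> b < 2 * J p})"

lemma squarefree_int_nat: "squarefree n \<Longrightarrow> squarefree (int n)"
proof (rule squarefreeI)
  fix k assume "squarefree n" "k\<^sup>2 dvd int n"
  hence "int ((nat \<bar>k\<bar>)\<^sup>2) dvd int n" by simp
  hence "(nat \<bar>k\<bar>)\<^sup>2 dvd n" by (simp only: int_dvd_int_iff)
  hence "nat \<bar>k\<bar> dvd 1" using \<open>squarefree n\<close> by (rule squarefreeD[rotated])
  thus "is_unit k" by simp
qed

lemma prime_pair_field:
  assumes p: "prime p" "odd p" and b: "odd b" "squarefree b" "\<not> p dvd b" "1 < b"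
  obtains \<gamma> where "biquadratic_field 1 (int p) (int b) (csqrt (of_int (int p))) (csqrt (of_int (int b))) \<gamma>"
    "biquadratic_field.K (csqrt (of_int (int p))) (csqrt (of_int (int b))) \<gamma> = field_of_pair (int p, int b)"
    "field_of_pair (int p, int b) \<in> odd_biquadratic_fields"
proof -
  have cop: "coprime p b" using p(1) b(3) by (rule prime_imp_coprime)
  have sq: "squarefree (int p)" "squarefree (int b)"
    using squarefree_int_nat[OF squarefree_prime[OF p(1)]] squarefree_int_nat[OF b(2)] by simp_all
  have ne: "int p \<noteq> 1" "int b \<noteq> 1" "int p \<noteq> int b" using p b(3,4) by auto
  have odd: "odd (int p)" "odd (int b)" using p b by simp_all
  define \<gamma> where "\<gamma> = csqrt (of_int (int p)) * csqrt (of_int (int b))"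
  have s1: "csqrt (of_int (int p)) * csqrt (of_int (int p)) = of_int (int p)"
    and s2: "csqrt (of_int (int b)) * csqrt (of_int (int b)) = of_int (int b)"
    using power2_csqrt by (simp_all only: power2_eq_square[symmetric])
  have bq: "biquadratic_field 1 (int p) (int b) (csqrt (of_int (int p))) (csqrt (of_int (int b))) \<gamma>"
  proof
    show "(csqrt (of_int (int p)))\<^sup>2 = of_int (1 * int p)" "(csqrt (of_int (int b)))\<^sup>2 = of_int (1 * int b)"
      unfolding mult_1 by (rule power2_csqrt)+
    have "\<gamma>\<^sup>2 = (csqrt (of_int (int p)) * csqrt (of_int (int p))) * (csqrt (of_int (int b)) * csqrt (of_int (int b)))"
      unfolding \<gamma>_def power2_eq_square by (simp only: mult_ac)
    thus "\<gamma>\<^sup>2 = of_int (int p * int b)" unfolding s1 s2 by simp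
    show "csqrt (of_int (int p)) * csqrt (of_int (int b)) = of_int 1 * \<gamma>" by (simp add: \<gamma>_def)
    have "csqrt (of_int (int p)) * \<gamma> = (csqrt (of_int (int p)) * csqrt (of_int (int p))) * csqrt (of_int (int b))"
      unfolding \<gamma>_def by (simp only: mult_ac)
    thus "csqrt (of_int (int p)) * \<gamma> = of_int (int p) * csqrt (of_int (int b))" unfolding s1 .
    have "csqrt (of_int (int b)) * \<gamma> = (csqrt (of_int (int b)) * csqrt (of_int (int b))) * csqrt (of_int (int p))"
      unfolding \<gamma>_def by (simp only: mult_ac)
    thus "csqrt (of_int (int b)) * \<gamma> = of_int (int b) * csqrt (of_int (int p))" unfolding s2 .
    show "squarefree (1 * int p)" "squarefree (1 * int b)" using sq by simp_all
    have "coprime (int p) (int b)" using cop by simp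
    thus "squarefree (int p * int b)" using sq by (rule squarefree_mult_coprime)
    show "1 * int p \<noteq> 1" "1 * int b \<noteq> 1" using ne by simp_all
    show "int p * int b \<noteq> 1" using ne by (auto simp: zmult_eq_1_iff)
    show "odd (1 :: int)" "odd (int p)" "odd (int b)" using odd by simp_all
  qed
  have "biquadratic_field.K (csqrt (of_int (int p))) (csqrt (of_int (int b))) \<gamma> = field_of_pair (int p, int b)"
    unfolding field_of_pair_def fst_conv snd_conv by (rule biquadratic_field.generate_field_eq_K[OF bq, symmetric])
  moreover have "field_of_pair (int p, int b) \<in> odd_biquadratic_fields"
    unfolding field_of_pair_def fst_conv snd_conv by (rule generate_field_csqrt_in_family[OF odd sq ne])
  ultimately show ?thesis using that[OF bq] by blast
qed

lemma card_le_fibres: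
  assumes "finite A" "finite B" "f ` A \<subseteq> B" "\<And>a. a \<in> A \<Longrightarrow> card {a' \<in> A. f a' = f a} \<le> k"
  shows "card A \<le> k * card B"
proof -
  have "A = (\<Union>b\<in>f ` A. {a \<in> A. f a = b})" by auto
  hence "card A \<le> (\<Sum>b\<in>f ` A. card {a \<in> A. f a = b})"
    using card_UN_le[of "f ` A" "\<lambda>b. {a \<in> A. f a = b}"] assms(1) by simp
  also have "\<dots> \<le> (\<Sum>b\<in>f ` A. k)" by (rule sum_mono) (use assms(4) in auto)
  also have "\<dots> = k * card (f ` A)" by simp
  also have "\<dots> \<le> k * card B" using assms(2,3) by (intro mult_le_mono2 card_mono)
  finally show ?thesis .
qed

text \<open>The discriminant is at most (4 p b)^2 and b < 2 J p, so the condition on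
  \<open>J\<close> keeps it below x. The factor 16 = 4 * 4 arises because another pair with the same
  field has both entries among 1, p, b and p b.\<close>

lemma card_prime_pairs_le:
  assumes P: "finite P" "\<And>p. p \<in> P \<Longrightarrow> prime p \<and> odd p"
    and J: "\<And>p. p \<in> P \<Longrightarrow> 8 * real p * real (J p) \<le> sqrt x" and x: "x \<ge> 0"
  shows "card (prime_pairs P J) \<le> 16 * card (up_to_discriminant odd_biquadratic_fields x)"
proof (rule card_le_fibres[where f = "\<lambda>(p, b). field_of_pair (int p, int b)"])
  have fin_b: "finite {b. odd b \<and> squarefree b \<and> \<not> p dvd b \<and> 1 < b \<and> b < 2 * J p}" for p
    by (rule finite_subset[of _ "{..<2 * J p}"]) auto
  show fin: "finite (prime_pairs P J)"
    unfolding prime_pairs_def by (rule finite_SigmaI[OF P(1) fin_b])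
  show "finite (up_to_discriminant odd_biquadratic_fields x)" by (rule finite_up_to_discriminant)
  have pairD: "prime p \<and> odd p \<and> odd b \<and> squarefree b \<and> \<not> p dvd b \<and> 1 < b \<and> p \<in> P \<and> b < 2 * J p"
    if "(p, b) \<in> prime_pairs P J" for p b
    using that P(2)[of p] by (auto simp: prime_pairs_def)
  show "(\<lambda>(p, b). field_of_pair (int p, int b)) ` prime_pairs P J \<subseteq> up_to_discriminant odd_biquadratic_fields x"
  proof (rule image_subsetI, clarify)
    fix p b assume "(p, b) \<in> prime_pairs P J"
    note pb = pairD[OF this]
    obtain \<gamma> where bq: "biquadratic_field 1 (int p) (int b) (csqrt (of_int (int p))) (csqrt (of_int (int b))) \<gamma>" and
      K: "biquadratic_field.K (csqrt (of_int (int p))) (csqrt (of_int (int b))) \<gamma> = field_of_pair (int p, int b)" and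
      fam: "field_of_pair (int p, int b) \<in> odd_biquadratic_fields"
      using prime_pair_field[of p b] pb by blast
    have "\<bar>discriminant (field_of_pair (int p, int b))\<bar> \<le> 16 * (1 * int p * int b)\<^sup>2"
      unfolding K[symmetric] by (rule biquadratic_field.abs_discriminant(2)[OF bq])
    hence "real_of_int \<bar>discriminant (field_of_pair (int p, int b))\<bar> \<le> real_of_int (16 * (1 * int p * int b)\<^sup>2)"
      by (simp only: of_int_le_iff)
    also have "\<dots> = (4 * real p * real b)\<^sup>2" by (simp add: power_mult_distrib)
    also have "\<dots> \<le> (sqrt x)\<^sup>2"
    proof (rule power_mono)
      have "real b \<le> 2 * real (J p)" using pb by linarith
      hence "4 * real p * real b \<le> 4 * real p * (2 * real (J p))" by (intro mult_left_mono) auto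
      also have "\<dots> \<le> sqrt x" using J[of p] pb by simp
      finally show "4 * real p * real b \<le> sqrt x" .
    qed simp
    also have "\<dots> = x" using x by simp
    finally show "field_of_pair (int p, int b) \<in> up_to_discriminant odd_biquadratic_fields x"
      using fam unfolding up_to_discriminant_def by simp
  qed
  fix a assume "a \<in> prime_pairs P J"
  then obtain p b where a: "a = (p, b)" and pb': "(p, b) \<in> prime_pairs P J" by (cases a) simp
  note pb = pairD[OF pb']
  obtain \<gamma> where bq: "biquadratic_field 1 (int p) (int b) (csqrt (of_int (int p))) (csqrt (of_int (int b))) \<gamma>" and
    K: "biquadratic_field.K (csqrt (of_int (int p))) (csqrt (of_int (int b))) \<gamma> = field_of_pair (int p, int b)"
    using prime_pair_field[of p b] pb by blast
  define V where "V = nat ` {1, 1 * int p, 1 * int b, int p * int b}"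
  have pos: "1 * int p > 0" "1 * int b > 0" using pb prime_gt_0_nat[of p] by simp_all
  have "{a' \<in> prime_pairs P J. (\<lambda>(p, b). field_of_pair (int p, int b)) a' = (\<lambda>(p, b). field_of_pair (int p, int b)) a} \<subseteq> V \<times> V"
  proof (rule subsetI)
    fix a' assume a': "a' \<in> {a' \<in> prime_pairs P J. (\<lambda>(p, b). field_of_pair (int p, int b)) a' = (\<lambda>(p, b). field_of_pair (int p, int b)) a}"
    obtain p' b' where pb': "a' = (p', b')" by (cases a')
    have pb'': "(p', b') \<in> prime_pairs P J"
      and eq: "(case a of (p, b) \<Rightarrow> field_of_pair (int p, int b)) = field_of_pair (int p', int b')"
      using a' unfolding pb' by simp_all
    note pb2 = pairD[OF pb'']
    have "csqrt (of_int (int p')) \<in> field_of_pair (int p', int b')" "csqrt (of_int (int b')) \<in> field_of_pair (int p', int b')"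
      unfolding field_of_pair_def by (simp_all add: generate_field.incl)
    hence in_K: "csqrt (of_int (int p')) \<in> biquadratic_field.K (csqrt (of_int (int p))) (csqrt (of_int (int b))) \<gamma>"
      "csqrt (of_int (int b')) \<in> biquadratic_field.K (csqrt (of_int (int p))) (csqrt (of_int (int b))) \<gamma>"
      using eq unfolding K a by simp_all
    have "int p' \<in> {1, 1 * int p, 1 * int b, int p * int b}"
      by (rule csqrt_in_K_cases[OF bq _ _ in_K(1) pos])
        (use pb2 prime_gt_0_nat[of p'] squarefree_int_nat[OF squarefree_prime[of p']] in simp_all)
    hence "nat (int p') \<in> V" unfolding V_def by (rule imageI)
    moreover have "int b' \<in> {1, 1 * int p, 1 * int b, int p * int b}"
      by (rule csqrt_in_K_cases[OF bq _ _ in_K(2) pos]) (use pb2 squarefree_int_nat[of b'] in simp_all)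
    hence "nat (int b') \<in> V" unfolding V_def by (rule imageI)
    ultimately show "a' \<in> V \<times> V" unfolding pb' by simp
  qed
  moreover have "finite V" by (simp add: V_def)
  ultimately have "card {a' \<in> prime_pairs P J. (\<lambda>(p, b). field_of_pair (int p, int b)) a' = (\<lambda>(p, b). field_of_pair (int p, int b)) a}
    \<le> card (V \<times> V)"
    by (intro card_mono) simp_all
  also have "\<dots> = card V * card V" by (rule card_cartesian_product)
  also have "\<dots> \<le> 4 * 4"
  proof -
    have "card V \<le> 4"
      using card_length[of "map nat [1, 1 * int p, 1 * int b, int p * int b]"] by (simp add: V_def)
    thus ?thesis by (intro mult_le_mono)
  qed
  finally show "card {a' \<in> prime_pairs P J. (\<lambda>(p, b). field_of_pair (int p, int b)) a' = (\<lambda>(p, b). field_of_pair (int p, int b)) a} \<le> 16"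
    by simp
qed

text \<open>Growth is measured against sqrt x. For each p there are at least sqrt x / (16 p)
  candidates j, of which a quarter survive the sieve, and fields are counted at most 16 times; hence
  1024 = 16 * 4 * 16.\<close>

lemma family_count_superlinear:
  fixes H :: real
  shows "\<forall>\<^sub>F x in at_top. H * sqrt x \<le> real (card (up_to_discriminant odd_biquadratic_fields x))"
proof -
  obtain P :: "nat set" where P: "finite P" "\<forall>p\<in>P. prime p \<and> odd p" "(\<Sum>p\<in>P. 1 / real p) \<ge> 1024 * H"
    using ex_odd_primes_reciprocal_sum_ge by blast
  define N where "N = Max (insert 1 P)"
  have N: "p \<le> N" if "p \<in> P" for p unfolding N_def using P(1) that by (intro Max_ge) auto
  have "N \<ge> 1" unfolding N_def using P(1) by (intro Max_ge) auto
  have main: "H * sqrt x \<le> real (card (up_to_discriminant odd_biquadratic_fields x))"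
    \<comment> \<open>This makes sqrt x / (8 p) at least 250, so that \<open>J p\<close> is at least
      200 even after rounding and the sieve applies to every p in \<open>P\<close>.\<close>
    if x: "x \<ge> (2000 * real N)\<^sup>2" for x
  proof -
    have x0: "x \<ge> 0" using x zero_le_power2[of "2000 * real N"] by linarith
    have sx: "sqrt x \<ge> 2000 * real N" using x by (rule real_le_rsqrt)
    define J where "J p = nat \<lfloor>sqrt x / (8 * real p)\<rfloor>" for p
    have pp: "p > 0" if "p \<in> P" for p using P(2) that prime_gt_0_nat by blast
    have J_le: "8 * real p * real (J p) \<le> sqrt x" if "p \<in> P" for p
    proof -
      have "real (J p) \<le> sqrt x / (8 * real p)" unfolding J_def using x0 by (intro of_nat_floor) simp
      thus ?thesis using pp[OF that] by (simp add: field_simps)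
    qed
    have J_ge: "J p \<ge> 200 \<and> real (J p) \<ge> sqrt x / (16 * real p)" if "p \<in> P" for p
    proof -
      have p: "real p > 0" "real p \<le> real N" using pp[OF that] N[OF that] by simp_all
      have "2000 * real p \<le> sqrt x" using sx p by linarith
      hence big: "250 \<le> sqrt x / (8 * real p)" using p by (simp add: field_simps)
      have fl: "real (J p) > sqrt x / (8 * real p) - 1"
        unfolding J_def using big by linarith
      have "sqrt x / (8 * real p) = sqrt x / (16 * real p) + sqrt x / (16 * real p)" using p by (simp add: field_simps)
      hence "real (J p) \<ge> sqrt x / (16 * real p)" using fl big by linarith
      moreover have "J p \<ge> 200" using fl big by linarith
      ultimately show ?thesis by blast
    qed
    let ?G = "\<lambda>p. {b. odd b \<and> squarefree b \<and> \<not> p dvd b \<and> 1 < b \<and> b < 2 * J p}"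
    have finG: "finite (?G p)" for p by (rule finite_subset[of _ "{..<2 * J p}"]) auto
    have "sqrt x / 64 * (\<Sum>p\<in>P. 1 / real p) = (\<Sum>p\<in>P. sqrt x / (16 * real p) / 4)"
      by (simp add: sum_distrib_left)
    also have "\<dots> \<le> (\<Sum>p\<in>P. real (card (?G p)))"
    proof (rule sum_mono)
      fix p assume p: "p \<in> P"
      have "sqrt x / (16 * real p) / 4 \<le> real (J p) / 4"
        using J_ge[OF p] by (intro divide_right_mono) auto
      also have "\<dots> \<le> real (card (?G p))" using P(2) p J_ge[OF p] by (intro odd_squarefree_count) auto
      finally show "sqrt x / (16 * real p) / 4 \<le> real (card (?G p))" .
    qed
    also have "\<dots> = real (card (prime_pairs P J))"
      unfolding prime_pairs_def using P(1) finG by (simp add: card_SigmaI)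
    also have "\<dots> \<le> real (16 * card (up_to_discriminant odd_biquadratic_fields x))"
      unfolding of_nat_le_iff using P J_le x0 by (intro card_prime_pairs_le) auto
    finally have "sqrt x / 64 * (\<Sum>p\<in>P. 1 / real p) \<le> 16 * real (card (up_to_discriminant odd_biquadratic_fields x))" by simp
    moreover have "sqrt x / 64 * (1024 * H) \<le> sqrt x / 64 * (\<Sum>p\<in>P. 1 / real p)"
      using P(3) x0 by (intro mult_left_mono) auto
    ultimately show ?thesis by (simp add: mult.commute)
  qed
  show ?thesis using main unfolding eventually_at_top_linorder by blast
qed

theorem theorem1p4:
  shows "((\<lambda>x :: real.
            real (card (up_to_discriminant euclidean_odd_biquadratic_fields x)) /
            real (card (up_to_discriminant odd_biquadratic_fields x))) \<longlongrightarrow> 0) at_top"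
proof (rule tendstoI)
  fix e :: real assume e: "e > 0"
  \<comment> \<open>Chosen so that the quotient of the two counts is at most e / 2; the added 1
    makes the positivity of H immediate.\<close>
  define H where "H = 2 * (real max_pairs + 1) / e"
  have H: "H > 0" using e by (simp add: H_def add_nonneg_pos)
  show "\<forall>\<^sub>F x in at_top. dist (real (card (up_to_discriminant euclidean_odd_biquadratic_fields x)) /
    real (card (up_to_discriminant odd_biquadratic_fields x))) 0 < e"
    using family_count_superlinear[of H] eventually_gt_at_top[of 0]
  proof eventually_elim
    case (elim x)
    let ?E = "real (card (up_to_discriminant euclidean_odd_biquadratic_fields x))"
    let ?S = "real (card (up_to_discriminant odd_biquadratic_fields x))"
    have sx: "sqrt x > 0" using elim(2) by simp
    have "?E \<le> real (max_pairs * nat \<lfloor>sqrt x\<rfloor>)" unfolding of_nat_le_iff by (rule card_euclidean_le)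
    also have "\<dots> \<le> real max_pairs * sqrt x"
      unfolding of_nat_mult using sx by (intro mult_left_mono of_nat_floor) auto
    also have "\<dots> \<le> (real max_pairs + 1) * sqrt x" using sx by (intro mult_right_mono) auto
    also have "\<dots> = e / 2 * (H * sqrt x)" using e by (simp add: H_def)
    also have "\<dots> \<le> e / 2 * ?S" using elim(1) e by (intro mult_left_mono) auto
    finally have le: "?E \<le> e / 2 * ?S" .
    have "?S > 0" using elim(1) mult_pos_pos[OF H sx] by linarith
    hence "?E / ?S \<le> e / 2" using le by (simp only: pos_divide_le_eq)
    moreover have "?E / ?S \<ge> 0" by simp
    ultimately show ?case using e unfolding dist_real_def by linarith
  qed
qed

end
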